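(* Let $\{\mathcal{E}_{s,t}\}_{0\le s\le t\le T}$ be an $\{\mathcal{F}_t\}$-consistent dynamic operator with zero floor such that (a) there is $\mu>0$ with $\mathcal{E}_{0,T}[X+Y]-\mathcal{E}_{0,T}[X]\le\mathcal{E}^\mu[Y]$ for all $X,Y\in L^2_+(\mathcal{F}_T)$, and (b) $\mathcal{E}_{t,T}[X+Y]=\mathcal{E}_{t,T}[X]+Y$ a.s. for all $t\in[0,T]$, $X\in L^2_+(\mathcal{F}_T)$, $Y\in L^2_+(\mathcal{F}_t)$. For $X\in L^2(\mathcal{F}_T)$ and $t\in[0,T]$ let $$\widehat{\mathcal{E}}[X|\mathcal{F}_t]:=\lim_{n\to\infty}\bigl(\mathcal{E}_{t,T}[X1_{\{X\ge-n\}}+n]-n\bigr)\quad\text{(limit in }L^2(\mathcal{F}_t)),\qquad \widehat{\mathcal{E}}[X]:=\widehat{\mathcal{E}}[X|\mathcal{F}_0].$$ Then $\widehat{\mathcal{E}}$ satisfies: 1. $\widehat{\mathcal{E}}[X+Y]-\widehat{\mathcal{E}}[X]\le\mathcal{E}^\mu[Y]$ for all $X\in L^2(\mathcal{F}_T)$, $Y\in L^2_+(\mathcal{F}_T)$; 2. $\widehat{\mathcal{E}}[X+Y|\mathcal{F}_t]=\widehat{\mathcal{E}}[X|\mathcal{F}_t]+Y$ a.s. for all $t\in[0,T]$, $X\in L^2(\mathcal{F}_T)$, $Y\in L^2(\mathcal{F}_t)$; 3. if $X,Y\in L^2(\mathcal{F}_T)$ and $Y\ge X$ a.s., then $\widehat{\mathcal{E}}[Y|\mathcal{F}_t]\ge\widehat{\mathcal{E}}[X|\mathcal{F}_t]$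 a.s. for all $t\in[0,T]$; and if moreover $\widehat{\mathcal{E}}[Y|\mathcal{F}_t]=\widehat{\mathcal{E}}[X|\mathcal{F}_t]$ a.s. for some $t$, then $Y=X$ a.s.; 4. $\widehat{\mathcal{E}}[Y|\mathcal{F}_t]=Y$ a.s. for all $t\in[0,T]$ and $Y\in L^2(\mathcal{F}_t)$; 5. $\widehat{\mathcal{E}}[\widehat{\mathcal{E}}[X|\mathcal{F}_t]\,|\,\mathcal{F}_s]=\widehat{\mathcal{E}}[X|\mathcal{F}_s]$ a.s. for all $0\le s\le t\le T$ and $X\in L^2(\mathcal{F}_T)$; 6. $\widehat{\mathcal{E}}[1_AX|\mathcal{F}_t]=1_A\widehat{\mathcal{E}}[X|\mathcal{F}_t]$ a.s. for all $t\in[0,T]$, $A\in\mathcal{F}_t$, $X\in L^2(\mathcal{F}_T)$. Consequently $\widehat{\mathcal{E}}$ is an $\{\mathcal{F}_t\}$-consistent expectation on $L^2(\mathcal{F}_T)$.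
   Context: $B$ is a $d$-dimensional standard Brownian motion on $(\Omega,\mathcal{F},P)$ and $\{\mathcal{F}_t\}_{0\le t\le T}$ is its natural filtration augmented by all $P$-null sets. $L^2(\mathcal{F}_t)$ is the space of square-integrable $\mathcal{F}_t$-measurable real random variables, and $L^2_+(\mathcal{F}_t)$ is its subset of a.s. nonnegative elements. $\mathcal{E}^{\mu}[Y]:=y_0$, where $(y,z)$ is the unique square-integrable adapted solution of $y_t=Y+\int_t^T\mu|z_s|\,ds-\int_t^T\langle z_s,dB_s\rangle$, $0\le t\le T$. An $\{\mathcal{F}_t\}$-consistent dynamic operator with zero floor is a family of maps $\mathcal{E}_{s,t}:L^2_+(\mathcal{F}_t)\to L^2_+(\mathcal{F}_s)$, $0\le s\le t\le T$, with $s\mapsto\mathcal{E}_{s,t}[Y]$ continuous on $[0,t]$ for every $t$ and $Y\in L^2_+(\mathcal{F}_t)$, such that: (D1) $Y\ge Y'$ a.s. implies $\mathcal{E}_{s,t}[Y]\ge\mathcal{E}_{s,t}[Y']$ a.s.; and if, for some $r\in[0,t]$, $\mathcal{E}_{s,t}[Y]>0$ a.s. for every $s\in[r,t]$, then $Y'\ge Y$ a.s. and $\mathcal{E}_{r,t}[Y']=\mathcal{E}_{r,t}[Y]$ a.s. imply $Y'=Y$ a.s.; (D2) $\mathcal{E}_{s,t}[Y]=Y$ a.s. for $Y\in L^2_+(\mathcal{F}_s)$; (D3) $\mathcal{E}_{r,s}[\mathcal{E}_{s,t}[Y]]=\mathcal{E}_{r,t}[Y]$ a.s. for $r\le s\le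 t$, $Y\in L^2_+(\mathcal{F}_t)$; (D4) $\mathcal{E}_{s,t}[1_AY]=1_A\mathcal{E}_{s,t}[Y]$ a.s. for $s\le t$, $A\in\mathcal{F}_s$, $Y\in L^2_+(\mathcal{F}_t)$. The $L^2(\mathcal{F}_t)$-limit defining $\widehat{\mathcal{E}}[X|\mathcal{F}_t]$ exists under (a) and (b). An $\{\mathcal{F}_t\}$-consistent expectation is a functional $\mathcal{E}:L^2(\mathcal{F}_T)\to\mathbb{R}$ such that: (E1) $Y_1\le Y_2$ a.s. implies $\mathcal{E}[Y_1]\le\mathcal{E}[Y_2]$, and if moreover $\mathcal{E}[Y_1]=\mathcal{E}[Y_2]$ then $Y_1=Y_2$ a.s.; (E2) $\mathcal{E}[c]=c$ for every constant $c$; (E3) for every $t\in[0,T]$ and $Y\in L^2(\mathcal{F}_T)$ there is a unique $\eta\in L^2(\mathcal{F}_t)$ with $\mathcal{E}[\eta1_A]=\mathcal{E}[Y1_A]$ for all $A\in\mathcal{F}_t$. *)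

theory Defs
  imports "HOL-Probability.Probability"
begin

section \<open>Brownian motion and its augmented filtration\<close>

definition natural_filtration ::
    "'a measure \<Rightarrow> (real \<Rightarrow> 'a \<Rightarrow> 'b::topological_space) \<Rightarrow> real \<Rightarrow> 'a measure" where
  "natural_filtration M B t =
     sigma (space M) {B r -` A \<inter> space M | r A. r \<in> {0..t} \<and> A \<in> sets borel}"

definition augmented_filtration ::
    "'a measure \<Rightarrow> (real \<Rightarrow> 'a \<Rightarrow> 'b::topological_space) \<Rightarrow> real \<Rightarrow> 'a measure" where
  "augmented_filtration M B t = sigma (space M) (sets (natural_filtration M B t) \<union> null_sets M)"

text \<open>Standard Brownian motion in dimension \<open>CARD('d)\<close> on the time interval \<open>[0,T]\<close>; the
  density below is that of \<open>N(0, (t - s) I)\<close>.\<close>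

definition brownian_motion ::
    "'a measure \<Rightarrow> real \<Rightarrow> (real \<Rightarrow> 'a \<Rightarrow> real ^ 'd) \<Rightarrow> bool" where
  "brownian_motion M T B \<longleftrightarrow>
     prob_space M \<and>
     (\<forall>t\<in>{0..T}. B t \<in> borel_measurable M) \<and>
     (AE \<omega> in M. B 0 \<omega> = 0) \<and>
     (AE \<omega> in M. continuous_on {0..T} (\<lambda>t. B t \<omega>)) \<and>
     (\<forall>s t. 0 \<le> s \<and> s < t \<and> t \<le> T \<longrightarrow>
        distributed M lborel (\<lambda>\<omega>. B t \<omega> - B s \<omega>)
          (\<lambda>x. ennreal (\<Prod>i\<in>UNIV. normal_density 0 (sqrt (t - s)) (x $ i))) \<and>
        prob_space.indep_set M (sets (natural_filtration M B s))
          (sets (vimage_algebra (space M) (\<lambda>\<omega>. B t \<omega> - B s \<omega>) borel)))"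

section \<open>Square-integrable random variables\<close>

text \<open>Elements are representatives; a statement about elements of the quotient space is
  rendered as an almost sure statement. \<open>G\<close> is a sub-sigma-algebra and only its measurable
  sets matter; integrals and null sets are those of \<open>M\<close>.\<close>

definition L2 :: "'a measure \<Rightarrow> 'a measure \<Rightarrow> ('a \<Rightarrow> real) set" where
  "L2 M G = {Y \<in> borel_measurable G. integrable M (\<lambda>\<omega>. (Y \<omega>)\<^sup>2)}"

definition L2_plus :: "'a measure \<Rightarrow> 'a measure \<Rightarrow> ('a \<Rightarrow> real) set" where
  "L2_plus M G = {Y \<in> L2 M G. AE \<omega> in M. 0 \<le> Y \<omega>}"

text \<open>The real number with which an almost surely constant random variable is identified.\<close>

definition ae_const :: "'a measure \<Rightarrow> ('a \<Rightarrow> real) \<Rightarrow> real" where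
  "ae_const M Y = (THE c. AE \<omega> in M. Y \<omega> = c)"

section \<open>Ito integral\<close>

definition progressive ::
    "(real \<Rightarrow> 'a measure) \<Rightarrow> real \<Rightarrow> (real \<Rightarrow> 'a \<Rightarrow> 'b::topological_space) \<Rightarrow> bool" where
  "progressive F T z \<longleftrightarrow>
     (\<forall>t\<in>{0..T}. (\<lambda>(s, \<omega>). z s \<omega>) \<in> borel_measurable (restrict_space borel {0..t} \<Otimes>\<^sub>M F t))"

definition sq_norm_H2 ::
    "'a measure \<Rightarrow> real \<Rightarrow> (real \<Rightarrow> 'a \<Rightarrow> 'b::real_normed_vector) \<Rightarrow> ennreal" where
  "sq_norm_H2 M T z =
     (\<integral>\<^sup>+\<omega>. (\<integral>\<^sup>+s\<in>{0..T}. ennreal ((norm (z s \<omega>))\<^sup>2) \<partial>lborel) \<partial>M)"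

definition H2 ::
    "'a measure \<Rightarrow> (real \<Rightarrow> 'a measure) \<Rightarrow> real \<Rightarrow> (real \<Rightarrow> 'a \<Rightarrow> 'b::real_normed_vector) set" where
  "H2 M F T = {z. progressive F T z \<and> sq_norm_H2 M T z < \<infinity>}"

text \<open>The triple \<open>(n, \<tau>, \<xi>)\<close> encodes the simple process taking the value \<open>\<xi> i\<close> on
  \<open>(\<tau> i, \<tau> (i + 1)]\<close> for \<open>i < n\<close>.\<close>

definition simple_integrand ::
    "'a measure \<Rightarrow> (real \<Rightarrow> 'a measure) \<Rightarrow> real \<Rightarrow>
     nat \<Rightarrow> (nat \<Rightarrow> real) \<Rightarrow> (nat \<Rightarrow> 'a \<Rightarrow> real ^ 'd) \<Rightarrow> bool" where
  "simple_integrand M F T n \<tau> \<xi> \<longleftrightarrow>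
     \<tau> 0 = 0 \<and> \<tau> n = T \<and> (\<forall>i<n. \<tau> i < \<tau> (Suc i)) \<and>
     (\<forall>i<n. \<xi> i \<in> borel_measurable (F (\<tau> i)) \<and> (\<exists>C. \<forall>\<omega>\<in>space M. norm (\<xi> i \<omega>) \<le> C))"

definition simple_process ::
    "nat \<Rightarrow> (nat \<Rightarrow> real) \<Rightarrow> (nat \<Rightarrow> 'a \<Rightarrow> real ^ 'd) \<Rightarrow> real \<Rightarrow> 'a \<Rightarrow> real ^ 'd" where
  "simple_process n \<tau> \<xi> s \<omega> = (\<Sum>i<n. indicator {\<tau> i<..\<tau> (Suc i)} s *\<^sub>R \<xi> i \<omega>)"

definition simple_ito_integral ::
    "(real \<Rightarrow> 'a \<Rightarrow> real ^ 'd) \<Rightarrow> nat \<Rightarrow> (nat \<Rightarrow> real) \<Rightarrow> (nat \<Rightarrow> 'a \<Rightarrow> real ^ 'd) \<Rightarrow>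
     real \<Rightarrow> 'a \<Rightarrow> real" where
  "simple_ito_integral B n \<tau> \<xi> t \<omega> =
     (\<Sum>i<n. \<xi> i \<omega> \<bullet> (B (min t (\<tau> (Suc i))) \<omega> - B (min t (\<tau> i)) \<omega>))"

text \<open>\<open>I t\<close> is a version of the integral of \<open>z\<close> against \<open>B\<close> over \<open>[0,t]\<close>: the limit in mean
  square of the integrals of simple processes approximating \<open>z\<close>.\<close>

definition has_ito_integral ::
    "'a measure \<Rightarrow> (real \<Rightarrow> 'a measure) \<Rightarrow> (real \<Rightarrow> 'a \<Rightarrow> real ^ 'd) \<Rightarrow> real \<Rightarrow>
     (real \<Rightarrow> 'a \<Rightarrow> real ^ 'd) \<Rightarrow> (real \<Rightarrow> 'a \<Rightarrow> real) \<Rightarrow> bool" where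
  "has_ito_integral M F B T z I \<longleftrightarrow>
     z \<in> H2 M F T \<and> (\<forall>t\<in>{0..T}. I t \<in> borel_measurable M) \<and>
     (\<exists>n \<tau> \<xi>.
        (\<forall>k::nat. simple_integrand M F T (n k) (\<tau> k) (\<xi> k)) \<and>
        (\<lambda>k. sq_norm_H2 M T (\<lambda>s \<omega>. simple_process (n k) (\<tau> k) (\<xi> k) s \<omega> - z s \<omega>))
          \<longlonglongrightarrow> 0 \<and>
        (\<forall>t\<in>{0..T}.
           (\<lambda>k. \<integral>\<^sup>+\<omega>. ennreal ((simple_ito_integral B (n k) (\<tau> k) (\<xi> k) t \<omega> - I t \<omega>)\<^sup>2) \<partial>M)
             \<longlonglongrightarrow> 0))"

section \<open>The backward equation and the associated expectation\<close>

definition solves_bsde ::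
    "'a measure \<Rightarrow> (real \<Rightarrow> 'a measure) \<Rightarrow> (real \<Rightarrow> 'a \<Rightarrow> real ^ 'd) \<Rightarrow> real \<Rightarrow> real \<Rightarrow>
     ('a \<Rightarrow> real) \<Rightarrow> (real \<Rightarrow> 'a \<Rightarrow> real) \<Rightarrow> (real \<Rightarrow> 'a \<Rightarrow> real ^ 'd) \<Rightarrow> bool" where
  "solves_bsde M F B T \<mu> Y y z \<longleftrightarrow>
     y \<in> H2 M F T \<and> z \<in> H2 M F T \<and>
     (\<exists>I. has_ito_integral M F B T z I \<and>
        (\<forall>t\<in>{0..T}. AE \<omega> in M.
           y t \<omega> = Y \<omega> + (LINT s:{t..T}|lborel. \<mu> * norm (z s \<omega>)) - (I T \<omega> - I t \<omega>)))"

text \<open>The relation ``the expectation of \<open>Y\<close> with parameter \<open>\<mu>\<close> is \<open>c\<close>''. The initial value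
  \<open>y 0\<close> is measurable with respect to a trivial sigma-algebra, hence almost surely constant.\<close>

definition has_g_expectation ::
    "'a measure \<Rightarrow> (real \<Rightarrow> 'a measure) \<Rightarrow> (real \<Rightarrow> 'a \<Rightarrow> real ^ 'd) \<Rightarrow> real \<Rightarrow> real \<Rightarrow>
     ('a \<Rightarrow> real) \<Rightarrow> real \<Rightarrow> bool" where
  "has_g_expectation M F B T \<mu> Y c \<longleftrightarrow>
     (\<exists>y z. solves_bsde M F B T \<mu> Y y z \<and> (AE \<omega> in M. y 0 \<omega> = c))"

section \<open>Consistent dynamic operators and consistent expectations\<close>

text \<open>Since \<open>E s t Y\<close> is only determined up to null sets, continuity in \<open>s\<close> is expressed by the
  existence of a modification with continuous paths.\<close>

definition consistent_operator_zero_floor ::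
    "'a measure \<Rightarrow> (real \<Rightarrow> 'a measure) \<Rightarrow> real \<Rightarrow>
     (real \<Rightarrow> real \<Rightarrow> ('a \<Rightarrow> real) \<Rightarrow> 'a \<Rightarrow> real) \<Rightarrow> bool" where
  "consistent_operator_zero_floor M F T E \<longleftrightarrow>
     (\<forall>s t Y. 0 \<le> s \<and> s \<le> t \<and> t \<le> T \<and> Y \<in> L2_plus M (F t) \<longrightarrow> E s t Y \<in> L2_plus M (F s)) \<and>
     (\<forall>t\<in>{0..T}. \<forall>Y\<in>L2_plus M (F t).
        \<exists>Z. (\<forall>\<omega>\<in>space M. continuous_on {0..t} (\<lambda>s. Z s \<omega>)) \<and>
            (\<forall>s\<in>{0..t}. AE \<omega> in M. Z s \<omega> = E s t Y \<omega>)) \<and>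
     (\<forall>s t. 0 \<le> s \<and> s \<le> t \<and> t \<le> T \<longrightarrow>
        (\<forall>Y\<in>L2_plus M (F t). \<forall>Y'\<in>L2_plus M (F t).
           (AE \<omega> in M. Y' \<omega> \<le> Y \<omega>) \<longrightarrow> (AE \<omega> in M. E s t Y' \<omega> \<le> E s t Y \<omega>))) \<and>
     (\<forall>r t. 0 \<le> r \<and> r \<le> t \<and> t \<le> T \<longrightarrow>
        (\<forall>Y\<in>L2_plus M (F t). \<forall>Y'\<in>L2_plus M (F t).
           (\<forall>s\<in>{r..t}. AE \<omega> in M. 0 < E s t Y \<omega>) \<longrightarrow>
           (AE \<omega> in M. Y \<omega> \<le> Y' \<omega>) \<longrightarrow>
           (AE \<omega> in M. E r t Y' \<omega> = E r t Y \<omega>) \<longrightarrow>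
           (AE \<omega> in M. Y' \<omega> = Y \<omega>))) \<and>
     (\<forall>s t. 0 \<le> s \<and> s \<le> t \<and> t \<le> T \<longrightarrow>
        (\<forall>Y\<in>L2_plus M (F s). AE \<omega> in M. E s t Y \<omega> = Y \<omega>)) \<and>
     (\<forall>r s t. 0 \<le> r \<and> r \<le> s \<and> s \<le> t \<and> t \<le> T \<longrightarrow>
        (\<forall>Y\<in>L2_plus M (F t). AE \<omega> in M. E r s (E s t Y) \<omega> = E r t Y \<omega>)) \<and>
     (\<forall>s t. 0 \<le> s \<and> s \<le> t \<and> t \<le> T \<longrightarrow>
        (\<forall>A\<in>sets (F s). \<forall>Y\<in>L2_plus M (F t).
           AE \<omega> in M. E s t (\<lambda>\<omega>. indicator A \<omega> * Y \<omega>) \<omega> = indicator A \<omega> * E s t Y \<omega>))"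

definition consistent_expectation ::
    "'a measure \<Rightarrow> (real \<Rightarrow> 'a measure) \<Rightarrow> real \<Rightarrow> (('a \<Rightarrow> real) \<Rightarrow> real) \<Rightarrow> bool" where
  "consistent_expectation M F T \<E> \<longleftrightarrow>
     (\<forall>Y1\<in>L2 M (F T). \<forall>Y2\<in>L2 M (F T). (AE \<omega> in M. Y1 \<omega> \<le> Y2 \<omega>) \<longrightarrow>
        \<E> Y1 \<le> \<E> Y2 \<and> (\<E> Y1 = \<E> Y2 \<longrightarrow> (AE \<omega> in M. Y1 \<omega> = Y2 \<omega>))) \<and>
     (\<forall>c. \<E> (\<lambda>\<omega>. c) = c) \<and>
     \<comment> \<open>uniqueness is up to null sets\<close>
     (\<forall>t\<in>{0..T}. \<forall>Y\<in>L2 M (F T).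
        \<exists>\<eta>\<in>L2 M (F t).
          (\<forall>A\<in>sets (F t). \<E> (\<lambda>\<omega>. \<eta> \<omega> * indicator A \<omega>) = \<E> (\<lambda>\<omega>. Y \<omega> * indicator A \<omega>)) \<and>
          (\<forall>\<eta>'\<in>L2 M (F t).
             (\<forall>A\<in>sets (F t). \<E> (\<lambda>\<omega>. \<eta>' \<omega> * indicator A \<omega>) = \<E> (\<lambda>\<omega>. Y \<omega> * indicator A \<omega>))
             \<longrightarrow> (AE \<omega> in M. \<eta>' \<omega> = \<eta> \<omega>)))"

section \<open>The extension of a dynamic operator to all of \<open>L\<^sup>2\<close>\<close>

definition is_L2_limit ::
    "'a measure \<Rightarrow> 'a measure \<Rightarrow> (nat \<Rightarrow> 'a \<Rightarrow> real) \<Rightarrow> ('a \<Rightarrow> real) \<Rightarrow> bool" where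
  "is_L2_limit M G U \<eta> \<longleftrightarrow>
     (\<forall>n. U n \<in> L2 M G) \<and> \<eta> \<in> L2 M G \<and> (\<lambda>n. \<integral>\<omega>. (U n \<omega> - \<eta> \<omega>)\<^sup>2 \<partial>M) \<longlonglongrightarrow> 0"

text \<open>A version of the limit is chosen by \<open>SOME\<close>; any two versions agree almost surely.\<close>

definition ext_cond ::
    "'a measure \<Rightarrow> (real \<Rightarrow> 'a measure) \<Rightarrow> real \<Rightarrow>
     (real \<Rightarrow> real \<Rightarrow> ('a \<Rightarrow> real) \<Rightarrow> 'a \<Rightarrow> real) \<Rightarrow> real \<Rightarrow> ('a \<Rightarrow> real) \<Rightarrow> 'a \<Rightarrow> real" where
  "ext_cond M F T E t X =
     (SOME \<eta>. is_L2_limit M (F t)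
        (\<lambda>n \<omega>. E t T (\<lambda>\<omega>'. X \<omega>' * indicator {\<omega>''. X \<omega>'' \<ge> - real n} \<omega>' + real n) \<omega> - real n) \<eta>)"

definition ext ::
    "'a measure \<Rightarrow> (real \<Rightarrow> 'a measure) \<Rightarrow> real \<Rightarrow>
     (real \<Rightarrow> real \<Rightarrow> ('a \<Rightarrow> real) \<Rightarrow> 'a \<Rightarrow> real) \<Rightarrow> ('a \<Rightarrow> real) \<Rightarrow> real" where
  "ext M F T E X = ae_const M (ext_cond M F T E 0 X)"

end

theory Submission
  imports Defs
begin

text \<open>Changing the measure by the stochastic exponential of a simple integrand bounded by \<open>\<mu>\<close> turns
  the terminal value of the backward equation into its initial value, up to an error tending to \<open>0\<close>,
  and no such change of measure gives more. Hence the \<open>g\<close>-expectation is a limit of expectations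
  under densities \<open>\<Gamma>\<close> for which the means of \<open>\<Gamma>\<^sup>2\<close> and of \<open>1 / \<Gamma>\<close> are bounded by
  \<open>exp (\<mu>\<^sup>2 T)\<close>; only the Cameron--Martin formula for a single Gaussian increment is needed. The bound
  on \<open>\<Gamma>\<^sup>2\<close> gives an \<open>L\<^sup>2\<close> estimate for the backward equation, the one on \<open>1 / \<Gamma>\<close> strict comparison.
  Together with strict monotonicity of the operator, domination of \<open>E 0 T\<close> localises to domination of
  \<open>E t T\<close> by the solution of the backward equation at time \<open>t\<close>. So \<open>E t T\<close> is Lipschitz in \<open>L\<^sup>2\<close>, and
  the extension inherits its properties by density of the variables that are bounded below.\<close>

section \<open>Gaussian increments\<close>

text \<open>Hypothesis (a) speaks of time \<open>0\<close> only, and it is also the source of every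
  solution of the backward equation used below, always with a nonnegative terminal value. The best
  density is read off from the equation: when \<open>z\<close> is replaced by a simple process
  \<open>\<xi>\<close>, the choice \<open>\<theta> = \<mu> sgn \<xi>\<close> gives
  \<open>\<theta> \<bullet> \<xi> = \<mu> |\<xi>|\<close> and removes the drift exactly, while any
  other \<open>\<theta>\<close> bounded by \<open>\<mu>\<close> gives
  \<open>\<theta> \<bullet> \<xi> \<le> \<mu> |\<xi>|\<close>, hence an inequality. The constant
  comes from the identity that the \<open>p\<close>-th power of the exponential of
  \<open>\<theta>\<close> is the exponential of \<open>p \<theta>\<close> times \<open>exp\<close>
  of \<open>(p\<^sup>2 - p) / 2\<close> times the time integral of
  \<open>|\<theta>|\<^sup>2\<close>. The floor is the other obstacle: strict monotonicity of the
  operator is granted only for arguments whose values stay positive. Adding a constant moves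
  arguments away from zero, and hypothesis (b) removes the constant again. For the extension, whose
  arguments may be unbounded below, strictness is proved anew from domination.\<close>

abbreviation gaussian_density :: "real \<Rightarrow> real ^ 'd \<Rightarrow> ennreal" where
  "gaussian_density h x \<equiv> ennreal (\<Prod>i\<in>UNIV. normal_density 0 (sqrt h) (x $ i))"

lemma measurable_gaussian_density [measurable]:
  "gaussian_density h \<in> borel_measurable borel"
  by measurable

text \<open>Completing the square in each coordinate: \<open>v x - v\<^sup>2 h / 2 - x\<^sup>2 / (2
  h) = - (x - h v)\<^sup>2 / (2 h)\<close>.\<close>

lemma gaussian_density_shift:
  fixes v x :: "real ^ 'd"
  assumes "0 < h"
  shows "ennreal (exp (v \<bullet> x - (norm v)\<^sup>2 / 2 * h)) * gaussian_density h x
    = gaussian_density h (x - h *\<^sub>R v)"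
proof -
  have 1: "exp (v $ i * x $ i - (v $ i)\<^sup>2 / 2 * h) * normal_density 0 (sqrt h) (x $ i)
      = normal_density 0 (sqrt h) ((x - h *\<^sub>R v) $ i)" for i
    using assms unfolding normal_density_def
    by (simp add: exp_add[symmetric] field_simps power2_eq_square flip: exp_add)
  have 2: "v \<bullet> x - (norm v)\<^sup>2 / 2 * h = (\<Sum>i\<in>UNIV. v $ i * x $ i - (v $ i)\<^sup>2 / 2 * h)"
    unfolding power2_norm_eq_inner inner_vec_def sum_subtractf sum_distrib_right
        sum_divide_distrib by (simp add: power2_eq_square)
  have "exp (v \<bullet> x - (norm v)\<^sup>2 / 2 * h) * (\<Prod>i\<in>UNIV. normal_density 0 (sqrt h) (x $ i))
      = (\<Prod>i\<in>UNIV. normal_density 0 (sqrt h) ((x - h *\<^sub>R v) $ i))"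
    unfolding 2 exp_sum[OF finite] prod.distrib[symmetric] 1 ..
  thus ?thesis
    by (simp add: ennreal_mult[symmetric] prod_nonneg)
qed

lemma nn_integral_lborel_translate:
  fixes c :: "'a::euclidean_space"
  assumes [measurable]: "f \<in> borel_measurable borel"
  shows "(\<integral>\<^sup>+x. f (x + c) \<partial>lborel) = (\<integral>\<^sup>+x. f x \<partial>lborel)"
proof -
  have "(\<integral>\<^sup>+x. f x \<partial>lborel) = (\<integral>\<^sup>+x. f x \<partial>distr lborel borel ((+) c))"
    by (simp add: lborel_distr_plus)
  also have "\<dots> = (\<integral>\<^sup>+x. f (c + x) \<partial>lborel)"
    by (rule nn_integral_distr) auto
  finally show ?thesis by (simp add: add.commute)
qed

lemma nn_integral_lborel_uminus:
  fixes f :: "'a::euclidean_space \<Rightarrow> ennreal"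
  assumes [measurable]: "f \<in> borel_measurable borel"
  shows "(\<integral>\<^sup>+x. f (- x) \<partial>lborel) = (\<integral>\<^sup>+x. f x \<partial>lborel)"
proof -
  have "(\<integral>\<^sup>+x. f x \<partial>lborel)
      = (\<integral>\<^sup>+x. f x \<partial>density (distr lborel borel (\<lambda>x. 0 + (-1) *\<^sub>R x)) (\<lambda>_. ennreal (\<bar>-1\<bar> ^ DIM('a))))"
    by (subst lborel_affine[where c="-1" and t=0]) auto
  also have "\<dots> = (\<integral>\<^sup>+x. f (- x) \<partial>lborel)"
    by (subst nn_integral_density, simp, simp, subst nn_integral_distr) auto
  finally show ?thesis by simp
qed

context prob_space
begin

text \<open>The exponential weight turns the density into its translate by \<open>h v\<close>, and
  Lebesgue measure is translation invariant. With nonnegative integrals no integrability has to be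
  checked beforehand.\<close>

lemma gaussian_cameron_martin:
  fixes X :: "'a \<Rightarrow> real ^ 'd"
  assumes X: "distributed M lborel X (gaussian_density h)" and "0 < h"
    and [measurable]: "f \<in> borel_measurable borel"
  shows "(\<integral>\<^sup>+w. ennreal (exp (v \<bullet> X w - (norm v)\<^sup>2 / 2 * h)) * f (X w) \<partial>M)
    = (\<integral>\<^sup>+w. f (X w + h *\<^sub>R v) \<partial>M)"
proof -
  have "(\<integral>\<^sup>+w. ennreal (exp (v \<bullet> X w - (norm v)\<^sup>2 / 2 * h)) * f (X w) \<partial>M)
      = (\<integral>\<^sup>+x. gaussian_density h x * (ennreal (exp (v \<bullet> x - (norm v)\<^sup>2 / 2 * h)) * f x) \<partial>lborel)"
    by (rule distributed_nn_integral[OF X, symmetric]) measurable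
  also have "\<dots> = (\<integral>\<^sup>+x. gaussian_density h (x - h *\<^sub>R v) * f x \<partial>lborel)"
    by (simp only: gaussian_density_shift[OF \<open>0 < h\<close>, symmetric] mult_ac)
  also have "\<dots> = (\<integral>\<^sup>+x. gaussian_density h x * f (x + h *\<^sub>R v) \<partial>lborel)"
    using nn_integral_lborel_translate[where c="h *\<^sub>R v"
        and f="\<lambda>x. gaussian_density h (x - h *\<^sub>R v) * f x"] by simp
  also have "\<dots> = (\<integral>\<^sup>+w. f (X w + h *\<^sub>R v) \<partial>M)"
    by (rule distributed_nn_integral[OF X]) measurable
  finally show ?thesis .
qed

lemma gaussian_symmetric:
  fixes X :: "'a \<Rightarrow> real ^ 'd"
  assumes X: "distributed M lborel X (gaussian_density h)"
    and [measurable]: "f \<in> borel_measurable borel"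
  shows "(\<integral>\<^sup>+w. f (- X w) \<partial>M) = (\<integral>\<^sup>+w. f (X w) \<partial>M)"
proof -
  have "(\<integral>\<^sup>+w. f (- X w) \<partial>M) = (\<integral>\<^sup>+x. gaussian_density h x * f (- x) \<partial>lborel)"
    by (rule distributed_nn_integral[OF X, symmetric]) measurable
  also have "\<dots> = (\<integral>\<^sup>+x. gaussian_density h (- x) * f x \<partial>lborel)"
    using nn_integral_lborel_uminus[where f="\<lambda>x. gaussian_density h (- x) * f x"] by simp
  also have "\<dots> = (\<integral>\<^sup>+x. gaussian_density h x * f x \<partial>lborel)"
    by (simp add: normal_density_def)
  also have "\<dots> = (\<integral>\<^sup>+w. f (X w) \<partial>M)"
    by (rule distributed_nn_integral[OF X]) measurable
  finally show ?thesis .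
qed

text \<open>Taking \<open>f\<close> constant in the Cameron--Martin formula shows that exponential
  moments are finite, and \<open>x\<^sup>2 \<le> 2 exp x + 2 exp (- x)\<close> bounds each
  coordinate.\<close>

lemma gaussian_square_integrable:
  fixes X :: "'a \<Rightarrow> real ^ 'd"
  assumes X: "distributed M lborel X (gaussian_density h)" and "0 < h"
  shows "integrable M (\<lambda>w. (norm (X w))\<^sup>2)"
proof -
  have [measurable]: "X \<in> borel_measurable M"
    using distributed_measurable[OF X] by simp
  have e: "integrable M (\<lambda>w. exp (v \<bullet> X w))" for v
  proof -
    have "(\<integral>\<^sup>+w. ennreal (exp (v \<bullet> X w)) \<partial>M)
        = (\<integral>\<^sup>+w. ennreal (exp (v \<bullet> X w - (norm v)\<^sup>2 / 2 * h)) * ennreal (exp ((norm v)\<^sup>2 / 2 * h)) \<partial>M)"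
      by (simp add: ennreal_mult[symmetric] exp_add[symmetric])
    also have "\<dots> = ennreal (exp ((norm v)\<^sup>2 / 2 * h))"
      by (subst gaussian_cameron_martin[OF X \<open>0 < h\<close>]) (auto simp: emeasure_space_1)
    finally show ?thesis
      by (intro integrableI_bounded) auto
  qed
  have [measurable]: "(\<lambda>w. X w $ i) \<in> borel_measurable M" for i
    using measurable_compose[OF \<open>X \<in> borel_measurable M\<close> borel_measurable_continuous_onI[OF continuous_on_component[OF continuous_on_id]]] .
  have "integrable M (\<lambda>w. (X w $ i)\<^sup>2)" for i
  proof (rule Bochner_Integration.integrable_bound)
    show "integrable M (\<lambda>w. 2 * exp (axis i 1 \<bullet> X w) + 2 * exp (axis i (-1) \<bullet> X w))"
      using e by auto
    have q: "x\<^sup>2 \<le> 2 * exp x + 2 * exp (- x)" for x :: real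
    proof -
      have nn: "x\<^sup>2 \<le> 2 * exp x" if "0 \<le> x" for x :: real
        using exp_lower_Taylor_quadratic[OF that] that by simp
      show ?thesis
      proof (cases "0 \<le> x")
        case True
        show ?thesis using nn[OF True] exp_gt_zero[of "-x"] by linarith
      next
        case False
        then show ?thesis using nn[of "-x"] exp_gt_zero[of "x"] by (simp; linarith)
      qed
    qed
    show "AE w in M. norm ((X w $ i)\<^sup>2)
        \<le> norm (2 * exp (axis i 1 \<bullet> X w) + 2 * exp (axis i (-1) \<bullet> X w))"
      using q by (auto simp: inner_axis inner_commute[of "axis _ _"] intro: order.trans[OF q])
  qed simp
  hence "integrable M (\<lambda>w. \<Sum>i\<in>UNIV. (X w $ i)\<^sup>2)" by auto
  thus ?thesis
    by (simp add: norm_vec_def L2_set_def sum_nonneg)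
qed

text \<open>The freezing rule: given the past \<open>G\<close>, the dependence on \<open>w\<close>
  may be held fixed while the independent variable \<open>X\<close> is integrated out.\<close>

lemma nn_integral_indep_sigma_algebra:
  assumes "space G = space M" "sets G \<subseteq> events"
    and X[measurable]: "X \<in> borel_measurable M"
    and ind: "indep_set (sets G) (sets (vimage_algebra (space M) X borel))"
    and \<Phi>[measurable]: "\<Phi> \<in> borel_measurable (G \<Otimes>\<^sub>M borel)"
  shows "(\<integral>\<^sup>+w. \<Phi> (w, X w) \<partial>M) = (\<integral>\<^sup>+w. \<integral>\<^sup>+w'. \<Phi> (w, X w') \<partial>M \<partial>M)"
proof -
  have id[measurable]: "(\<lambda>w. w) \<in> measurable M G"
    using assms(1,2) by (intro measurableI) (auto dest: sets.sets_into_space simp: Int_absorb2)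
  \<comment> \<open>The identity is treated as a random element with values in \<open>G\<close>;
    independence says that its joint law with \<open>X\<close> is the product of the two laws, which
    is checked on rectangles.\<close>
  have eq: "distr M G (\<lambda>w. w) \<Otimes>\<^sub>M distr M borel X = distr M (G \<Otimes>\<^sub>M borel) (\<lambda>w. (w, X w))"
  proof (rule pair_measure_eqI)
    fix A B assume "A \<in> sets (distr M G (\<lambda>w. w))" and "B \<in> sets (distr M borel X)"
    hence A: "A \<in> sets G" and B: "B \<in> sets borel" by auto
    have "A \<subseteq> space M" using sets.sets_into_space[OF A] assms(1) by simp
    hence 1: "(\<lambda>w. w) -` A \<inter> space M = A"
      "(\<lambda>w. (w, X w)) -` (A \<times> B) \<inter> space M = A \<inter> (X -` B \<inter> space M)" by auto
    have "X -` B \<inter> space M \<in> sets (vimage_algebra (space M) X borel)"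
      using B by (rule in_vimage_algebra)
    hence "prob (A \<inter> (X -` B \<inter> space M)) = prob A * prob (X -` B \<inter> space M)"
      using ind A by (auto simp: indep_sets2_eq)
    thus "emeasure (distr M G (\<lambda>w. w)) A * emeasure (distr M borel X) B
        = emeasure (distr M (G \<Otimes>\<^sub>M borel) (\<lambda>w. (w, X w))) (A \<times> B)"
      using A B by (simp add: emeasure_distr 1 emeasure_eq_measure ennreal_mult''
            Int_absorb2[OF \<open>A \<subseteq> space M\<close>])
  qed (auto intro!: prob_space_distr prob_space_imp_sigma_finite cong: sets_pair_measure_cong)
  interpret D: prob_space "distr M borel X" by (rule prob_space_distr) simp
  have "(\<integral>\<^sup>+w. \<Phi> (w, X w) \<partial>M) = (\<integral>\<^sup>+p. \<Phi> p \<partial>distr M (G \<Otimes>\<^sub>M borel) (\<lambda>w. (w, X w)))"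
    by (subst nn_integral_distr) auto
  also have "\<dots> = (\<integral>\<^sup>+w. \<integral>\<^sup>+x. \<Phi> (w, x) \<partial>distr M borel X \<partial>distr M G (\<lambda>w. w))"
    unfolding eq[symmetric] by (subst D.nn_integral_fst[symmetric]) auto
  also have "\<dots> = (\<integral>\<^sup>+w. \<integral>\<^sup>+x. \<Phi> (w, x) \<partial>distr M borel X \<partial>M)"
    by (subst nn_integral_distr) auto
  also have "\<dots> = (\<integral>\<^sup>+w. \<integral>\<^sup>+w'. \<Phi> (w, X w') \<partial>M \<partial>M)"
    by (intro nn_integral_cong, subst nn_integral_distr) (auto simp: assms(1)[symmetric])
  finally show ?thesis .
qed

end

section \<open>The augmented Brownian filtration\<close>

locale augmented_brownian = prob_space M for M :: "'a measure" +
  fixes T :: real and B :: "real \<Rightarrow> 'a \<Rightarrow> real ^ 'd"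
  assumes T_pos: "0 < T" and brownian: "brownian_motion M T B"
begin

abbreviation F :: "real \<Rightarrow> 'a measure" where
  "F \<equiv> augmented_filtration M B"

lemma measurable_brownian: "0 \<le> t \<Longrightarrow> t \<le> T \<Longrightarrow> B t \<in> borel_measurable M"
  using brownian by (auto simp: brownian_motion_def)

lemma space_natural [simp]: "space (natural_filtration M B t) = space M"
  by (simp add: natural_filtration_def space_measure_of_conv)

lemma space_augmented [simp]: "space (F t) = space M"
  by (simp add: augmented_filtration_def space_measure_of_conv)

lemma sets_natural_subset: "t \<le> T \<Longrightarrow> sets (natural_filtration M B t) \<subseteq> events"
  unfolding natural_filtration_def
  by (subst sets_measure_of) (auto intro!: sets.sigma_sets_subset measurable_sets measurable_brownian)

lemma augmented_generators: "t \<le> T \<Longrightarrow> sets (natural_filtration M B t) \<union> null_sets M \<subseteq> Pow (space M)"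
  using sets_natural_subset sets.sets_into_space by (fastforce simp: null_sets_def)

lemma sets_augmented:
  "t \<le> T \<Longrightarrow> sets (F t) = sigma_sets (space M) (sets (natural_filtration M B t) \<union> null_sets M)"
  unfolding augmented_filtration_def by (rule sets_measure_of) (rule augmented_generators)

lemma sets_augmented_subset: "t \<le> T \<Longrightarrow> sets (F t) \<subseteq> events"
  using sets_natural_subset by (auto simp: sets_augmented intro!: sets.sigma_sets_subset)

lemma sets_natural_mono:
  "s \<le> t \<Longrightarrow> t \<le> T \<Longrightarrow> sets (natural_filtration M B s) \<subseteq> sets (natural_filtration M B t)"
  unfolding natural_filtration_def
  by (subst (1 2) sets_measure_of) (fastforce intro!: sigma_sets_mono')+

lemma sets_augmented_mono: "s \<le> t \<Longrightarrow> t \<le> T \<Longrightarrow> sets (F s) \<subseteq> sets (F t)"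
  using sets_natural_mono[of s t] by (auto simp: sets_augmented intro!: sigma_sets_mono')

lemma measurable_augmented_mono:
  "X \<in> measurable (F s) N \<Longrightarrow> s \<le> t \<Longrightarrow> t \<le> T \<Longrightarrow> X \<in> measurable (F t) N"
  using sets_augmented_mono[of s t] by (auto simp: measurable_def)

lemma measurable_augmented_imp: "X \<in> measurable (F s) N \<Longrightarrow> s \<le> T \<Longrightarrow> X \<in> measurable M N"
  using sets_augmented_subset[of s] by (auto simp: measurable_def)

lemma brownian_adapted:
  assumes "0 \<le> s" "s \<le> t" "t \<le> T"
  shows "B s \<in> borel_measurable (F t)"
proof (rule measurableI)
  fix A :: "(real ^ 'd) set" assume "A \<in> sets borel"
  hence "B s -` A \<inter> space M \<in> sets (natural_filtration M B t)"
    using assms unfolding natural_filtration_def by (subst sets_measure_of) auto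
  thus "B s -` A \<inter> space (F t) \<in> sets (F t)"
    using assms by (auto simp: sets_augmented)
qed simp

text \<open>The sets that agree almost surely with a set of the natural filtration form a
  sigma-algebra containing all null sets. This carries independence, and triviality at time
  \<open>0\<close>, over to the augmentation.\<close>

lemma augmented_ae_natural:
  assumes "t \<le> T" "A \<in> sets (F t)"
  shows "\<exists>A'\<in>sets (natural_filtration M B t). AE w in M. w \<in> A \<longleftrightarrow> w \<in> A'"
  using assms(2) unfolding sets_augmented[OF assms(1)]
proof (induction rule: sigma_sets.induct)
  case (Basic A)
  show ?case
  proof (cases "A \<in> null_sets M")
    case True
    hence "AE w in M. w \<in> A \<longleftrightarrow> w \<in> {}" using AE_not_in by fastforce
    thus ?thesis by blast
  next
    case False
    thus ?thesis using Basic by (intro bexI[of _ A]) auto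
  qed
next
  case Empty
  show ?case by (intro bexI[of _ "{}"]) auto
next
  case (Compl A)
  then obtain A' where "A' \<in> sets (natural_filtration M B t)" "AE w in M. w \<in> A \<longleftrightarrow> w \<in> A'" by auto
  thus ?case
    using sets.compl_sets[of A' "natural_filtration M B t"]
    by (intro bexI[of _ "space M - A'"]) auto
next
  case (Union A)
  then obtain A' where A': "\<And>i. A' i \<in> sets (natural_filtration M B t)"
    "\<And>i. AE w in M. w \<in> A i \<longleftrightarrow> w \<in> A' i" by metis
  have "AE w in M. \<forall>i. w \<in> A i \<longleftrightarrow> w \<in> A' i" using A'(2) by (simp add: AE_all_countable)
  thus ?case using A'(1) by (intro bexI[of _ "\<Union>i. A' i"]) auto
qed

lemma increment_distributed:
  "0 \<le> s \<Longrightarrow> s < t \<Longrightarrow> t \<le> T \<Longrightarrow> distributed M lborel (\<lambda>w. B t w - B s w) (gaussian_density (t - s))"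
  using brownian unfolding brownian_motion_def by blast

text \<open>Brownian motion is assumed independent of its natural past only; replacing an event by
  an almost surely equal one changes no probability.\<close>

lemma increment_indep:
  assumes "0 \<le> s" "s < t" "t \<le> T"
  shows "indep_set (sets (F s)) (sets (vimage_algebra (space M) (\<lambda>w. B t w - B s w) borel))"
proof -
  let ?V = "sets (vimage_algebra (space M) (\<lambda>w. B t w - B s w) borel)"
  have ind: "indep_set (sets (natural_filtration M B s)) ?V"
    using brownian assms unfolding brownian_motion_def by blast
  hence V: "?V \<subseteq> events"
    and prod: "\<And>a b. a \<in> sets (natural_filtration M B s) \<Longrightarrow> b \<in> ?V \<Longrightarrow> prob (a \<inter> b) = prob a * prob b"
    by (auto simp: indep_sets2_eq)
  show ?thesis unfolding indep_sets2_eq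
  proof (intro conjI ballI)
    show "sets (F s) \<subseteq> events" using assms by (intro sets_augmented_subset) auto
    show "?V \<subseteq> events" by (rule V)
    fix A b assume A: "A \<in> sets (F s)" and b: "b \<in> ?V"
    obtain A' where A': "A' \<in> sets (natural_filtration M B s)" "AE w in M. w \<in> A \<longleftrightarrow> w \<in> A'"
      using augmented_ae_natural[of s A] A assms by auto
    have ev: "A \<in> events" "A' \<in> events" "b \<in> events"
      using A A'(1) b V sets_augmented_subset[of s] sets_natural_subset[of s] assms by auto
    have "prob A = prob A'" "prob (A \<inter> b) = prob (A' \<inter> b)"
      using A'(2) ev by (auto intro!: finite_measure_eq_AE)
    thus "prob (A \<inter> b) = prob A * prob b" using prod[OF A'(1) b] by simp
  qed
qed

section \<open>Integrals of functions of the past and of one increment\<close>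

lemma nn_integral_increment:
  assumes st: "0 \<le> s" "s < t" "t \<le> T"
    and [measurable]: "\<Phi> \<in> borel_measurable (F s \<Otimes>\<^sub>M borel)"
  shows "(\<integral>\<^sup>+w. \<Phi> (w, B t w - B s w) \<partial>M)
    = (\<integral>\<^sup>+w. \<integral>\<^sup>+w'. \<Phi> (w, B t w' - B s w') \<partial>M \<partial>M)"
proof (rule nn_integral_indep_sigma_algebra)
  show "sets (F s) \<subseteq> events" using st by (intro sets_augmented_subset) auto
  show "(\<lambda>w. B t w - B s w) \<in> borel_measurable M"
    using st by (intro borel_measurable_diff measurable_brownian) auto
  show "indep_set (sets (F s)) (sets (vimage_algebra (space M) (\<lambda>w. B t w - B s w) borel))"
    by (rule increment_indep[OF st])
qed (use assms in auto)

lemma measurable_increment_pair: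
  assumes st: "0 \<le> s" "s < t" "t \<le> T"
    and g: "g \<in> measurable (F s \<Otimes>\<^sub>M borel) N"
  shows "(\<lambda>w. g (w, B t w - B s w)) \<in> measurable M N"
proof -
  have [measurable]: "(\<lambda>w. w) \<in> measurable M (F s)"
    using measurable_augmented_imp[of "\<lambda>w. w" s "F s"] st by auto
  have "(\<lambda>w. B t w - B s w) \<in> borel_measurable M"
    using st by (intro borel_measurable_diff measurable_brownian) auto
  hence "(\<lambda>w. (w, B t w - B s w)) \<in> measurable M (F s \<Otimes>\<^sub>M borel)" by measurable
  from measurable_compose[OF this g] show ?thesis .
qed

text \<open>Girsanov's theorem for one time step: with the past frozen, \<open>\<theta> w\<close> is
  a constant vector and the Gaussian formula applies to the increment alone.\<close>

lemma nn_cameron_martin_increment: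
  assumes st: "0 \<le> s" "s < t" "t \<le> T"
    and \<Phi>[measurable]: "\<Phi> \<in> borel_measurable (F s \<Otimes>\<^sub>M borel)"
    and \<theta>[measurable]: "\<theta> \<in> borel_measurable (F s)"
  shows "(\<integral>\<^sup>+w. ennreal (exp (\<theta> w \<bullet> (B t w - B s w) - (norm (\<theta> w))\<^sup>2 / 2 * (t - s)))
             * \<Phi> (w, B t w - B s w) \<partial>M)
    = (\<integral>\<^sup>+w. \<Phi> (w, B t w - B s w + (t - s) *\<^sub>R \<theta> w) \<partial>M)"
proof -
  let ?\<Psi> = "\<lambda>(w, x). ennreal (exp (\<theta> w \<bullet> x - (norm (\<theta> w))\<^sup>2 / 2 * (t - s))) * \<Phi> (w, x)"
  have m: "(\<lambda>x. \<Phi> (w, x)) \<in> borel_measurable borel" if "w \<in> space M" for w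
    using measurable_compose[OF measurable_Pair1' \<Phi>, of w] that by simp
  have "(\<integral>\<^sup>+w. ?\<Psi> (w, B t w - B s w) \<partial>M) = (\<integral>\<^sup>+w. \<integral>\<^sup>+w'. ?\<Psi> (w, B t w' - B s w') \<partial>M \<partial>M)"
    by (rule nn_integral_increment[OF st]) measurable
  also have "\<dots> = (\<integral>\<^sup>+w. \<integral>\<^sup>+w'. \<Phi> (w, B t w' - B s w' + (t - s) *\<^sub>R \<theta> w) \<partial>M \<partial>M)"
  proof (rule nn_integral_cong)
    fix w assume "w \<in> space M"
    from gaussian_cameron_martin[OF increment_distributed[OF st] _ m[OF this], of "\<theta> w"] st
    show "(\<integral>\<^sup>+w'. ?\<Psi> (w, B t w' - B s w') \<partial>M)
        = (\<integral>\<^sup>+w'. \<Phi> (w, B t w' - B s w' + (t - s) *\<^sub>R \<theta> w) \<partial>M)" by simp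
  qed
  also have "\<dots> = (\<integral>\<^sup>+w. (\<lambda>(w, x). \<Phi> (w, x + (t - s) *\<^sub>R \<theta> w)) (w, B t w - B s w) \<partial>M)"
    using nn_integral_increment[OF st, of "\<lambda>(w, x). \<Phi> (w, x + (t - s) *\<^sub>R \<theta> w)"] by simp
  finally show ?thesis by simp
qed

lemma nn_symmetric_increment:
  assumes st: "0 \<le> s" "s < t" "t \<le> T"
    and \<Phi>[measurable]: "\<Phi> \<in> borel_measurable (F s \<Otimes>\<^sub>M borel)"
  shows "(\<integral>\<^sup>+w. \<Phi> (w, - (B t w - B s w)) \<partial>M) = (\<integral>\<^sup>+w. \<Phi> (w, B t w - B s w) \<partial>M)"
proof -
  have m: "(\<lambda>x. \<Phi> (w, x)) \<in> borel_measurable borel" if "w \<in> space M" for w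
    using measurable_compose[OF measurable_Pair1' \<Phi>, of w] that by simp
  have "(\<integral>\<^sup>+w. (\<lambda>(w, x). \<Phi> (w, - x)) (w, B t w - B s w) \<partial>M)
      = (\<integral>\<^sup>+w. \<integral>\<^sup>+w'. (\<lambda>(w, x). \<Phi> (w, - x)) (w, B t w' - B s w') \<partial>M \<partial>M)"
    by (rule nn_integral_increment[OF st]) measurable
  also have "\<dots> = (\<integral>\<^sup>+w. \<integral>\<^sup>+w'. \<Phi> (w, B t w' - B s w') \<partial>M \<partial>M)"
  proof (rule nn_integral_cong)
    fix w assume "w \<in> space M"
    from gaussian_symmetric[OF increment_distributed[OF st] m[OF this]]
    show "(\<integral>\<^sup>+w'. (\<lambda>(w, x). \<Phi> (w, - x)) (w, B t w' - B s w') \<partial>M)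
        = (\<integral>\<^sup>+w'. \<Phi> (w, B t w' - B s w') \<partial>M)" by simp
  qed
  also have "\<dots> = (\<integral>\<^sup>+w. \<Phi> (w, B t w - B s w) \<partial>M)"
    by (rule nn_integral_increment[OF st, symmetric]) measurable
  finally show ?thesis by simp
qed

lemma cameron_martin_increment:
  fixes \<Phi> :: "'a \<times> (real ^ 'd) \<Rightarrow> real"
  assumes st: "0 \<le> s" "s < t" "t \<le> T"
    and \<Phi>[measurable]: "\<Phi> \<in> borel_measurable (F s \<Otimes>\<^sub>M borel)"
    and \<theta>[measurable]: "\<theta> \<in> borel_measurable (F s)"
    and int: "integrable M (\<lambda>w. \<Phi> (w, B t w - B s w + (t - s) *\<^sub>R \<theta> w))" (is "integrable M ?f")
  shows "has_bochner_integral M (\<lambda>w. exp (\<theta> w \<bullet> (B t w - B s w) - (norm (\<theta> w))\<^sup>2 / 2 * (t - s))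
             * \<Phi> (w, B t w - B s w)) (\<integral>w. \<Phi> (w, B t w - B s w + (t - s) *\<^sub>R \<theta> w) \<partial>M)"
    (is "has_bochner_integral M ?g _")
proof -
  \<comment> \<open>As \<open>ennreal\<close> cuts off negative numbers, \<open>k = 1\<close> and
    \<open>k = -1\<close> yield the integrals of the positive and of the negative part.\<close>
  have eq: "(\<integral>\<^sup>+w. ennreal (k * ?g w) \<partial>M) = (\<integral>\<^sup>+w. ennreal (k * ?f w) \<partial>M)" for k
    using nn_cameron_martin_increment[OF st _ \<theta>, of "\<lambda>p. ennreal (k * \<Phi> p)"]
    by (simp add: ennreal_mult'[symmetric] ennreal_mult''[symmetric] mult_ac)
  have eq_abs: "(\<integral>\<^sup>+w. ennreal (norm (?g w)) \<partial>M) = (\<integral>\<^sup>+w. ennreal (norm (?f w)) \<partial>M)"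
    using nn_cameron_martin_increment[OF st _ \<theta>, of "\<lambda>p. ennreal \<bar>\<Phi> p\<bar>"]
    by (simp add: ennreal_mult'[symmetric] ennreal_mult''[symmetric] abs_mult mult_ac)
  have "?g \<in> borel_measurable M"
    using measurable_increment_pair[OF st, of "\<lambda>(w, x). exp (\<theta> w \<bullet> x - (norm (\<theta> w))\<^sup>2 / 2 * (t - s)) * \<Phi> (w, x)"]
    by simp
  hence ig: "integrable M ?g"
    using int eq_abs by (simp add: integrable_iff_bounded)
  have "integral\<^sup>L M ?g = integral\<^sup>L M ?f"
    unfolding real_lebesgue_integral_def[OF ig] real_lebesgue_integral_def[OF int]
    using eq[of 1] eq[of "-1"] by simp
  thus ?thesis using ig by (simp add: has_bochner_integral_iff)
qed

end

section \<open>Exponential martingales of simple integrands\<close>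

context augmented_brownian
begin

lemma increment_square_integrable:
  assumes "0 \<le> s" "s \<le> t" "t \<le> T"
  shows "integrable M (\<lambda>w. (norm (B t w - B s w))\<^sup>2)"
  using gaussian_square_integrable[OF increment_distributed[of s t]] assms
  by (cases "s = t") auto

text \<open>\<open>W\<close> is merely integrable, so square-integrability of the increment would
  not suffice; independence factorises the mean of
  \<open>norm (W w) * norm (B t w - B s w)\<close>.\<close>

lemma inner_increment_integrable:
  assumes st: "0 \<le> s" "s < t" "t \<le> T"
    and W[measurable]: "W \<in> borel_measurable (F s)" and int: "integrable M W"
  shows "integrable M (\<lambda>w. W w \<bullet> (B t w - B s w))"
proof -
  have [measurable]: "W \<in> borel_measurable M" using measurable_augmented_imp[OF W] st by simp
  have [measurable]: "B t \<in> borel_measurable M" "B s \<in> borel_measurable M"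
    using st by (intro measurable_brownian; linarith)+
  have i: "integrable M (\<lambda>w. norm (B t w - B s w))"
  proof (rule square_integrable_imp_integrable)
    show "integrable M (\<lambda>w. (norm (B t w - B s w))\<^sup>2)"
      using st by (intro increment_square_integrable) linarith+
  qed measurable
  have "(\<integral>\<^sup>+w. ennreal (norm (W w)) * ennreal (norm (B t w - B s w)) \<partial>M)
      = (\<integral>\<^sup>+w. \<integral>\<^sup>+w'. ennreal (norm (W w)) * ennreal (norm (B t w' - B s w')) \<partial>M \<partial>M)"
    using nn_integral_increment[OF st, of "\<lambda>(w, x). ennreal (norm (W w)) * ennreal (norm x)"] by simp
  also have "\<dots> = (\<integral>\<^sup>+w. ennreal (norm (W w)) \<partial>M) * (\<integral>\<^sup>+w'. ennreal (norm (B t w' - B s w')) \<partial>M)"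
    by (subst nn_integral_cmult, simp, subst nn_integral_multc) auto
  also have "\<dots> < \<infinity>"
    using int i by (simp add: integrable_iff_bounded ennreal_mult_less_top)
  finally have "integrable M (\<lambda>w. norm (W w) * norm (B t w - B s w))"
    by (intro integrableI_bounded) (auto simp: ennreal_mult)
  thus ?thesis
    by (rule Bochner_Integration.integrable_bound) (auto intro: Cauchy_Schwarz_ineq2)
qed

text \<open>Given the past the increment is symmetric, so the positive and the negative part of the
  product have the same mean.\<close>

lemma inner_increment_mean:
  assumes st: "0 \<le> s" "s < t" "t \<le> T"
    and W[measurable]: "W \<in> borel_measurable (F s)" and int: "integrable M W"
  shows "(\<integral>w. W w \<bullet> (B t w - B s w) \<partial>M) = 0"
proof -
  have "(\<integral>\<^sup>+w. ennreal (W w \<bullet> - (B t w - B s w)) \<partial>M) = (\<integral>\<^sup>+w. ennreal (W w \<bullet> (B t w - B s w)) \<partial>M)"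
    using nn_symmetric_increment[OF st, of "\<lambda>(w, x). ennreal (W w \<bullet> x)"] by simp
  hence "(\<integral>\<^sup>+w. ennreal (- (W w \<bullet> (B t w - B s w))) \<partial>M) = (\<integral>\<^sup>+w. ennreal (W w \<bullet> (B t w - B s w)) \<partial>M)"
    unfolding inner_minus_right .
  thus ?thesis
    unfolding real_lebesgue_integral_def[OF inner_increment_integrable[OF assms]] by simp
qed

text \<open>The change of measure shifts the increment by \<open>(t - s) \<theta>\<close>; the
  unshifted part has mean zero and the shift contributes
  \<open>(t - s) W \<bullet> \<theta>\<close>.\<close>

lemma inner_increment_girsanov:
  assumes st: "0 \<le> s" "s < t" "t \<le> T"
    and W[measurable]: "W \<in> borel_measurable (F s)" and int: "integrable M W"
    and \<theta>[measurable]: "\<theta> \<in> borel_measurable (F s)"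
    and bd: "\<And>w. w \<in> space M \<Longrightarrow> norm (\<theta> w) \<le> m"
  shows "has_bochner_integral M (\<lambda>w. exp (\<theta> w \<bullet> (B t w - B s w) - (norm (\<theta> w))\<^sup>2 / 2 * (t - s))
             * (W w \<bullet> (B t w - B s w))) ((t - s) * (\<integral>w. W w \<bullet> \<theta> w \<partial>M))"
proof -
  have [measurable]: "W \<in> borel_measurable M" "\<theta> \<in> borel_measurable M"
    using measurable_augmented_imp[OF W] measurable_augmented_imp[OF \<theta>] st by auto
  have i1: "integrable M (\<lambda>w. W w \<bullet> (B t w - B s w))"
    by (rule inner_increment_integrable[OF st W int])
  have i2: "integrable M (\<lambda>w. W w \<bullet> \<theta> w)"
  proof (rule Bochner_Integration.integrable_bound)
    show "integrable M (\<lambda>w. m * norm (W w))" using int by auto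
    have "norm (W w \<bullet> \<theta> w) \<le> norm (m * norm (W w))" if "w \<in> space M" for w
    proof -
      have "norm (W w \<bullet> \<theta> w) \<le> norm (W w) * norm (\<theta> w)" by (simp add: Cauchy_Schwarz_ineq2)
      also have "\<dots> \<le> norm (W w) * m" using bd[OF that] by (intro mult_left_mono) auto
      also have "\<dots> \<le> norm (m * norm (W w))" using abs_ge_self[of "m * norm (W w)"] by (simp add: mult.commute)
      finally show ?thesis .
    qed
    thus "AE w in M. norm (W w \<bullet> \<theta> w) \<le> norm (m * norm (W w))" by auto
  qed measurable
  have i: "integrable M (\<lambda>w. W w \<bullet> (B t w - B s w + (t - s) *\<^sub>R \<theta> w))"
    using i1 i2 by (simp add: inner_add_right)
  have "(\<integral>w. W w \<bullet> (B t w - B s w + (t - s) *\<^sub>R \<theta> w) \<partial>M) = (t - s) * (\<integral>w. W w \<bullet> \<theta> w \<partial>M)"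
    using i1 i2 inner_increment_mean[OF st W int] by (simp add: inner_add_right)
  thus ?thesis
    using cameron_martin_increment[OF st _ \<theta>, of "\<lambda>(w, x). W w \<bullet> x"] i by simp
qed

end

text \<open>For \<open>r \<le> u\<close> this is the projection onto the interval from
  \<open>r\<close> to \<open>u\<close>.\<close>

definition clip :: "real \<Rightarrow> real \<Rightarrow> real \<Rightarrow> real" where
  "clip r u x = max r (min u x)"

text \<open>The bound \<open>m\<close> is common to all steps: the later moment estimates depend on
  the integrand only through \<open>m\<close> and \<open>T\<close>, hence survive a limit over
  integrands.\<close>

locale simple_exponential = augmented_brownian M T B
  for M :: "'a measure" and T and B :: "real \<Rightarrow> 'a \<Rightarrow> real ^ 'd" +
  fixes n :: nat and \<tau> :: "nat \<Rightarrow> real" and \<theta> :: "nat \<Rightarrow> 'a \<Rightarrow> real ^ 'd" and m :: real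
  assumes simple: "simple_integrand M F T n \<tau> \<theta>"
    and bound: "\<And>i w. i < n \<Longrightarrow> w \<in> space M \<Longrightarrow> norm (\<theta> i w) \<le> m"
    and m_nonneg: "0 \<le> m"

context augmented_brownian
begin

lemma simple_partition:
  assumes "simple_integrand M F T n \<tau> \<xi>"
  shows "\<tau> 0 = 0" "\<tau> n = T" "\<And>i j. i \<le> j \<Longrightarrow> j \<le> n \<Longrightarrow> \<tau> i \<le> \<tau> j" "\<And>i. i \<le> n \<Longrightarrow> \<tau> i \<in> {0..T}"
proof -
  show 1: "\<tau> 0 = 0" "\<tau> n = T" using assms by (auto simp: simple_integrand_def)
  show 2: "\<tau> i \<le> \<tau> j" if "i \<le> j" "j \<le> n" for i j
    using that
  proof (induction j rule: dec_induct)
    case (step k)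
    moreover have "\<tau> k < \<tau> (Suc k)" using assms step by (auto simp: simple_integrand_def)
    ultimately show ?case using step by auto
  qed simp
  show "\<tau> i \<in> {0..T}" if "i \<le> n" for i using 2[of 0 i] 2[of i n] that 1 by auto
qed

text \<open>Clipping the partition points restricts the integrand to the time interval from \<open>r\<close> to \<open>u\<close>.\<close>

definition stoch_log ::
    "nat \<Rightarrow> (nat \<Rightarrow> real) \<Rightarrow> (nat \<Rightarrow> 'a \<Rightarrow> real ^ 'd) \<Rightarrow> real \<Rightarrow> real \<Rightarrow> 'a \<Rightarrow> real" where
  "stoch_log n \<tau> \<theta> r u w =
     (\<Sum>i<n. \<theta> i w \<bullet> (B (clip r u (\<tau> (Suc i))) w - B (clip r u (\<tau> i)) w)
       - (norm (\<theta> i w))\<^sup>2 / 2 * (clip r u (\<tau> (Suc i)) - clip r u (\<tau> i)))"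

text \<open>The Doleans-Dade exponential of the integral of \<open>\<theta>\<close> against
  \<open>B\<close> from \<open>r\<close> to \<open>u\<close>.\<close>

definition stoch_exp ::
    "nat \<Rightarrow> (nat \<Rightarrow> real) \<Rightarrow> (nat \<Rightarrow> 'a \<Rightarrow> real ^ 'd) \<Rightarrow> real \<Rightarrow> real \<Rightarrow> 'a \<Rightarrow> real" where
  "stoch_exp n \<tau> \<theta> r u w = exp (stoch_log n \<tau> \<theta> r u w)"

end

section \<open>Flow and martingale properties of the stochastic exponential\<close>

context simple_exponential
begin

abbreviation "G \<equiv> stoch_exp n \<tau> \<theta>"

lemmas partition = simple_partition[OF simple]

lemma G_pos [simp]: "0 < G r u w" "0 \<le> G r u w" "G r u w \<noteq> 0"
  by (simp_all add: stoch_exp_def)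

lemma G_self [simp]: "G s s w = 1"
  by (simp add: stoch_exp_def stoch_log_def clip_def)

lemma G_split:
  assumes "r \<le> s" "s \<le> u"
  shows "G r s w * G s u w = G r u w"
proof -
  \<comment> \<open>One of the two inner clips equals \<open>s\<close> and the other equals the
    outer clip, according to the side of \<open>s\<close> on which \<open>x\<close> lies. A general
    \<open>f\<close> is used because the identity is needed for the path and for time
    itself.\<close>
  have c: "f (clip r u x) + f s = f (clip r s x) + f (clip s u x)" for f :: "real \<Rightarrow> 'c::ab_group_add" and x
    using assms by (cases "x \<le> s") (auto simp: clip_def max_def min_def)
  let ?c1 = "\<lambda>i. clip r s (\<tau> i)" and ?c2 = "\<lambda>i. clip s u (\<tau> i)" and ?c = "\<lambda>i. clip r u (\<tau> i)"
  have d: "f (?c1 (Suc i)) - f (?c1 i) + (f (?c2 (Suc i)) - f (?c2 i)) = f (?c (Suc i)) - f (?c i)"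
    for f :: "real \<Rightarrow> 'c::ab_group_add" and i
  proof -
    have "f (?c1 (Suc i)) - f (?c1 i) + (f (?c2 (Suc i)) - f (?c2 i))
        = (f (?c1 (Suc i)) + f (?c2 (Suc i))) - (f (?c1 i) + f (?c2 i))" by simp
    also have "\<dots> = f (?c (Suc i)) - f (?c i)" unfolding c[symmetric] by simp
    finally show ?thesis .
  qed
  have g: "x \<bullet> p - k * a + (x \<bullet> q - k * b) = x \<bullet> (p + q) - k * (a + b)" for x p q :: "real ^ 'd" and k a b :: real
    by (simp add: inner_add_right algebra_simps)
  have "stoch_log n \<tau> \<theta> r s w + stoch_log n \<tau> \<theta> s u w = stoch_log n \<tau> \<theta> r u w"
    unfolding stoch_log_def sum.distrib[symmetric] g d[of "\<lambda>x. B x w"] d[of "\<lambda>x. x"] ..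
  thus ?thesis by (simp add: stoch_exp_def exp_add[symmetric])
qed

text \<open>Inside one cell of the partition the two clipped end points coincide for every summand
  but the \<open>i\<close>-th.\<close>

lemma G_step:
  assumes i: "i < n" and s: "\<tau> i \<le> s" "s \<le> u" "u \<le> \<tau> (Suc i)"
  shows "G s u w = exp (\<theta> i w \<bullet> (B u w - B s w) - (norm (\<theta> i w))\<^sup>2 / 2 * (u - s))"
proof -
  have l: "clip s u (\<tau> j) = s" if "j \<le> i" for j
    using partition(3)[of j i] that i s by (auto simp: clip_def)
  have g: "clip s u (\<tau> j) = u" if "Suc i \<le> j" "j \<le> n" for j
    using partition(3)[of "Suc i" j] that i s by (auto simp: clip_def)
  have "stoch_log n \<tau> \<theta> s u w = (\<Sum>j<n. if j = i then
      \<theta> i w \<bullet> (B u w - B s w) - (norm (\<theta> i w))\<^sup>2 / 2 * (u - s) else 0)"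
    unfolding stoch_log_def
  proof (intro sum.cong refl)
    fix j assume "j \<in> {..<n}"
    then consider "j < i" "j < n" | "j = i" | "i < j" "j < n" by force
    thus "\<theta> j w \<bullet> (B (clip s u (\<tau> (Suc j))) w - B (clip s u (\<tau> j)) w)
       - (norm (\<theta> j w))\<^sup>2 / 2 * (clip s u (\<tau> (Suc j)) - clip s u (\<tau> j))
      = (if j = i then \<theta> i w \<bullet> (B u w - B s w) - (norm (\<theta> i w))\<^sup>2 / 2 * (u - s) else 0)"
      using l[of j] l[of "Suc j"] g[of j] g[of "Suc j"] i by cases auto
  qed
  thus ?thesis using i by (simp add: stoch_exp_def)
qed

lemma measurable_theta: "i < n \<Longrightarrow> \<tau> i \<le> s \<Longrightarrow> s \<le> T \<Longrightarrow> \<theta> i \<in> borel_measurable (F s)"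
  using simple by (auto simp: simple_integrand_def intro: measurable_augmented_mono)

lemma G_measurable:
  assumes "0 \<le> r" "r \<le> u" "u \<le> T"
  shows "G r u \<in> borel_measurable (F u)"
proof -
  have "(\<lambda>w. \<theta> i w \<bullet> (B (clip r u (\<tau> (Suc i))) w - B (clip r u (\<tau> i)) w)
      - (norm (\<theta> i w))\<^sup>2 / 2 * (clip r u (\<tau> (Suc i)) - clip r u (\<tau> i))) \<in> borel_measurable (F u)"
    if "i < n" for i
  proof (cases "\<tau> i \<le> u")
    case True
    have [measurable]: "\<theta> i \<in> borel_measurable (F u)" using measurable_theta[OF that True] assms by simp
    have [measurable]: "B (clip r u x) \<in> borel_measurable (F u)" for x
      using assms by (intro brownian_adapted) (auto simp: clip_def)
    show ?thesis by measurable
  next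
    case False
    hence "clip r u (\<tau> i) = u" "clip r u (\<tau> (Suc i)) = u"
      using partition(3)[of i "Suc i"] that assms by (auto simp: clip_def)
    thus ?thesis by simp
  qed
  hence "stoch_log n \<tau> \<theta> r u \<in> borel_measurable (F u)"
    unfolding stoch_log_def[abs_def] by (intro borel_measurable_sum) auto
  thus ?thesis unfolding stoch_exp_def[abs_def] by measurable
qed

text \<open>Cutting an interval at the partition points reduces a claim about it to single cells,
  where the integrand is constant in time, and to concatenation.\<close>

lemma interval_induct [consumes 3, case_names refl step trans]:
  assumes su: "0 \<le> s" "s \<le> u" "u \<le> T"
    and "\<And>s. 0 \<le> s \<Longrightarrow> s \<le> T \<Longrightarrow> P s s"
    and "\<And>i s u. i < n \<Longrightarrow> \<tau> i \<le> s \<Longrightarrow> s < u \<Longrightarrow> u \<le> \<tau> (Suc i) \<Longrightarrow> 0 \<le> s \<Longrightarrow> u \<le> T \<Longrightarrow> P s u"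
    and "\<And>s u v. 0 \<le> s \<Longrightarrow> s \<le> u \<Longrightarrow> u \<le> v \<Longrightarrow> v \<le> T \<Longrightarrow> P s u \<Longrightarrow> P u v \<Longrightarrow> P s v"
  shows "P s u"
proof -
  have "j \<le> n \<Longrightarrow> 0 \<le> s \<Longrightarrow> s \<le> u \<Longrightarrow> u \<le> \<tau> j \<Longrightarrow> P s u" for j s u
  proof (induction j arbitrary: s u)
    case 0
    hence "s = 0" "u = 0" using partition(1) by auto
    thus ?case using assms(4)[of 0] T_pos by simp
  next
    case (Suc j)
    have T: "\<tau> (Suc j) \<le> T" "0 \<le> \<tau> j" "\<tau> j \<le> T" using partition(4)[of j] partition(4)[of "Suc j"] Suc by auto
    consider "s = u" | "u \<le> \<tau> j" | "\<tau> j \<le> s" "s < u" | "s \<le> \<tau> j" "\<tau> j < u" using Suc by linarith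
    thus ?case
    proof cases
      case 1
      thus ?thesis using assms(4)[of u] Suc.prems T by simp
    next
      case 2
      thus ?thesis using Suc.IH[of s u] Suc.prems by simp
    next
      case 3
      thus ?thesis using assms(5)[of j s u] Suc.prems T by simp
    next
      case 4
      have "P s (\<tau> j)" using 4 Suc.IH[of s "\<tau> j"] Suc.prems by simp
      moreover have "P (\<tau> j) u" using 4 assms(5)[of j "\<tau> j" u] Suc.prems T by simp
      ultimately show ?thesis using 4 assms(6)[of s "\<tau> j" u] Suc.prems T by simp
    qed
  qed
  from this[of n s u] show ?thesis using su partition(2) by simp
qed

text \<open>On one cell this is the Cameron--Martin formula for a function that ignores the
  increment. In a concatenation \<open>G s u\<close> is absorbed into \<open>K\<close>, which is why
  the claim is made for all \<open>K\<close> at once.\<close>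

lemma G_martingale:
  assumes "0 \<le> s" "s \<le> u" "u \<le> T" "K \<in> borel_measurable (F s)" "integrable M K"
  shows "has_bochner_integral M (\<lambda>w. G s u w * K w) (\<integral>w. K w \<partial>M)"
  using assms
proof (induction s u arbitrary: K rule: interval_induct)
  case (refl s)
  thus ?case by (simp add: has_bochner_integral_integrable)
next
  case (step i s u)
  have m: "\<theta> i \<in> borel_measurable (F s)" using measurable_theta[of i s] step by auto
  have "(\<lambda>p. K (fst p)) \<in> borel_measurable (F s \<Otimes>\<^sub>M borel)" using step by measurable
  from cameron_martin_increment[OF _ _ _ this m, of u] step
  show ?case by (simp add: G_step[of i])
next
  case (trans s u v)
  have K: "has_bochner_integral M (\<lambda>w. G s u w * K w) (integral\<^sup>L M K)" using trans by blast
  have "K \<in> borel_measurable (F u)" using trans by (auto intro: measurable_augmented_mono)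
  moreover have "G s u \<in> borel_measurable (F u)" using trans by (intro G_measurable) auto
  ultimately have "(\<lambda>w. G s u w * K w) \<in> borel_measurable (F u)" by measurable
  from trans(6)[OF this] K
  have "has_bochner_integral M (\<lambda>w. G u v w * (G s u w * K w)) (integral\<^sup>L M K)"
    by (simp add: has_bochner_integral_iff)
  moreover have "G u v w * (G s u w * K w) = G s v w * K w" for w
    using G_split[of s u v w] trans by (simp add: mult_ac)
  ultimately show ?case by simp
qed

text \<open>The factor \<open>G u T\<close> is integrated out by the martingale property, since the
  rest is known at time \<open>u\<close>; what remains is the one-step formula.\<close>

lemma G_increment_step:
  assumes i: "i < n" "\<tau> i \<le> s" "s \<le> u" "u \<le> \<tau> (Suc i)"
    and W: "W \<in> borel_measurable (F s)" "integrable M W"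
  shows "has_bochner_integral M (\<lambda>w. G s T w * (W w \<bullet> (B u w - B s w))) ((u - s) * (\<integral>w. W w \<bullet> \<theta> i w \<partial>M))"
proof (cases "s = u")
  case True
  thus ?thesis by (simp add: has_bochner_integral_zero)
next
  case False
  have s: "0 \<le> s" "u \<le> T" "s < u" using partition(4)[of i] partition(4)[of "Suc i"] i False by simp_all
  let ?K = "\<lambda>w. G s u w * (W w \<bullet> (B u w - B s w))"
  have K: "has_bochner_integral M ?K ((u - s) * (\<integral>w. W w \<bullet> \<theta> i w \<partial>M))"
  proof -
    have "\<theta> i \<in> borel_measurable (F s)" using i s by (intro measurable_theta) auto
    from inner_increment_girsanov[OF s(1) s(3) s(2) W this bound[OF i(1)]]
    show ?thesis unfolding G_step[OF i] .
  qed
  have "G s u \<in> borel_measurable (F u)" "B u \<in> borel_measurable (F u)" "B s \<in> borel_measurable (F u)"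
    "W \<in> borel_measurable (F u)"
    using s W by (auto intro!: G_measurable brownian_adapted intro: measurable_augmented_mono)
  hence "?K \<in> borel_measurable (F u)" by measurable
  from G_martingale[OF _ _ _ this, of T] K s
  have "has_bochner_integral M (\<lambda>w. G u T w * ?K w) ((u - s) * (\<integral>w. W w \<bullet> \<theta> i w \<partial>M))"
    by (simp add: has_bochner_integral_iff)
  moreover have "G u T w * ?K w = G s T w * (W w \<bullet> (B u w - B s w))" for w
    using G_split[of s u T w] s by (simp add: mult_ac)
  ultimately show ?thesis by simp
qed

text \<open>Over several cells the direction of \<open>\<theta>\<close> varies, so only
  \<open>norm (\<theta> i w) \<le> m\<close> is used. In a concatenation \<open>G s u\<close> is
  absorbed into \<open>W\<close>; the martingale property keeps the mean of
  \<open>norm (W w)\<close> unchanged, so the two bounds add up.\<close>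

lemma G_increment_le:
  assumes "0 \<le> s" "s \<le> u" "u \<le> T" "W \<in> borel_measurable (F s)" "integrable M W"
  shows "integrable M (\<lambda>w. G s T w * (W w \<bullet> (B u w - B s w))) \<and>
    (\<integral>w. G s T w * (W w \<bullet> (B u w - B s w)) \<partial>M) \<le> (u - s) * (m * (\<integral>w. norm (W w) \<partial>M))"
  using assms
proof (induction s u arbitrary: W rule: interval_induct)
  case (refl s)
  thus ?case by simp
next
  case (step i s u)
  have "(\<integral>w. W w \<bullet> \<theta> i w \<partial>M) \<le> (\<integral>w. m * norm (W w) \<partial>M)"
  proof (rule integral_mono')
    show "integrable M (\<lambda>w. m * norm (W w))" using step by auto
    fix w assume "w \<in> space M"
    have "W w \<bullet> \<theta> i w \<le> norm (W w) * norm (\<theta> i w)" by (rule norm_cauchy_schwarz)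
    also have "\<dots> \<le> norm (W w) * m"
      using bound[OF step(1) \<open>w \<in> space M\<close>] by (intro mult_left_mono) auto
    finally show "W w \<bullet> \<theta> i w \<le> m * norm (W w)" by (simp add: mult.commute)
    show "0 \<le> m * norm (W w)" using m_nonneg by simp
  qed
  hence "(u - s) * (\<integral>w. W w \<bullet> \<theta> i w \<partial>M) \<le> (u - s) * (m * (\<integral>w. norm (W w) \<partial>M))"
    using step by (intro mult_left_mono) auto
  thus ?case using G_increment_step[of i s u W] step by (auto simp: has_bochner_integral_iff)
next
  case (trans s u v)
  let ?W = "\<lambda>w. G s u w *\<^sub>R W w"
  have [measurable]: "G s u \<in> borel_measurable (F u)" "W \<in> borel_measurable (F u)"
    using trans by (auto intro!: G_measurable intro: measurable_augmented_mono)
  have [measurable]: "G s u \<in> borel_measurable M" "W \<in> borel_measurable M"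
    using trans by (auto intro: measurable_augmented_imp[of _ u])
  have nW: "has_bochner_integral M (\<lambda>w. G s u w * norm (W w)) (\<integral>w. norm (W w) \<partial>M)"
  proof (rule G_martingale)
    show "(\<lambda>w. norm (W w)) \<in> borel_measurable (F s)" using \<open>W \<in> borel_measurable (F s)\<close> by measurable
    show "integrable M (\<lambda>w. norm (W w))" using \<open>integrable M W\<close> by simp
  qed (use trans(1-4) in linarith)+
  have iW: "integrable M ?W"
    by (rule Bochner_Integration.integrable_bound[of M "\<lambda>w. G s u w * norm (W w)"])
      (use nW in \<open>auto simp: has_bochner_integral_iff\<close>)
  have "?W \<in> borel_measurable (F u)" by measurable
  note IH1 = trans(5)[OF \<open>W \<in> borel_measurable (F s)\<close> \<open>integrable M W\<close>] and IH2 = trans(6)[OF this iW]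
  have eq: "G u T w * (?W w \<bullet> x) = G s T w * (W w \<bullet> x)" for w x
    using G_split[of s u T w] trans by (simp add: mult_ac)
  have n: "(\<integral>w. norm (?W w) \<partial>M) = (\<integral>w. norm (W w) \<partial>M)"
    using nW by (simp add: has_bochner_integral_iff)
  have dec: "G s T w * (W w \<bullet> (B v w - B s w))
      = G s T w * (W w \<bullet> (B u w - B s w)) + G s T w * (W w \<bullet> (B v w - B u w))" for w
    by (simp add: inner_diff_right algebra_simps)
  show ?case
  proof
    show "integrable M (\<lambda>w. G s T w * (W w \<bullet> (B v w - B s w)))"
      unfolding dec using IH1 IH2 unfolding eq by (intro Bochner_Integration.integrable_add) auto
    have "(\<integral>w. G s T w * (W w \<bullet> (B v w - B s w)) \<partial>M)
        \<le> (u - s) * (m * (\<integral>w. norm (W w) \<partial>M)) + (v - u) * (m * (\<integral>w. norm (W w) \<partial>M))"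
      unfolding dec using IH1 IH2 unfolding eq n
      by (subst Bochner_Integration.integral_add) (auto intro: add_mono)
    thus "(\<integral>w. G s T w * (W w \<bullet> (B v w - B s w)) \<partial>M) \<le> (v - s) * (m * (\<integral>w. norm (W w) \<partial>M))"
      by (simp add: left_diff_distrib)
  qed
qed

end

section \<open>Square-integrable functions\<close>

lemma square_integrable_mult:
  fixes f g :: "'a \<Rightarrow> real"
  assumes [measurable]: "f \<in> borel_measurable M" "g \<in> borel_measurable M"
    and "integrable M (\<lambda>x. (f x)\<^sup>2)" "integrable M (\<lambda>x. (g x)\<^sup>2)"
  shows "integrable M (\<lambda>x. f x * g x)"
proof (rule Bochner_Integration.integrable_bound)
  show "integrable M (\<lambda>x. (f x)\<^sup>2 + (g x)\<^sup>2)" using assms by auto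
  have "\<bar>a * b\<bar> \<le> a\<^sup>2 + b\<^sup>2" for a b :: real
    using sum_squares_bound[of "\<bar>a\<bar>" "\<bar>b\<bar>"] mult_nonneg_nonneg[of "\<bar>a\<bar>" "\<bar>b\<bar>"]
    unfolding abs_mult power2_abs by linarith
  thus "AE x in M. norm (f x * g x) \<le> norm ((f x)\<^sup>2 + (g x)\<^sup>2)" by simp
qed measurable

lemma Cauchy_Schwarz_integral:
  fixes f g :: "'a \<Rightarrow> real"
  assumes [measurable]: "f \<in> borel_measurable M" "g \<in> borel_measurable M"
    and f: "integrable M (\<lambda>x. (f x)\<^sup>2)" and g: "integrable M (\<lambda>x. (g x)\<^sup>2)"
  shows "(\<integral>x. f x * g x \<partial>M)\<^sup>2 \<le> (\<integral>x. (f x)\<^sup>2 \<partial>M) * (\<integral>x. (g x)\<^sup>2 \<partial>M)"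
proof -
  define a b c where "a = (\<integral>x. (f x)\<^sup>2 \<partial>M)" and "b = (\<integral>x. (g x)\<^sup>2 \<partial>M)" and "c = (\<integral>x. f x * g x \<partial>M)"
  note fg = square_integrable_mult[OF assms]
  have q: "0 \<le> l\<^sup>2 * a + 2 * l * c + b" for l
  proof -
    have "0 \<le> (\<integral>x. (l * f x + g x)\<^sup>2 \<partial>M)" by simp
    also have "(\<lambda>x. (l * f x + g x)\<^sup>2) = (\<lambda>x. l\<^sup>2 * (f x)\<^sup>2 + 2 * l * (f x * g x) + (g x)\<^sup>2)"
      by (auto simp: power2_eq_square algebra_simps)
    also have "(\<integral>x. l\<^sup>2 * (f x)\<^sup>2 + 2 * l * (f x * g x) + (g x)\<^sup>2 \<partial>M) = l\<^sup>2 * a + 2 * l * c + b"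
      using f g fg by (simp add: a_def b_def c_def)
    finally show ?thesis .
  qed
  have "0 \<le> a" by (simp add: a_def)
  show ?thesis
  proof (cases "a = 0")
    case True
    hence "AE x in M. (f x)\<^sup>2 = 0" using f integral_nonneg_eq_0_iff_AE[OF f] by (simp add: a_def)
    hence "c = (\<integral>x. 0 \<partial>M)" unfolding c_def by (intro integral_cong_AE) auto
    thus ?thesis by (simp add: c_def)
  next
    case False
    \<comment> \<open>The quadratic in \<open>l\<close> is minimal at
      \<open>- c / a\<close>.\<close>
    have "0 \<le> b - c\<^sup>2 / a" using q[of "- c / a"] False by (simp add: power2_eq_square field_simps)
    thus ?thesis using False \<open>0 \<le> a\<close> unfolding a_def[symmetric] b_def[symmetric] c_def[symmetric]
      by (simp add: field_simps)
  qed
qed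

text \<open>A divergent Bochner integral has the value \<open>0\<close>, so the number is meaningful
  on \<open>L2\<close> only; the triangle inequality and monotonicity below therefore assume
  membership in \<open>L2\<close>.\<close>

definition l2norm :: "'a measure \<Rightarrow> ('a \<Rightarrow> real) \<Rightarrow> real" where
  "l2norm M f = sqrt (\<integral>w. (f w)\<^sup>2 \<partial>M)"

abbreviation l2dist :: "'a measure \<Rightarrow> ('a \<Rightarrow> real) \<Rightarrow> ('a \<Rightarrow> real) \<Rightarrow> real" where
  "l2dist M f g \<equiv> l2norm M (\<lambda>w. f w - g w)"

lemma l2norm_nonneg [simp]: "0 \<le> l2norm M f" by (simp add: l2norm_def)

lemma l2norm_square: "(l2norm M f)\<^sup>2 = (\<integral>w. (f w)\<^sup>2 \<partial>M)" by (simp add: l2norm_def)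

lemma subalgebra_refl [simp]: "subalgebra M M" by (simp add: subalgebra_def)

lemma L2_D:
  assumes "subalgebra M G" "f \<in> L2 M G"
  shows "f \<in> borel_measurable G" "f \<in> borel_measurable M" "integrable M (\<lambda>w. (f w)\<^sup>2)" "f \<in> L2 M M"
  using assms by (auto simp: L2_def subalgebra_def measurable_def)

lemma L2_bound:
  assumes G: "subalgebra M G" and f: "f \<in> borel_measurable G"
    and g: "subalgebra M G'" "g \<in> L2 M G'" and le: "AE w in M. \<bar>f w\<bar> \<le> \<bar>g w\<bar>"
  shows "f \<in> L2 M G"
proof -
  have [measurable]: "f \<in> borel_measurable M" using G f by (auto simp: subalgebra_def measurable_def)
  have "integrable M (\<lambda>w. (f w)\<^sup>2)"
    by (rule Bochner_Integration.integrable_bound[OF L2_D(3)[OF g]])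
      (use le in \<open>auto simp: abs_le_square_iff\<close>)
  thus ?thesis using f by (simp add: L2_def)
qed

lemma L2_add:
  assumes G: "subalgebra M G" and f: "f \<in> L2 M G" and g: "g \<in> L2 M G"
  shows "(\<lambda>w. f w + g w) \<in> L2 M G"
proof -
  note [measurable] = L2_D(1,2)[OF G f] L2_D(1,2)[OF G g]
  have "integrable M (\<lambda>w. f w * g w)"
    using L2_D[OF G f] L2_D[OF G g] by (intro square_integrable_mult) auto
  hence "integrable M (\<lambda>w. (f w)\<^sup>2 + (2 * (f w * g w) + (g w)\<^sup>2))"
    using L2_D(3)[OF G f] L2_D(3)[OF G g] by auto
  thus ?thesis by (simp add: L2_def power2_sum algebra_simps)
qed

lemma L2_cmult: "f \<in> L2 M G \<Longrightarrow> (\<lambda>w. c * f w) \<in> L2 M G"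
  by (auto simp: L2_def power_mult_distrib)

lemma L2_minus: "f \<in> L2 M G \<Longrightarrow> (\<lambda>w. - f w) \<in> L2 M G"
  by (simp add: L2_def)

lemma L2_diff:
  assumes "subalgebra M G" "f \<in> L2 M G" "g \<in> L2 M G"
  shows "(\<lambda>w. f w - g w) \<in> L2 M G"
  using L2_add[OF assms(1,2) L2_minus[OF assms(3)]] by simp

lemma L2_sum:
  assumes "subalgebra M G" "\<And>i. i \<in> A \<Longrightarrow> f i \<in> L2 M G"
  shows "(\<lambda>w. \<Sum>i\<in>A. f i w) \<in> L2 M G"
  using assms(2)
proof (induction A rule: infinite_finite_induct)
  case (insert x A)
  thus ?case using L2_add[OF assms(1), of "f x" "\<lambda>w. \<Sum>i\<in>A. f i w"] by simp
qed (simp_all add: L2_def)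

lemma L2_abs: "f \<in> L2 M G \<Longrightarrow> (\<lambda>w. \<bar>f w\<bar>) \<in> L2 M G"
  by (auto simp: L2_def)

lemma L2_indicator:
  assumes "subalgebra M G" "A \<in> sets G" "f \<in> L2 M G"
  shows "(\<lambda>w. indicator A w * f w) \<in> L2 M G"
proof (rule L2_bound[OF assms(1) _ assms(1,3)])
  show "(\<lambda>w. indicator A w * f w) \<in> borel_measurable G"
    using assms L2_D(1)[OF assms(1,3)] by measurable
qed (auto simp: indicator_def)

lemma (in prob_space) L2_const [simp]: "(\<lambda>w. c) \<in> L2 M G"
  by (simp add: L2_def)

lemma L2_integrable_mult:
  assumes "f \<in> L2 M M" "g \<in> L2 M M"
  shows "integrable M (\<lambda>w. f w * g w)"
  using assms by (intro square_integrable_mult) (auto simp: L2_def)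

lemma (in prob_space) L2_integrable:
  "f \<in> L2 M M \<Longrightarrow> integrable M f"
  using L2_integrable_mult[of f M "\<lambda>_. 1"] by simp

lemma L2_Cauchy_Schwarz:
  assumes "f \<in> L2 M M" "g \<in> L2 M M"
  shows "\<bar>\<integral>w. f w * g w \<partial>M\<bar> \<le> l2norm M f * l2norm M g"
proof -
  have "\<bar>\<integral>w. f w * g w \<partial>M\<bar> = sqrt ((\<integral>w. f w * g w \<partial>M)\<^sup>2)" by simp
  also have "\<dots> \<le> sqrt ((\<integral>w. (f w)\<^sup>2 \<partial>M) * (\<integral>w. (g w)\<^sup>2 \<partial>M))"
    using assms by (intro real_sqrt_le_mono Cauchy_Schwarz_integral) (auto simp: L2_def)
  finally show ?thesis by (simp add: l2norm_def real_sqrt_mult)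
qed

lemma l2norm_triangle:
  assumes "f \<in> L2 M M" "g \<in> L2 M M"
  shows "l2norm M (\<lambda>w. f w + g w) \<le> l2norm M f + l2norm M g"
proof (rule power2_le_imp_le)
  have i: "integrable M (\<lambda>w. (f w)\<^sup>2)" "integrable M (\<lambda>w. (g w)\<^sup>2)" "integrable M (\<lambda>w. f w * g w)"
    using assms L2_integrable_mult[OF assms] by (auto simp: L2_def)
  have "(l2norm M (\<lambda>w. f w + g w))\<^sup>2 = (\<integral>w. (f w)\<^sup>2 + (g w)\<^sup>2 + 2 * (f w * g w) \<partial>M)"
    unfolding l2norm_square by (simp add: power2_sum mult.assoc)
  also have "\<dots> = (l2norm M f)\<^sup>2 + (l2norm M g)\<^sup>2 + 2 * (\<integral>w. f w * g w \<partial>M)"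
    using i by (simp add: l2norm_square)
  also have "\<dots> \<le> (l2norm M f + l2norm M g)\<^sup>2"
    using L2_Cauchy_Schwarz[OF assms] by (simp add: power2_sum)
  finally show "(l2norm M (\<lambda>w. f w + g w))\<^sup>2 \<le> (l2norm M f + l2norm M g)\<^sup>2" .
qed simp

lemma l2norm_abs: "l2norm M (\<lambda>w. \<bar>f w\<bar>) = l2norm M f"
  by (simp add: l2norm_def)

lemma l2norm_diff_triangle:
  assumes "f \<in> L2 M M" "g \<in> L2 M M" "h \<in> L2 M M"
  shows "l2dist M f h \<le> l2dist M f g + l2dist M g h"
  using l2norm_triangle[OF L2_diff[OF _ assms(1,2)] L2_diff[OF _ assms(2,3)]] by simp

lemma l2norm_diff_commute: "l2dist M f g = l2dist M g f"
  by (simp add: l2norm_def power2_commute)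

lemma l2norm_mono_AE:
  assumes "f \<in> L2 M M" "g \<in> L2 M M" "AE w in M. \<bar>f w\<bar> \<le> \<bar>g w\<bar>"
  shows "l2norm M f \<le> l2norm M g"
  unfolding l2norm_def using assms
  by (intro real_sqrt_le_mono integral_mono_AE) (auto simp: L2_def abs_le_square_iff)

lemma l2norm_eq_0_AE:
  assumes "f \<in> L2 M M" "l2norm M f = 0"
  shows "AE w in M. f w = 0"
  using assms integral_nonneg_eq_0_iff_AE[of M "\<lambda>w. (f w)\<^sup>2"] by (simp add: l2norm_def L2_def)

lemma l2norm_tendsto_iff:
  "(\<lambda>n. l2norm M (f n)) \<longlonglongrightarrow> 0 \<longleftrightarrow> (\<lambda>n. \<integral>w. (f n w)\<^sup>2 \<partial>M) \<longlonglongrightarrow> 0"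
proof
  assume "(\<lambda>n. l2norm M (f n)) \<longlonglongrightarrow> 0"
  from tendsto_power[OF this, of 2] show "(\<lambda>n. \<integral>w. (f n w)\<^sup>2 \<partial>M) \<longlonglongrightarrow> 0" by (simp add: l2norm_square)
next
  assume "(\<lambda>n. \<integral>w. (f n w)\<^sup>2 \<partial>M) \<longlonglongrightarrow> 0"
  from tendsto_real_sqrt[OF this] show "(\<lambda>n. l2norm M (f n)) \<longlonglongrightarrow> 0" by (simp add: l2norm_def)
qed

lemma L2_of_nn_integral:
  assumes "f \<in> borel_measurable M" "(\<integral>\<^sup>+w. ennreal ((f w)\<^sup>2) \<partial>M) < \<infinity>"
  shows "f \<in> L2 M M" "(l2norm M f)\<^sup>2 = enn2real (\<integral>\<^sup>+w. ennreal ((f w)\<^sup>2) \<partial>M)"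
proof -
  show "f \<in> L2 M M" using assms by (simp add: L2_def integrable_iff_bounded)
  thus "(l2norm M f)\<^sup>2 = enn2real (\<integral>\<^sup>+w. ennreal ((f w)\<^sup>2) \<partial>M)"
    using assms by (simp add: l2norm_square integral_eq_nn_integral)
qed

section \<open>Nonnegative variables and limits in mean square\<close>

lemma L2_plusD: "X \<in> L2_plus M G \<Longrightarrow> X \<in> L2 M G" "X \<in> L2_plus M G \<Longrightarrow> AE w in M. 0 \<le> X w"
  by (simp_all add: L2_plus_def)

lemma L2_plusI: "X \<in> L2 M G \<Longrightarrow> AE w in M. 0 \<le> X w \<Longrightarrow> X \<in> L2_plus M G"
  by (simp add: L2_plus_def)

lemma (in prob_space) L2_plus_const: "0 \<le> c \<Longrightarrow> (\<lambda>w. c) \<in> L2_plus M G"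
  by (simp add: L2_plus_def)

text \<open>Because \<open>U n \<le> V n\<close>, the positive part of \<open>f - g\<close> is at
  most \<open>|U n - f| + |V n - g|\<close>, whose norm tends to \<open>0\<close>.\<close>

lemma l2_limit_mono:
  assumes L: "\<And>n. U n \<in> L2 M M" "\<And>n. V n \<in> L2 M M" "f \<in> L2 M M" "g \<in> L2 M M"
    and le: "\<And>n. AE w in M. U n w \<le> V n w"
    and lim: "(\<lambda>n. l2dist M (U n) f) \<longlonglongrightarrow> 0" "(\<lambda>n. l2dist M (V n) g) \<longlonglongrightarrow> 0"
  shows "AE w in M. f w \<le> g w"
proof -
  let ?h = "\<lambda>w. max 0 (f w - g w)"
  have d: "(\<lambda>w. f w - g w) \<in> L2 M M" by (intro L2_diff L) simp
  have hm: "?h \<in> borel_measurable M"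
    using L2_D(1)[OF subalgebra_refl d] by measurable
  have h: "?h \<in> L2 M M"
    by (rule L2_bound[OF subalgebra_refl hm subalgebra_refl d]) auto
  have "l2norm M ?h \<le> l2dist M (U n) f + l2dist M (V n) g" for n
  proof -
    have a: "(\<lambda>w. \<bar>U n w - f w\<bar>) \<in> L2 M M" "(\<lambda>w. \<bar>V n w - g w\<bar>) \<in> L2 M M"
      by (intro L2_abs L2_diff L subalgebra_refl)+
    have "l2norm M ?h \<le> l2norm M (\<lambda>w. \<bar>U n w - f w\<bar> + \<bar>V n w - g w\<bar>)"
    proof (rule l2norm_mono_AE[OF h L2_add[OF subalgebra_refl a]])
      show "AE w in M. \<bar>?h w\<bar> \<le> \<bar>\<bar>U n w - f w\<bar> + \<bar>V n w - g w\<bar>\<bar>"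
        using le[of n] by eventually_elim (simp add: max_def abs_if)
    qed
    also have "\<dots> \<le> l2norm M (\<lambda>w. \<bar>U n w - f w\<bar>) + l2norm M (\<lambda>w. \<bar>V n w - g w\<bar>)" by (rule l2norm_triangle[OF a])
    finally show ?thesis by (simp add: l2norm_abs)
  qed
  moreover have "(\<lambda>n. l2dist M (U n) f + l2dist M (V n) g) \<longlonglongrightarrow> 0"
    using tendsto_add[OF lim] by simp
  ultimately have "l2norm M ?h \<le> 0" by (intro LIMSEQ_le_const) auto
  hence "l2norm M ?h = 0" using l2norm_nonneg[of M ?h] by linarith
  from l2norm_eq_0_AE[OF h this] show ?thesis by eventually_elim (simp add: max_def split: if_splits)
qed

text \<open>The form in which identities verified on a dense class are carried over to all
  square-integrable variables.\<close>

lemma l2_limit_eq: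
  assumes L: "\<And>n. U n \<in> L2 M M" "\<And>n. V n \<in> L2 M M" "f \<in> L2 M M" "g \<in> L2 M M"
    and eq: "\<And>n. AE w in M. U n w = V n w"
    and lim: "(\<lambda>n. l2dist M (U n) f) \<longlonglongrightarrow> 0" "(\<lambda>n. l2dist M (V n) g) \<longlonglongrightarrow> 0"
  shows "AE w in M. f w = g w"
proof -
  have le: "AE w in M. U n w \<le> V n w" "AE w in M. V n w \<le> U n w" for n
    using eq[of n] by (eventually_elim, simp)+
  from l2_limit_mono[OF L le(1) lim] l2_limit_mono[OF L(2,1,4,3) le(2) lim(2,1)]
  show ?thesis by eventually_elim simp
qed

lemma l2norm_sum_limit:
  assumes L: "\<And>n. U n \<in> L2 M M" "\<And>n. V n \<in> L2 M M" "f \<in> L2 M M" "g \<in> L2 M M"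
    and lim: "(\<lambda>n. l2dist M (U n) f) \<longlonglongrightarrow> 0" "(\<lambda>n. l2dist M (V n) g) \<longlonglongrightarrow> 0"
  shows "(\<lambda>n. l2norm M (\<lambda>w. (U n w + V n w) - (f w + g w))) \<longlonglongrightarrow> 0"
proof (rule Lim_null_comparison)
  show "(\<lambda>n. l2dist M (U n) f + l2dist M (V n) g) \<longlonglongrightarrow> 0"
    using tendsto_add[OF lim] by simp
  have "l2norm M (\<lambda>w. (U n w - f w) + (V n w - g w)) \<le> l2dist M (U n) f + l2dist M (V n) g" for n
    by (intro l2norm_triangle L2_diff L subalgebra_refl)
  thus "\<forall>\<^sub>F n in sequentially. norm (l2norm M (\<lambda>w. (U n w + V n w) - (f w + g w)))
      \<le> l2dist M (U n) f + l2dist M (V n) g"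
    by (intro always_eventually allI) (simp add: algebra_simps)
qed

lemma l2_limit_dominated:
  assumes U: "\<And>n. U n \<in> borel_measurable M" and f: "f \<in> borel_measurable M" and g: "g \<in> L2 M M"
    and lim: "AE w in M. (\<lambda>n. U n w) \<longlonglongrightarrow> f w" and le: "\<And>n. AE w in M. \<bar>U n w - f w\<bar> \<le> \<bar>g w\<bar>"
  shows "(\<lambda>n. l2dist M (U n) f) \<longlonglongrightarrow> 0"
proof -
  note [measurable] = U f
  have "(\<lambda>n. \<integral>w. (U n w - f w)\<^sup>2 \<partial>M) \<longlonglongrightarrow> (\<integral>w. 0 \<partial>M)"
  proof (rule integral_dominated_convergence[where w="\<lambda>w. (g w)\<^sup>2"])
    show "integrable M (\<lambda>w. (g w)\<^sup>2)" using g by (simp add: L2_def)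
    show "AE w in M. (\<lambda>n. (U n w - f w)\<^sup>2) \<longlonglongrightarrow> 0"
      using lim
    proof eventually_elim
      case (elim w)
      from tendsto_power[OF tendsto_diff[OF elim tendsto_const[of "f w"]], of 2] show ?case by simp
    qed
    show "AE w in M. norm ((U n w - f w)\<^sup>2) \<le> (g w)\<^sup>2" for n
      using le[of n] by eventually_elim (simp add: abs_le_square_iff)
  qed measurable
  thus ?thesis by (simp add: l2norm_tendsto_iff)
qed

text \<open>The first condition makes \<open>f\<close> itself a dominating function, the second
  makes the sequence eventually constant at each point. Both truncations used for the extension are
  of this kind.\<close>

lemma l2_limit_truncation:
  assumes f: "f \<in> L2 M M" and U: "\<And>n. U n \<in> borel_measurable M"
    and le: "\<And>n w. \<bar>U n w - f w\<bar> \<le> \<bar>f w\<bar>" and eq: "\<And>n w. - f w \<le> real n \<Longrightarrow> U n w = f w"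
  shows "(\<lambda>n. l2dist M (U n) f) \<longlonglongrightarrow> 0"
proof (rule l2_limit_dominated[OF U L2_D(1)[OF subalgebra_refl f] f])
  show "AE w in M. (\<lambda>n. U n w) \<longlonglongrightarrow> f w"
  proof (rule AE_I2)
    fix w
    obtain N where "- f w \<le> real N" using real_arch_simple by blast
    hence "\<forall>n\<ge>N. U n w = f w" using eq by force
    thus "(\<lambda>n. U n w) \<longlonglongrightarrow> f w"
      by (intro tendsto_eventually) (auto simp: eventually_sequentially)
  qed
qed (use le in simp)

section \<open>Approximation of backward equations by simple processes\<close>

context augmented_brownian
begin

section \<open>Time as a finite measure space and the measurability of integrands\<close>

lemma subalgebra_augmented [simp]: "t \<le> T \<Longrightarrow> subalgebra M (F t)"
  using sets_augmented_subset by (simp add: subalgebra_def)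

abbreviation "time_measure \<equiv> restrict_space lborel {0..T}"

lemma finite_time_measure: "finite_measure time_measure"
  using T_pos by (intro finite_measureI) (simp add: emeasure_restrict_space)

lemma measure_time [simp]: "measure time_measure {0..T} = T"
  using T_pos by (simp add: measure_restrict_space)

lemma set_integral_time:
  fixes f :: "real \<Rightarrow> real"
  assumes "0 \<le> t"
  shows "(LINT s:{t..T}|lborel. f s) = (\<integral>s. indicator {t..T} s * f s \<partial>time_measure)"
  using assms by (subst integral_restrict_space)
    (auto simp: set_lebesgue_integral_def indicator_def intro!: Bochner_Integration.integral_cong)

lemma sq_norm_H2_time:
  "sq_norm_H2 M T z = (\<integral>\<^sup>+w. \<integral>\<^sup>+s. ennreal ((norm (z s w))\<^sup>2) \<partial>time_measure \<partial>M)"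
  by (simp add: sq_norm_H2_def nn_integral_restrict_space mult.commute)

lemma H2_jointly_measurable:
  assumes "z \<in> H2 M F T"
  shows "(\<lambda>(s, w). z s w) \<in> borel_measurable (time_measure \<Otimes>\<^sub>M M)"
proof -
  have 1: "(\<lambda>(s, w). z s w) \<in> borel_measurable (restrict_space borel {0..T} \<Otimes>\<^sub>M F T)"
    using assms T_pos by (auto simp: H2_def progressive_def)
  have [measurable]: "(\<lambda>w. w) \<in> measurable M (F T)"
    using measurable_augmented_imp[of "\<lambda>w. w" T "F T"] by simp
  have [measurable]: "(\<lambda>s. s) \<in> measurable time_measure (restrict_space borel {0..T})"
    by (intro measurable_restrict_space3) auto
  have "(\<lambda>p. (fst p, snd p)) \<in> measurable (time_measure \<Otimes>\<^sub>M M) (restrict_space borel {0..T} \<Otimes>\<^sub>M F T)"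
    by measurable
  from measurable_compose[OF this 1] show ?thesis by (simp add: case_prod_beta')
qed

lemma H2_section:
  assumes "z \<in> H2 M F T" "w \<in> space M"
  shows "(\<lambda>s. z s w) \<in> borel_measurable time_measure"
  using measurable_compose[OF measurable_Pair2' H2_jointly_measurable[OF assms(1)], of w] assms(2) by simp

lemma progressive_adapted:
  assumes "progressive F T y" "t \<in> {0..T}"
  shows "y t \<in> borel_measurable (F t)"
proof -
  have "(\<lambda>(s, w). y s w) \<in> borel_measurable (restrict_space borel {0..t} \<Otimes>\<^sub>M F t)"
    using assms by (auto simp: progressive_def)
  from measurable_compose[OF measurable_Pair1' this, of t] show ?thesis
    using assms by (simp add: space_restrict_space)
qed

lemma H2_AE_finite:
  assumes z: "z \<in> H2 M F T"
  shows "AE w in M. (\<integral>\<^sup>+s. ennreal ((norm (z s w))\<^sup>2) \<partial>time_measure) \<noteq> \<infinity>"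
proof (rule nn_integral_PInf_AE)
  interpret finite_measure time_measure by (rule finite_time_measure)
  note [measurable] = H2_jointly_measurable[OF z]
  have "(\<lambda>(w, s). ennreal ((norm (z s w))\<^sup>2)) \<in> borel_measurable (M \<Otimes>\<^sub>M time_measure)"
    by measurable
  thus "(\<lambda>w. \<integral>\<^sup>+s. ennreal ((norm (z s w))\<^sup>2) \<partial>time_measure) \<in> borel_measurable M"
    by (rule borel_measurable_nn_integral)
  show "(\<integral>\<^sup>+w. \<integral>\<^sup>+s. ennreal ((norm (z s w))\<^sup>2) \<partial>time_measure \<partial>M) \<noteq> \<infinity>"
    using z less_top by (auto simp: H2_def sq_norm_H2_time)
qed

text \<open>The cells are disjoint, so at most one summand is nonzero at a given time and the norm
  passes through the sum.\<close>

lemma norm_simple_process: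
  assumes "simple_integrand M F T n \<tau> \<xi>"
  shows "norm (simple_process n \<tau> \<xi> s w) = (\<Sum>i<n. indicator {\<tau> i<..\<tau> (Suc i)} s * norm (\<xi> i w))"
proof (cases "\<exists>i<n. s \<in> {\<tau> i<..\<tau> (Suc i)}")
  case True
  then obtain i where i: "i < n" "s \<in> {\<tau> i<..\<tau> (Suc i)}" by auto
  have "s \<notin> {\<tau> j<..\<tau> (Suc j)}" if "j < n" "j \<noteq> i" for j
    using simple_partition(3)[OF assms, of "Suc j" i] simple_partition(3)[OF assms, of "Suc i" j] that i
    by (cases "j < i") auto
  hence ind: "indicator {\<tau> j<..\<tau> (Suc j)} s = (if j = i then 1 else 0 :: real)" if "j < n" for j
    using i that by (auto simp: indicator_def)
  have "simple_process n \<tau> \<xi> s w = (\<Sum>j<n. if j = i then \<xi> i w else 0)"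
    unfolding simple_process_def by (intro sum.cong) (auto simp: ind)
  moreover have "(\<Sum>i<n. indicator {\<tau> i<..\<tau> (Suc i)} s * norm (\<xi> i w)) = (\<Sum>j<n. if j = i then norm (\<xi> i w) else 0)"
    by (intro sum.cong) (auto simp: ind)
  ultimately show ?thesis using i by simp
next
  case False
  thus ?thesis by (simp add: simple_process_def)
qed

lemma integral_interval_clip:
  assumes "0 \<le> t" "t \<le> T" "0 \<le> a" "a \<le> b" "b \<le> T"
  shows "(\<integral>s. indicator {t..T} s * (indicator {a<..b} s :: real) \<partial>time_measure) = clip t T b - clip t T a"
proof -
  have "(\<integral>s. indicator {t..T} s * (indicator {a<..b} s :: real) \<partial>time_measure)
      = (\<integral>s. (indicator ({t..T} \<inter> {a<..b}) s :: real) \<partial>lborel)"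
  proof -
    have "(\<lambda>s. indicator {0..T} s *\<^sub>R (indicator {t..T} s * indicator {a<..b} s))
        = (\<lambda>s. indicator ({t..T} \<inter> {a<..b}) s :: real)"
      using assms by (auto split: split_indicator)
    thus ?thesis using assms by (subst integral_restrict_space) auto
  qed
  also have "\<dots> = measure lborel ({t..T} \<inter> {a<..b})" by simp
  \<comment> \<open>The point \<open>t\<close> belongs to the intersection exactly when
    \<open>a < t \<le> b\<close>; for \<open>b < t\<close> the interval \<open>{t..b}\<close> is
    empty and both clips equal \<open>t\<close>.\<close>
  also have "{t..T} \<inter> {a<..b} = (if a < t then {t..b} else {a<..b})" using assms by auto
  also have "measure lborel \<dots> = clip t T b - clip t T a"
    using assms by (auto simp: clip_def)
  finally show ?thesis .
qed

lemma integral_norm_simple_process: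
  assumes "simple_integrand M F T n \<tau> \<xi>" "t \<in> {0..T}"
  shows "(\<integral>s. indicator {t..T} s * norm (simple_process n \<tau> \<xi> s w) \<partial>time_measure)
    = (\<Sum>i<n. norm (\<xi> i w) * (clip t T (\<tau> (Suc i)) - clip t T (\<tau> i)))"
proof -
  interpret finite_measure time_measure by (rule finite_time_measure)
  have b: "\<tau> i \<in> {0..T}" "\<tau> i \<le> \<tau> (Suc i)" "\<tau> (Suc i) \<in> {0..T}" if "i < n" for i
    using simple_partition(3)[OF assms(1), of i "Suc i"] simple_partition(4)[OF assms(1)] that by auto
  have m: "(\<lambda>s. indicator {a..b} s * indicator {c<..d} s :: real) \<in> borel_measurable time_measure" for a b c d :: real
    by (intro measurable_restrict_space1) measurable
  have "integrable time_measure (\<lambda>s. indicator {t..T} s * indicator {\<tau> i<..\<tau> (Suc i)} s :: real)" for i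
    by (rule integrable_const_bound[of _ 1]) (auto simp: m split: split_indicator)
  hence i: "integrable time_measure (\<lambda>s. norm (\<xi> i w) * (indicator {t..T} s * indicator {\<tau> i<..\<tau> (Suc i)} s))" for i
    by auto
  have "(\<integral>s. indicator {t..T} s * norm (simple_process n \<tau> \<xi> s w) \<partial>time_measure)
      = (\<integral>s. (\<Sum>i<n. norm (\<xi> i w) * (indicator {t..T} s * indicator {\<tau> i<..\<tau> (Suc i)} s)) \<partial>time_measure)"
    by (simp only: norm_simple_process[OF assms(1)] sum_distrib_left mult_ac)
  also have "\<dots> = (\<Sum>i<n. norm (\<xi> i w) * (\<integral>s. indicator {t..T} s * indicator {\<tau> i<..\<tau> (Suc i)} s \<partial>time_measure))"
    using i by (subst Bochner_Integration.integral_sum) auto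
  also have "\<dots> = (\<Sum>i<n. norm (\<xi> i w) * (clip t T (\<tau> (Suc i)) - clip t T (\<tau> i)))"
    using b assms by (intro sum.cong refl arg_cong2[where f="(*)"] integral_interval_clip) auto
  finally show ?thesis .
qed

text \<open>Pathwise: the reverse triangle inequality compares the two norms, and Cauchy--Schwarz
  against the constant \<open>1\<close> on the time interval produces the factor
  \<open>T\<close>.\<close>

lemma drift_approximation:
  assumes z: "z \<in> H2 M F T" and w: "w \<in> space M" and t: "t \<in> {0..T}"
    and fin: "(\<integral>\<^sup>+s. ennreal ((norm (z s w))\<^sup>2) \<partial>time_measure) \<noteq> \<infinity>"
    and simple: "simple_integrand M F T n \<tau> \<xi>"
  shows "ennreal (((LINT s:{t..T}|lborel. norm (z s w))
        - (\<Sum>i<n. norm (\<xi> i w) * (clip t T (\<tau> (Suc i)) - clip t T (\<tau> i))))\<^sup>2)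
    \<le> ennreal T * (\<integral>\<^sup>+s. ennreal ((norm (simple_process n \<tau> \<xi> s w - z s w))\<^sup>2) \<partial>time_measure)"
proof -
  interpret finite_measure time_measure by (rule finite_time_measure)
  let ?p = "\<lambda>s. simple_process n \<tau> \<xi> s w"
  have zm[measurable]: "(\<lambda>s. z s w) \<in> borel_measurable time_measure" by (rule H2_section[OF z w])
  have pm[measurable]: "?p \<in> borel_measurable time_measure"
    unfolding simple_process_def by (intro measurable_restrict_space1) measurable
  have im[measurable]: "indicator {t..T} \<in> borel_measurable time_measure"
    by (intro measurable_restrict_space1) auto
  have i0: "integrable time_measure (\<lambda>s. norm (z s w))"
  proof (rule square_integrable_imp_integrable)
    show "(\<lambda>s. norm (z s w)) \<in> borel_measurable time_measure" by measurable
    thus "integrable time_measure (\<lambda>s. (norm (z s w))\<^sup>2)"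
      using fin by (simp add: integrable_iff_bounded less_top)
  qed
  have iz: "integrable time_measure (\<lambda>s. indicator {t..T} s * norm (z s w))"
    by (rule Bochner_Integration.integrable_bound[OF i0]) (auto split: split_indicator)
  have bp: "norm (?p s) \<le> (\<Sum>i<n. norm (\<xi> i w))" for s
    unfolding norm_simple_process[OF simple] by (intro sum_mono) (auto simp: indicator_def)
  have ip: "integrable time_measure (\<lambda>s. indicator {t..T} s * norm (?p s))"
    by (rule integrable_const_bound[of _ "\<Sum>i<n. norm (\<xi> i w)"])
      (use bp in \<open>auto simp: sum_nonneg split: split_indicator\<close>)
  have i2: "integrable time_measure (\<lambda>s. (norm (?p s - z s w))\<^sup>2)"
  proof (rule Bochner_Integration.integrable_bound)
    show "integrable time_measure (\<lambda>s. 2 * (norm (z s w))\<^sup>2 + 2 * (\<Sum>i<n. norm (\<xi> i w))\<^sup>2)"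
    proof -
      have "integrable time_measure (\<lambda>s. (norm (z s w))\<^sup>2)"
        using fin by (simp add: integrable_iff_bounded less_top)
      thus ?thesis by auto
    qed
    have "(norm (?p s - z s w))\<^sup>2 \<le> 2 * (norm (z s w))\<^sup>2 + 2 * (\<Sum>i<n. norm (\<xi> i w))\<^sup>2" for s
    proof -
      have "norm (?p s - z s w) \<le> norm (z s w) + (\<Sum>i<n. norm (\<xi> i w))"
        using norm_triangle_ineq4[of "?p s" "z s w"] bp[of s] by simp
      hence "(norm (?p s - z s w))\<^sup>2 \<le> (norm (z s w) + (\<Sum>i<n. norm (\<xi> i w)))\<^sup>2" by (intro power_mono) auto
      also have "\<dots> \<le> 2 * (norm (z s w))\<^sup>2 + 2 * (\<Sum>i<n. norm (\<xi> i w))\<^sup>2"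
        using sum_squares_bound[of "norm (z s w)" "\<Sum>i<n. norm (\<xi> i w)"] by (simp add: power2_sum)
      finally show ?thesis .
    qed
    thus "AE s in time_measure. norm ((norm (?p s - z s w))\<^sup>2)
        \<le> norm (2 * (norm (z s w))\<^sup>2 + 2 * (\<Sum>i<n. norm (\<xi> i w))\<^sup>2)" by auto
  qed measurable
  let ?h = "\<lambda>s. indicator {t..T} s * (norm (z s w) - norm (?p s))"
  have hle: "(?h s)\<^sup>2 \<le> (norm (?p s - z s w))\<^sup>2" for s
  proof -
    have "\<bar>?h s\<bar> \<le> norm (?p s - z s w)"
      using norm_triangle_ineq3[of "z s w" "?p s"] by (auto simp: indicator_def norm_minus_commute)
    thus ?thesis by (simp add: abs_le_square_iff[symmetric])
  qed
  have ih2: "integrable time_measure (\<lambda>s. (?h s)\<^sup>2)"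
    by (rule Bochner_Integration.integrable_bound[OF i2]) (use hle in auto)
  have "(LINT s:{t..T}|lborel. norm (z s w)) - (\<Sum>i<n. norm (\<xi> i w) * (clip t T (\<tau> (Suc i)) - clip t T (\<tau> i)))
      = (\<integral>s. ?h s * 1 \<partial>time_measure)"
    unfolding integral_norm_simple_process[OF simple t, symmetric]
    using iz ip t by (simp add: set_integral_time right_diff_distrib)
  also have "(\<dots>)\<^sup>2 \<le> (\<integral>s. (?h s)\<^sup>2 \<partial>time_measure) * (\<integral>s. 1\<^sup>2 \<partial>time_measure)"
    using ih2 by (intro Cauchy_Schwarz_integral) auto
  also have "\<dots> = T * (\<integral>s. (?h s)\<^sup>2 \<partial>time_measure)" by (simp add: space_restrict_space)
  also have "\<dots> \<le> T * (\<integral>s. (norm (?p s - z s w))\<^sup>2 \<partial>time_measure)"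
    using T_pos hle by (intro mult_left_mono integral_mono ih2 i2) auto
  finally show ?thesis
    using T_pos i2 by (simp add: nn_integral_eq_integral ennreal_mult[symmetric] ennreal_leI)
qed

text \<open>The integral of \<open>-m |\<xi>| ds + \<xi> dB\<close> over the time interval from \<open>t\<close> to \<open>T\<close>, for simple \<open>\<xi>\<close>.\<close>

definition simple_driver ::
    "nat \<Rightarrow> (nat \<Rightarrow> real) \<Rightarrow> (nat \<Rightarrow> 'a \<Rightarrow> real ^ 'd) \<Rightarrow> real \<Rightarrow> real \<Rightarrow> 'a \<Rightarrow> real" where
  "simple_driver n \<tau> \<xi> m t w =
     (\<Sum>i<n. \<xi> i w \<bullet> (B (clip t T (\<tau> (Suc i))) w - B (clip t T (\<tau> i)) w)
       - m * (norm (\<xi> i w) * (clip t T (\<tau> (Suc i)) - clip t T (\<tau> i))))"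

text \<open>The equation equates \<open>Q - y t\<close> with the integral of
  \<open>- m |z| ds + z dB\<close> over the time from \<open>t\<close> to \<open>T\<close>; this is
  the defect left when \<open>z\<close> is replaced by a simple process.\<close>

abbreviation bsde_error where
  "bsde_error Q y m t n \<tau> \<xi> \<equiv> \<lambda>w. Q w - y t w - simple_driver n \<tau> \<xi> m t w"

lemma simple_driver_L2:
  assumes simple: "simple_integrand M F T n \<tau> \<xi>" and t: "t \<in> {0..T}"
  shows "simple_driver n \<tau> \<xi> m t \<in> L2 M M"
proof -
  have "(\<lambda>w. \<xi> i w \<bullet> (B (clip t T (\<tau> (Suc i))) w - B (clip t T (\<tau> i)) w)
       - m * (norm (\<xi> i w) * (clip t T (\<tau> (Suc i)) - clip t T (\<tau> i)))) \<in> L2 M M" if i: "i < n" for i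
  proof (rule L2_diff)
    obtain C where C: "\<And>w. w \<in> space M \<Longrightarrow> norm (\<xi> i w) \<le> C"
      using simple i unfolding simple_integrand_def by blast
    have "\<xi> i \<in> borel_measurable (F (\<tau> i))" using simple i by (simp add: simple_integrand_def)
    from measurable_augmented_imp[OF this]
    have [measurable]: "\<xi> i \<in> borel_measurable M"
      using simple_partition(4)[OF simple, of i] i by simp
    have "clip t T x \<in> {0..T}" for x using t by (auto simp: clip_def)
    hence [measurable]: "B (clip t T x) \<in> borel_measurable M" for x
      by (intro measurable_brownian) auto
    let ?D = "\<lambda>w. B (clip t T (\<tau> (Suc i))) w - B (clip t T (\<tau> i)) w"
    have "integrable M (\<lambda>w. (norm (?D w))\<^sup>2)"
      using simple_partition(3)[OF simple, of i "Suc i"] i t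
      by (intro increment_square_integrable) (auto simp: clip_def)
    hence "(\<lambda>w. norm (?D w)) \<in> L2 M M" by (auto simp: L2_def)
    hence g: "(\<lambda>w. C * norm (?D w)) \<in> L2 M M" by (rule L2_cmult)
    have "\<bar>\<xi> i w \<bullet> ?D w\<bar> \<le> \<bar>C * norm (?D w)\<bar>" if "w \<in> space M" for w
    proof -
      have "\<bar>\<xi> i w \<bullet> ?D w\<bar> \<le> norm (\<xi> i w) * norm (?D w)" by (rule Cauchy_Schwarz_ineq2)
      also have "\<dots> \<le> C * norm (?D w)" using C[OF that] by (rule mult_right_mono) simp
      also have "\<dots> \<le> \<bar>C * norm (?D w)\<bar>" by (rule abs_ge_self)
      finally show ?thesis .
    qed
    thus "(\<lambda>w. \<xi> i w \<bullet> ?D w) \<in> L2 M M"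
      by (intro L2_bound[OF _ _ _ g]) auto
    have n: "(\<lambda>w. norm (\<xi> i w)) \<in> L2 M M"
    proof (rule L2_bound[OF subalgebra_refl _ subalgebra_refl L2_const[of C]])
      show "AE w in M. \<bar>norm (\<xi> i w)\<bar> \<le> \<bar>C\<bar>"
        using C by (intro AE_I2) (metis abs_ge_self abs_norm_cancel order_trans)
    qed measurable
    show "(\<lambda>w. m * (norm (\<xi> i w) * (clip t T (\<tau> (Suc i)) - clip t T (\<tau> i)))) \<in> L2 M M"
      using L2_cmult[OF n, of "m * (clip t T (\<tau> (Suc i)) - clip t T (\<tau> i))"] by (simp add: mult_ac)
  qed simp
  thus ?thesis unfolding simple_driver_def by (intro L2_sum) auto
qed

lemma simple_ito_difference:
  assumes "t \<le> T"
  shows "simple_ito_integral B n \<tau> \<xi> T w - simple_ito_integral B n \<tau> \<xi> t w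
    = (\<Sum>i<n. \<xi> i w \<bullet> (B (clip t T (\<tau> (Suc i))) w - B (clip t T (\<tau> i)) w))"
proof -
  have c: "B (min T x) w - B (min t x) w = B (clip t T x) w - B t w" for x
    using assms by (auto simp: clip_def min_def max_def)
  have "B (min T x) w - B (min T y) w - (B (min t x) w - B (min t y) w) = B (clip t T x) w - B (clip t T y) w"
    for x y
  proof -
    have "B (min T x) w - B (min T y) w - (B (min t x) w - B (min t y) w)
      = (B (min T x) w - B (min t x) w) - (B (min T y) w - B (min t y) w)" by simp
    also have "\<dots> = B (clip t T x) w - B (clip t T y) w" unfolding c by simp
    finally show ?thesis .
  qed
  thus ?thesis
    unfolding simple_ito_integral_def sum_subtractf[symmetric] inner_diff_right[symmetric] by simp
qed

text \<open>The defect consists of the drift error and of the errors of the Ito integral at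
  \<open>T\<close> and at \<open>t\<close>. The first is controlled pathwise by the distance of the
  integrands, the other two tend to \<open>0\<close> by the definition of the integral.\<close>

lemma bsde_approximation:
  assumes sol: "solves_bsde M F B T m Q y z" and Q: "Q \<in> L2 M M" and t: "t \<in> {0..T}"
  obtains n \<tau> \<xi> where "\<And>k::nat. simple_integrand M F T (n k) (\<tau> k) (\<xi> k)"
    and "\<And>k. bsde_error Q y m t (n k) (\<tau> k) (\<xi> k) \<in> L2 M M"
    and "(\<lambda>k. l2norm M (bsde_error Q y m t (n k) (\<tau> k) (\<xi> k))) \<longlonglongrightarrow> 0"
proof -
  obtain I where y: "y \<in> H2 M F T" and z: "z \<in> H2 M F T" and I: "has_ito_integral M F B T z I"
    and eq: "\<And>t. t \<in> {0..T} \<Longrightarrow> AE w in M.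
           y t w = Q w + (LINT s:{t..T}|lborel. m * norm (z s w)) - (I T w - I t w)"
    using sol by (auto simp: solves_bsde_def)
  obtain n \<tau> \<xi> where simple: "\<And>k::nat. simple_integrand M F T (n k) (\<tau> k) (\<xi> k)"
    and lim_z: "(\<lambda>k. sq_norm_H2 M T (\<lambda>s w. simple_process (n k) (\<tau> k) (\<xi> k) s w - z s w)) \<longlonglongrightarrow> 0"
    and lim_I: "\<And>t. t \<in> {0..T} \<Longrightarrow>
      (\<lambda>k. \<integral>\<^sup>+w. ennreal ((simple_ito_integral B (n k) (\<tau> k) (\<xi> k) t w - I t w)\<^sup>2) \<partial>M) \<longlonglongrightarrow> 0"
    using I unfolding has_ito_integral_def by blast
  let ?J = "\<lambda>k. simple_ito_integral B (n k) (\<tau> k) (\<xi> k)"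
  have [measurable]: "I t \<in> borel_measurable M" if "t \<in> {0..T}" for t
    using I that by (simp add: has_ito_integral_def)
  have T: "T \<in> {0..T}" using T_pos by simp
  have ym: "y t \<in> borel_measurable M"
    using y t by (intro measurable_augmented_imp[OF progressive_adapted[of y t]]) (simp_all add: H2_def)
  define R where "R k w = Q w - y t w - simple_driver (n k) (\<tau> k) (\<xi> k) m t w" for k w
  have Rm[measurable]: "R k \<in> borel_measurable M" for k
    unfolding R_def[abs_def] using ym L2_D(2)[OF _ Q] L2_D(2)[OF _ simple_driver_L2[OF simple t]]
    by (intro borel_measurable_diff) simp_all
  define Nz where "Nz k w = (\<integral>\<^sup>+s. ennreal ((norm (simple_process (n k) (\<tau> k) (\<xi> k) s w - z s w))\<^sup>2) \<partial>time_measure)"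
    for k w
  define e where "e k t = (\<integral>\<^sup>+w. ennreal ((?J k t w - I t w)\<^sup>2) \<partial>M)" for k t
  have \<xi>m: "\<xi> k i \<in> borel_measurable M" if "i < n k" for k i
  proof (rule measurable_augmented_imp)
    show "\<xi> k i \<in> borel_measurable (F (\<tau> k i))" using simple[of k] that by (simp add: simple_integrand_def)
    show "\<tau> k i \<le> T" using that simple_partition(4)[OF simple, of i k] by simp
  qed
  have Nm[measurable]: "Nz k \<in> borel_measurable M" for k
  proof -
    interpret finite_measure time_measure by (rule finite_time_measure)
    note [measurable] = H2_jointly_measurable[OF z]
    have im: "(\<lambda>s. indicator A s :: real) \<in> borel_measurable time_measure" if "A \<in> sets borel" for A
      using that by (intro measurable_restrict_space1) auto
    have [measurable]: "(\<lambda>(w, s). simple_process (n k) (\<tau> k) (\<xi> k) s w) \<in> borel_measurable (M \<Otimes>\<^sub>M time_measure)"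
      unfolding simple_process_def case_prod_beta'
      by (intro borel_measurable_sum borel_measurable_scaleR
          measurable_compose[OF measurable_snd im] measurable_compose[OF measurable_fst \<xi>m]) auto
    have "(\<lambda>(w, s). ennreal ((norm (simple_process (n k) (\<tau> k) (\<xi> k) s w - z s w))\<^sup>2))
        \<in> borel_measurable (M \<Otimes>\<^sub>M time_measure)"
      by measurable
    thus ?thesis unfolding Nz_def by (rule borel_measurable_nn_integral)
  qed
  have sm[measurable]: "?J k r \<in> borel_measurable M" if "r \<in> {0..T}" for k r
    unfolding simple_ito_integral_def[abs_def]
  proof (intro borel_measurable_sum borel_measurable_inner borel_measurable_diff)
    fix i assume "i \<in> {..<n k}"
    hence i: "i < n k" by simp
    show "\<xi> k i \<in> borel_measurable M" by (rule \<xi>m[OF i])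
    show "B (min r (\<tau> k (Suc i))) \<in> borel_measurable M" "B (min r (\<tau> k i)) \<in> borel_measurable M"
      using that simple_partition(4)[OF simple, of i k] simple_partition(4)[OF simple, of "Suc i" k] i
      by (auto intro!: measurable_brownian)
  qed
  \<comment> \<open>The right side minus the left side is
    \<open>(a - b)\<^sup>2 + (b + c)\<^sup>2 + (a + c)\<^sup>2\<close>.\<close>
  have three_squares: "(c - a - b)\<^sup>2 \<le> 3 * (a\<^sup>2 + b\<^sup>2 + c\<^sup>2)" for a b c :: real
    using zero_le_power2[of "a - b"] zero_le_power2[of "b + c"] zero_le_power2[of "a + c"]
    by (simp add: power2_eq_square algebra_simps)
  have bound: "(\<integral>\<^sup>+w. ennreal ((R k w)\<^sup>2) \<partial>M)
      \<le> 3 * (ennreal (m\<^sup>2 * T) * (\<integral>\<^sup>+w. Nz k w \<partial>M) + e k T + e k t)" for k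
  proof -
    have "AE w in M. ennreal ((R k w)\<^sup>2) \<le> 3 * (ennreal (m\<^sup>2 * T) * Nz k w
        + ennreal ((?J k T w - I T w)\<^sup>2)
        + ennreal ((?J k t w - I t w)\<^sup>2))"
      using eq[OF t] H2_AE_finite[OF z] AE_space
    proof eventually_elim
      case (elim w)
      let ?Z = "LINT s:{t..T}|lborel. norm (z s w)"
      let ?S = "\<Sum>i<n k. norm (\<xi> k i w) * (clip t T (\<tau> k (Suc i)) - clip t T (\<tau> k i))"
      let ?a = "m * (?Z - ?S)" and ?b = "?J k T w - I T w"
        and ?c = "?J k t w - I t w"
      have "simple_driver (n k) (\<tau> k) (\<xi> k) m t w
          = ?J k T w - ?J k t w - m * ?S"
        using simple_ito_difference[of t "n k" "\<tau> k" "\<xi> k" w] t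
        by (simp add: simple_driver_def sum_subtractf sum_distrib_left)
      hence "R k w = ?c - ?a - ?b"
        using elim(1) by (simp add: R_def algebra_simps)
      hence "(R k w)\<^sup>2 \<le> 3 * (?a\<^sup>2 + ?b\<^sup>2 + ?c\<^sup>2)"
        using three_squares by simp
      hence "ennreal ((R k w)\<^sup>2) \<le> ennreal (3 * (?a\<^sup>2 + ?b\<^sup>2 + ?c\<^sup>2))" by (rule ennreal_leI)
      also have "\<dots> = 3 * (ennreal (m\<^sup>2) * ennreal ((?Z - ?S)\<^sup>2) + ennreal (?b\<^sup>2) + ennreal (?c\<^sup>2))"
        by (simp add: ennreal_mult ennreal_plus power_mult_distrib)
      also have "\<dots> \<le> 3 * (ennreal (m\<^sup>2) * (ennreal T * Nz k w) + ennreal (?b\<^sup>2) + ennreal (?c\<^sup>2))"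
        using drift_approximation[OF z elim(3) t elim(2) simple[of k]] unfolding Nz_def[symmetric]
        by (intro mult_left_mono add_right_mono) auto
      finally show ?case using T_pos by (simp add: ennreal_mult mult.assoc)
    qed
    hence "(\<integral>\<^sup>+w. ennreal ((R k w)\<^sup>2) \<partial>M) \<le> (\<integral>\<^sup>+w. 3 * (ennreal (m\<^sup>2 * T) * Nz k w
        + ennreal ((?J k T w - I T w)\<^sup>2)
        + ennreal ((?J k t w - I t w)\<^sup>2)) \<partial>M)"
      by (rule nn_integral_mono_AE)
    also have "\<dots> = 3 * (ennreal (m\<^sup>2 * T) * (\<integral>\<^sup>+w. Nz k w \<partial>M) + e k T + e k t)"
      unfolding e_def using sm[OF t] sm[OF T] \<open>\<And>t. t \<in> {0..T} \<Longrightarrow> I t \<in> borel_measurable M\<close>[OF t]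
        \<open>\<And>t. t \<in> {0..T} \<Longrightarrow> I t \<in> borel_measurable M\<close>[OF T]
      by (simp add: nn_integral_cmult nn_integral_add)
    finally show ?thesis .
  qed
  have "(\<lambda>k. 3 * (ennreal (m\<^sup>2 * T) * (\<integral>\<^sup>+w. Nz k w \<partial>M) + e k T + e k t)) \<longlonglongrightarrow> 3 * (ennreal (m\<^sup>2 * T) * 0 + 0 + 0)"
    using lim_z lim_I[OF t] lim_I[OF T] unfolding e_def Nz_def sq_norm_H2_time
    by (intro tendsto_intros ennreal_tendsto_cmult) auto
  hence up: "(\<lambda>k. 3 * (ennreal (m\<^sup>2 * T) * (\<integral>\<^sup>+w. Nz k w \<partial>M) + e k T + e k t)) \<longlonglongrightarrow> 0" by simp
  have lim: "(\<lambda>k. \<integral>\<^sup>+w. ennreal ((R k w)\<^sup>2) \<partial>M) \<longlonglongrightarrow> 0"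
  proof (rule tendsto_sandwich[OF _ _ tendsto_const up])
    show "\<forall>\<^sub>F k in sequentially. (\<integral>\<^sup>+w. ennreal ((R k w)\<^sup>2) \<partial>M)
        \<le> 3 * (ennreal (m\<^sup>2 * T) * (\<integral>\<^sup>+w. Nz k w \<partial>M) + e k T + e k t)"
      using bound by (intro always_eventually allI)
  qed simp
  hence "\<forall>\<^sub>F k in sequentially. (\<integral>\<^sup>+w. ennreal ((R k w)\<^sup>2) \<partial>M) < 1"
    by (rule order_tendstoD) simp
  \<comment> \<open>Convergence in \<open>ennreal\<close> permits finitely many infinite terms;
    shifting the sequence by \<open>K\<close> drops them, so that every defect lies in
    \<open>L2\<close>.\<close>
  then obtain K where K: "\<And>k. K \<le> k \<Longrightarrow> (\<integral>\<^sup>+w. ennreal ((R k w)\<^sup>2) \<partial>M) < \<infinity>"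
    unfolding eventually_sequentially by (metis ennreal_one_less_top infinity_ennreal_def order_less_trans)
  have l: "(\<lambda>k. (l2norm M (R (k + K)))\<^sup>2) \<longlonglongrightarrow> 0"
  proof -
    have "(\<lambda>k. enn2real (\<integral>\<^sup>+w. ennreal ((R (k + K) w)\<^sup>2) \<partial>M)) \<longlonglongrightarrow> 0"
      using LIMSEQ_ignore_initial_segment[OF lim, of K] by (intro tendsto_enn2real) simp_all
    thus ?thesis using L2_of_nn_integral(2)[OF Rm K[OF le_add2]] by simp
  qed
  show thesis
  proof (rule that[of "\<lambda>k. n (k + K)" "\<lambda>k. \<tau> (k + K)" "\<lambda>k. \<xi> (k + K)"])
    show "simple_integrand M F T (n (k + K)) (\<tau> (k + K)) (\<xi> (k + K))" for k by (rule simple)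
    show "bsde_error Q y m t (n (k + K)) (\<tau> (k + K)) (\<xi> (k + K)) \<in> L2 M M" for k
      using L2_of_nn_integral(1)[OF Rm K, of "k + K"] by (simp add: R_def[abs_def])
    show "(\<lambda>k. l2norm M (bsde_error Q y m t (n (k + K)) (\<tau> (k + K)) (\<xi> (k + K)))) \<longlonglongrightarrow> 0"
      using l unfolding l2norm_tendsto_iff l2norm_square by (simp add: R_def)
  qed
qed

text \<open>Membership of \<open>y\<close> in \<open>H2\<close> controls \<open>y t\<close> for
  almost every \<open>t\<close> only. The equation controls it for every \<open>t\<close>:
  \<open>y t\<close> is \<open>Q\<close> minus a defect minus a simple driver, and one approximation
  suffices.\<close>

lemma bsde_solution_L2:
  assumes sol: "solves_bsde M F B T m Q y z" and Q: "Q \<in> L2 M M" and t: "t \<in> {0..T}"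
  shows "y t \<in> L2 M (F t)"
proof -
  obtain n \<tau> \<xi> where simple: "\<And>k::nat. simple_integrand M F T (n k) (\<tau> k) (\<xi> k)"
    and R: "\<And>k. bsde_error Q y m t (n k) (\<tau> k) (\<xi> k) \<in> L2 M M"
    and "(\<lambda>k. l2norm M (bsde_error Q y m t (n k) (\<tau> k) (\<xi> k))) \<longlonglongrightarrow> 0"
    by (rule bsde_approximation[OF assms], rule that)
  have "(\<lambda>w. Q w - (Q w - y t w - simple_driver (n 0) (\<tau> 0) (\<xi> 0) m t w)
      - simple_driver (n 0) (\<tau> 0) (\<xi> 0) m t w) \<in> L2 M M"
    by (intro L2_diff Q R simple_driver_L2[OF simple t] subalgebra_refl)
  moreover have "y t \<in> borel_measurable (F t)"
    using progressive_adapted[of y t] sol t by (auto simp: solves_bsde_def H2_def)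
  ultimately show ?thesis by (simp add: L2_def)
qed

end

section \<open>Change of measure in the backward equation\<close>

context simple_exponential
begin

text \<open>Used in two situations: a density started at \<open>r = 0\<close> with \<open>H\<close>
  an indicator, and a density started at \<open>r = t\<close>, where \<open>G t t\<close> is
  \<open>1\<close> and \<open>H\<close> is an arbitrary integrable variable.\<close>

lemma weighted_integrand:
  fixes \<xi> :: "'a \<Rightarrow> real ^ 'd"
  assumes rts: "0 \<le> r" "r \<le> t" "t \<le> s" "s \<le> T"
    and H: "H \<in> borel_measurable (F t)" "integrable M (\<lambda>w. G r t w * H w)"
    and \<xi>: "\<xi> \<in> borel_measurable (F s)" "\<And>w. w \<in> space M \<Longrightarrow> norm (\<xi> w) \<le> C"
  shows "(\<lambda>w. (G r s w * H w) *\<^sub>R \<xi> w) \<in> borel_measurable (F s)" (is "?W \<in> _")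
    and "integrable M (\<lambda>w. (G r s w * H w) *\<^sub>R \<xi> w)"
proof -
  have [measurable]: "H \<in> borel_measurable (F s)" "G r s \<in> borel_measurable (F s)" "\<xi> \<in> borel_measurable (F s)"
    using rts H(1) \<xi>(1) by (auto intro!: G_measurable intro: measurable_augmented_mono)
  show m: "?W \<in> borel_measurable (F s)" by measurable
  have "G r t \<in> borel_measurable (F t)" using rts by (intro G_measurable) auto
  hence "(\<lambda>w. G r t w * H w) \<in> borel_measurable (F t)" using H(1) by measurable
  from G_martingale[OF _ _ _ this H(2), of s] rts
  have "integrable M (\<lambda>w. G t s w * (G r t w * H w))" by (simp add: has_bochner_integral_iff)
  moreover have "G t s w * (G r t w * H w) = G r s w * H w" for w
    using G_split[of r t s w] rts by (simp add: mult_ac)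
  ultimately have i: "integrable M (\<lambda>w. C * \<bar>G r s w * H w\<bar>)" by simp
  show "integrable M ?W"
  proof (rule Bochner_Integration.integrable_bound[OF i])
    show "?W \<in> borel_measurable M" using measurable_augmented_imp[OF m] rts by simp
    have "norm (?W w) \<le> norm (C * \<bar>G r s w * H w\<bar>)" if "w \<in> space M" for w
    proof -
      have "norm (?W w) = norm (\<xi> w) * \<bar>G r s w * H w\<bar>" by simp
      also have "\<dots> \<le> C * \<bar>G r s w * H w\<bar>" using \<xi>(2)[OF that] by (rule mult_right_mono) simp
      also have "\<dots> \<le> norm (C * \<bar>G r s w * H w\<bar>)" unfolding real_norm_def by (rule abs_ge_self)
      finally show ?thesis .
    qed
    thus "AE w in M. norm (?W w) \<le> norm (C * \<bar>G r s w * H w\<bar>)" by auto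
  qed
qed

lemma weighted_norm_martingale:
  fixes \<xi> :: "'a \<Rightarrow> real ^ 'd"
  assumes rts: "0 \<le> r" "r \<le> t" "t \<le> s" "s \<le> T"
    and H: "H \<in> borel_measurable (F t)" "integrable M (\<lambda>w. G r t w * H w)"
    and \<xi>: "\<xi> \<in> borel_measurable (F s)" "\<And>w. w \<in> space M \<Longrightarrow> norm (\<xi> w) \<le> C"
  shows "has_bochner_integral M (\<lambda>w. G r T w * (H w * norm (\<xi> w))) (\<integral>w. G r s w * H w * norm (\<xi> w) \<partial>M)"
proof -
  note W = weighted_integrand[OF assms]
  have m: "H \<in> borel_measurable (F s)" "G r s \<in> borel_measurable (F s)"
    using rts H(1) by (auto intro!: G_measurable intro: measurable_augmented_mono)
  have "(\<lambda>w. G r s w * H w * norm (\<xi> w)) \<in> borel_measurable (F s)" using m \<xi>(1) by measurable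
  moreover have "integrable M (\<lambda>w. G r s w * H w * norm (\<xi> w))"
  proof (rule Bochner_Integration.integrable_bound[OF W(2)])
    show "(\<lambda>w. G r s w * H w * norm (\<xi> w)) \<in> borel_measurable M"
      by (rule measurable_augmented_imp[OF calculation]) (use rts in simp)
    show "AE w in M. norm (G r s w * H w * norm (\<xi> w)) \<le> norm ((G r s w * H w) *\<^sub>R \<xi> w)"
      by (intro AE_I2) (simp only: real_norm_def norm_scaleR abs_mult abs_norm_cancel order_refl)
  qed
  ultimately have "has_bochner_integral M (\<lambda>w. G s T w * (G r s w * H w * norm (\<xi> w)))
      (\<integral>w. G r s w * H w * norm (\<xi> w) \<partial>M)"
    using rts by (intro G_martingale) auto
  moreover have "G s T w * (G r s w * H w * norm (\<xi> w)) = G r T w * (H w * norm (\<xi> w))" for w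
    using G_split[of r s T w] rts by (simp add: mult_ac)
  ultimately show ?thesis by simp
qed

text \<open>The partitions of \<open>\<theta>\<close> and \<open>\<xi>\<close> are unrelated, so
  each cell of \<open>\<xi>\<close> is treated by \<open>G_increment_le\<close>: its stochastic part
  contributes at most \<open>m\<close> times its length times the weighted mean of
  \<open>norm (\<xi> i w)\<close>, which is exactly what the drift subtracts.\<close>

lemma G_simple_driver_le:
  assumes rt: "0 \<le> r" "r \<le> t" "t \<le> T"
    and H: "H \<in> borel_measurable (F t)" "integrable M (\<lambda>w. G r t w * H w)" "\<And>w. 0 \<le> H w"
    and \<xi>: "simple_integrand M F T k \<sigma> \<xi>"
  shows "integrable M (\<lambda>w. G r T w * (H w * simple_driver k \<sigma> \<xi> m t w))"
    and "(\<integral>w. G r T w * (H w * simple_driver k \<sigma> \<xi> m t w) \<partial>M) \<le> 0"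
proof -
  let ?term = "\<lambda>i w. G r T w * (H w * (\<xi> i w \<bullet> (B (clip t T (\<sigma> (Suc i))) w - B (clip t T (\<sigma> i)) w)
       - m * (norm (\<xi> i w) * (clip t T (\<sigma> (Suc i)) - clip t T (\<sigma> i)))))"
  have summand: "integrable M (?term i) \<and> (\<integral>w. ?term i w \<partial>M) \<le> 0" if i: "i < k" for i
  proof (cases "\<sigma> (Suc i) \<le> t")
    case True
    have "clip t T (\<sigma> (Suc i)) = t" "clip t T (\<sigma> i) = t"
      using True simple_partition(3)[OF \<xi>, of i "Suc i"] i rt by (auto simp: clip_def)
    thus ?thesis by simp
  next
    case False
    define s u where "s = clip t T (\<sigma> i)" and "u = clip t T (\<sigma> (Suc i))"
    have su: "t \<le> s" "s \<le> u" "u \<le> T" "\<sigma> i \<le> s"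
      using simple_partition(3)[OF \<xi>, of i "Suc i"] simple_partition(4)[OF \<xi>, of i] i rt
      by (auto simp: s_def u_def clip_def)
    have s: "0 \<le> r" "r \<le> t" "t \<le> s" "s \<le> T" using su rt by auto
    obtain C where C: "\<And>w. w \<in> space M \<Longrightarrow> norm (\<xi> i w) \<le> C"
      using \<xi> i unfolding simple_integrand_def by blast
    have \<xi>m: "\<xi> i \<in> borel_measurable (F s)"
    proof (rule measurable_augmented_mono)
      show "\<xi> i \<in> borel_measurable (F (\<sigma> i))" using \<xi> i by (simp add: simple_integrand_def)
    qed (use su s in simp_all)
    note W = weighted_integrand[OF s H(1,2) \<xi>m C]
    note N = weighted_norm_martingale[OF s H(1,2) \<xi>m C]
    let ?W = "\<lambda>w. (G r s w * H w) *\<^sub>R \<xi> i w"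
    have L: "integrable M (\<lambda>w. G s T w * (?W w \<bullet> (B u w - B s w)))"
      "(\<integral>w. G s T w * (?W w \<bullet> (B u w - B s w)) \<partial>M) \<le> (u - s) * (m * (\<integral>w. norm (?W w) \<partial>M))"
      using G_increment_le[OF _ su(2,3) W] s by auto
    have n: "norm (?W w) = G r s w * H w * norm (\<xi> i w)" for w
      using H(3)[of w] by (simp add: abs_mult)
    have eq: "?term i w = G s T w * (?W w \<bullet> (B u w - B s w)) - ((u - s) * m) * (G r T w * (H w * norm (\<xi> i w)))" for w
      using G_split[of r s T w, symmetric] s by (simp add: s_def[symmetric] u_def[symmetric] algebra_simps)
    show ?thesis
      unfolding eq using L N unfolding n by (auto simp: has_bochner_integral_iff mult.assoc)
  qed
  have eq: "G r T w * (H w * simple_driver k \<sigma> \<xi> m t w) = (\<Sum>i<k. ?term i w)" for w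
    unfolding simple_driver_def sum_distrib_left ..
  show "integrable M (\<lambda>w. G r T w * (H w * simple_driver k \<sigma> \<xi> m t w))"
    unfolding eq using summand by (intro Bochner_Integration.integrable_sum) auto
  show "(\<integral>w. G r T w * (H w * simple_driver k \<sigma> \<xi> m t w) \<partial>M) \<le> 0"
    unfolding eq using summand by (subst Bochner_Integration.integral_sum) (auto intro: sum_nonpos)
qed

text \<open>For \<open>p = 2\<close> and \<open>p = -1\<close> the factor \<open>(p\<^sup>2 - p) / 2\<close> equals \<open>1\<close>.\<close>

lemma G_power_le:
  assumes p: "p = 2 \<or> p = -1" and t: "0 \<le> t" "t \<le> T" and w: "w \<in> space M"
  shows "exp (p * stoch_log n \<tau> \<theta> t T w) \<le> exp (m\<^sup>2 * T) * stoch_exp n \<tau> (\<lambda>i w. p *\<^sub>R \<theta> i w) t T w"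
proof -
  let ?c = "\<lambda>i. clip t T (\<tau> i)"
  have "p * stoch_log n \<tau> \<theta> t T w = stoch_log n \<tau> (\<lambda>i w. p *\<^sub>R \<theta> i w) t T w
      + (\<Sum>i<n. (norm (\<theta> i w))\<^sup>2 * (?c (Suc i) - ?c i))"
  proof -
    have "p * (x - a / 2 * d) = p * x - (p\<^sup>2 * a) / 2 * d + a * d" for x a d :: real
      using p by (auto simp: power2_eq_square algebra_simps)
    thus ?thesis
      unfolding stoch_log_def sum_distrib_left sum.distrib[symmetric]
      by (simp add: power_mult_distrib)
  qed
  also have "(\<Sum>i<n. (norm (\<theta> i w))\<^sup>2 * (?c (Suc i) - ?c i)) \<le> (\<Sum>i<n. m\<^sup>2 * (?c (Suc i) - ?c i))"
  proof (intro sum_mono mult_right_mono)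
    fix i assume "i \<in> {..<n}"
    thus "(norm (\<theta> i w))\<^sup>2 \<le> m\<^sup>2" using bound[of i w] w by (intro power_mono) auto
    show "0 \<le> ?c (Suc i) - ?c i"
      using partition(3)[of i "Suc i"] \<open>i \<in> {..<n}\<close> by (auto simp: clip_def)
  qed
  also have "\<dots> = m\<^sup>2 * (T - t)"
    using t unfolding sum_distrib_left[symmetric] sum_lessThan_telescope[of ?c n] partition(1,2)
    by (simp add: clip_def)
  also have "\<dots> \<le> m\<^sup>2 * T" using t by (intro mult_left_mono) auto
  finally show ?thesis by (simp add: stoch_exp_def exp_add[symmetric] add.commute)
qed

lemma scaled: "simple_exponential M T B n \<tau> (\<lambda>i w. p *\<^sub>R \<theta> i w) (\<bar>p\<bar> * m)"
proof unfold_locales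
  have "\<exists>C. \<forall>w\<in>space M. norm (p *\<^sub>R \<theta> i w) \<le> C" if "i < n" for i
    using bound[OF that] by (intro exI[of _ "\<bar>p\<bar> * m"]) (auto intro: mult_left_mono)
  thus "simple_integrand M F T n \<tau> (\<lambda>i w. p *\<^sub>R \<theta> i w)"
    using simple unfolding simple_integrand_def by (auto intro!: borel_measurable_scaleR)
  show "norm (p *\<^sub>R \<theta> i w) \<le> \<bar>p\<bar> * m" if "i < n" "w \<in> space M" for i w
    using bound[OF that] by (auto intro: mult_left_mono)
  show "0 \<le> \<bar>p\<bar> * m" using m_nonneg by simp
qed

text \<open>The square of the density is at most \<open>exp (m\<^sup>2 * T)\<close> times the
  exponential of \<open>2 \<theta>\<close>. The latter starts at time \<open>t\<close>, when
  \<open>H\<close> is already known, so weighting by it does not change the mean of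
  \<open>(H w)\<^sup>2\<close>.\<close>

lemma G_L2:
  assumes t: "t \<in> {0..T}" and H: "H \<in> L2 M (F t)"
  shows "(\<lambda>w. G t T w * H w) \<in> L2 M M"
    and "l2norm M (\<lambda>w. G t T w * H w) \<le> exp (m\<^sup>2 * T / 2) * l2norm M H"
proof -
  interpret D: simple_exponential M T B n \<tau> "\<lambda>i w. 2 *\<^sub>R \<theta> i w" "\<bar>2\<bar> * m" by (rule scaled)
  have "G t T \<in> borel_measurable (F T)" using t by (intro G_measurable) auto
  hence [measurable]: "G t T \<in> borel_measurable M" by (rule measurable_augmented_imp) simp
  have "subalgebra M (F t)" using t by simp
  note HL = L2_D[OF this H]
  note [measurable] = HL(2)
  have "(\<lambda>w. (H w)\<^sup>2) \<in> borel_measurable (F t)" using HL(1) by measurable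
  from D.G_martingale[OF _ _ _ this HL(3), of T] t
  have D: "has_bochner_integral M (\<lambda>w. D.G t T w * (H w)\<^sup>2) (\<integral>w. (H w)\<^sup>2 \<partial>M)" by simp
  have le: "(G t T w * H w)\<^sup>2 \<le> exp (m\<^sup>2 * T) * (D.G t T w * (H w)\<^sup>2)" if "w \<in> space M" for w
  proof -
    have "(G t T w)\<^sup>2 = exp (2 * stoch_log n \<tau> \<theta> t T w)" by (simp add: stoch_exp_def exp_double)
    also have "\<dots> \<le> exp (m\<^sup>2 * T) * D.G t T w" using t that by (intro G_power_le) auto
    finally have "(G t T w)\<^sup>2 * (H w)\<^sup>2 \<le> exp (m\<^sup>2 * T) * D.G t T w * (H w)\<^sup>2" by (rule mult_right_mono) simp
    thus ?thesis by (simp add: power_mult_distrib mult_ac)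
  qed
  have i: "integrable M (\<lambda>w. exp (m\<^sup>2 * T) * (D.G t T w * (H w)\<^sup>2))"
    using D by (simp add: has_bochner_integral_iff)
  have i2: "integrable M (\<lambda>w. (G t T w * H w)\<^sup>2)"
  proof (rule Bochner_Integration.integrable_bound[OF i])
    show "AE w in M. norm ((G t T w * H w)\<^sup>2) \<le> norm (exp (m\<^sup>2 * T) * (D.G t T w * (H w)\<^sup>2))"
      using le by (intro AE_I2) (simp add: abs_mult)
  qed measurable
  thus "(\<lambda>w. G t T w * H w) \<in> L2 M M" by (simp add: L2_def)
  have "(l2norm M (\<lambda>w. G t T w * H w))\<^sup>2 \<le> (\<integral>w. exp (m\<^sup>2 * T) * (D.G t T w * (H w)\<^sup>2) \<partial>M)"
    unfolding l2norm_square using i i2 le by (intro integral_mono)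
  also have "\<dots> = (exp (m\<^sup>2 * T / 2) * l2norm M H)\<^sup>2"
    using D by (simp add: has_bochner_integral_iff l2norm_square power_mult_distrib exp_double[symmetric])
  finally show "l2norm M (\<lambda>w. G t T w * H w) \<le> exp (m\<^sup>2 * T / 2) * l2norm M H"
    by (rule power2_le_imp_le) simp
qed

text \<open>The same comparison with the exponential of \<open>- \<theta>\<close>, whose mean is
  \<open>1\<close>.\<close>

lemma G_inverse:
  assumes t: "t \<in> {0..T}"
  shows "integrable M (\<lambda>w. 1 / G t T w)" and "(\<integral>w. 1 / G t T w \<partial>M) \<le> exp (m\<^sup>2 * T)"
proof -
  interpret D: simple_exponential M T B n \<tau> "\<lambda>i w. (-1) *\<^sub>R \<theta> i w" "\<bar>-1\<bar> * m" by (rule scaled)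
  have "G t T \<in> borel_measurable (F T)" using t by (intro G_measurable) auto
  hence [measurable]: "G t T \<in> borel_measurable M" by (rule measurable_augmented_imp) simp
  have "has_bochner_integral M (\<lambda>w. D.G t T w * 1) (\<integral>w. 1 \<partial>M)"
    using t by (intro D.G_martingale) auto
  hence D: "has_bochner_integral M (\<lambda>w. D.G t T w) 1" by (simp add: prob_space)
  have le: "1 / G t T w \<le> exp (m\<^sup>2 * T) * D.G t T w" if "w \<in> space M" for w
    using G_power_le[of "-1" t w] t that by (simp add: stoch_exp_def exp_minus divide_inverse)
  have i: "integrable M (\<lambda>w. exp (m\<^sup>2 * T) * D.G t T w)" using D by (simp add: has_bochner_integral_iff)
  show i2: "integrable M (\<lambda>w. 1 / G t T w)"
  proof (rule Bochner_Integration.integrable_bound[OF i])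
    show "AE w in M. norm (1 / G t T w) \<le> norm (exp (m\<^sup>2 * T) * D.G t T w)"
    proof (rule AE_I2)
      fix w assume "w \<in> space M"
      have "norm (1 / G t T w) = 1 / G t T w" by simp
      also have "\<dots> \<le> exp (m\<^sup>2 * T) * D.G t T w" by (rule le) fact
      also have "\<dots> \<le> norm (exp (m\<^sup>2 * T) * D.G t T w)" unfolding real_norm_def by (rule abs_ge_self)
      finally show "norm (1 / G t T w) \<le> norm (exp (m\<^sup>2 * T) * D.G t T w)" .
    qed
  qed measurable
  have "(\<integral>w. 1 / G t T w \<partial>M) \<le> (\<integral>w. exp (m\<^sup>2 * T) * D.G t T w \<partial>M)"
    using i i2 le by (intro integral_mono)
  thus "(\<integral>w. 1 / G t T w \<partial>M) \<le> exp (m\<^sup>2 * T)" using D by (simp add: has_bochner_integral_iff)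
qed

end

section \<open>Optimal densities and the dual description of the backward equation\<close>

context augmented_brownian
begin

text \<open>Among the vectors of norm at most \<open>m\<close>, \<open>m sgn \<xi>\<close> maximises
  the inner product with \<open>\<xi>\<close>.\<close>

lemma sgn_exponential:
  assumes "simple_integrand M F T n \<tau> \<xi>" "0 \<le> m"
  shows "simple_exponential M T B n \<tau> (\<lambda>i w. m *\<^sub>R sgn (\<xi> i w)) m"
proof unfold_locales
  have b: "norm (m *\<^sub>R sgn (\<xi> i w)) \<le> m" for i w using assms(2) by (simp add: norm_sgn)
  thus "norm (m *\<^sub>R sgn (\<xi> i w)) \<le> m" for i w .
  have "(\<lambda>w. m *\<^sub>R sgn (\<xi> i w)) \<in> borel_measurable (F (\<tau> i))" if "i < n" for i
    using assms(1) that unfolding simple_integrand_def sgn_div_norm by (auto intro!: borel_measurable_scaleR)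
  thus "simple_integrand M F T n \<tau> (\<lambda>i w. m *\<^sub>R sgn (\<xi> i w))"
    using assms(1) b unfolding simple_integrand_def by blast
qed fact

text \<open>Density and driver now share one partition, so \<open>G_increment_step\<close> gives an
  equality, and \<open>\<xi> \<bullet> (m sgn \<xi>) = m |\<xi>|\<close> makes stochastic part and
  drift cancel in every cell.\<close>

lemma sgn_exponential_driver:
  assumes \<xi>: "simple_integrand M F T n \<tau> \<xi>" and m: "0 \<le> m" and t: "t \<in> {0..T}"
    and H: "H \<in> borel_measurable (F t)" "integrable M H"
  shows "has_bochner_integral M (\<lambda>w. stoch_exp n \<tau> (\<lambda>i w. m *\<^sub>R sgn (\<xi> i w)) t T w
    * (H w * simple_driver n \<tau> \<xi> m t w)) 0"
proof -
  interpret simple_exponential M T B n \<tau> "\<lambda>i w. m *\<^sub>R sgn (\<xi> i w)" m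
    by (rule sgn_exponential[OF \<xi> m])
  let ?term = "\<lambda>i w. G t T w * (H w * (\<xi> i w \<bullet> (B (clip t T (\<tau> (Suc i))) w - B (clip t T (\<tau> i)) w)
       - m * (norm (\<xi> i w) * (clip t T (\<tau> (Suc i)) - clip t T (\<tau> i)))))"
  have summand: "has_bochner_integral M (?term i) 0" if i: "i < n" for i
  proof (cases "\<tau> (Suc i) \<le> t")
    case True
    have "clip t T (\<tau> (Suc i)) = t" "clip t T (\<tau> i) = t"
      using True partition(3)[of i "Suc i"] i t by (auto simp: clip_def)
    thus ?thesis by (simp add: has_bochner_integral_zero)
  next
    case False
    define s u where "s = clip t T (\<tau> i)" and "u = clip t T (\<tau> (Suc i))"
    have su: "t \<le> s" "s \<le> u" "u \<le> \<tau> (Suc i)" "\<tau> i \<le> s" "u \<le> T"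
      using partition(3)[of i "Suc i"] partition(4)[of i] partition(4)[of "Suc i"] i t False
      by (auto simp: s_def u_def clip_def)
    have s: "0 \<le> t" "t \<le> t" "t \<le> s" "s \<le> T" using su t by auto
    obtain C where C: "\<And>w. w \<in> space M \<Longrightarrow> norm (\<xi> i w) \<le> C"
      using \<xi> i unfolding simple_integrand_def by blast
    have \<xi>m: "\<xi> i \<in> borel_measurable (F s)"
    proof (rule measurable_augmented_mono)
      show "\<xi> i \<in> borel_measurable (F (\<tau> i))" using \<xi> i by (simp add: simple_integrand_def)
    qed (use su s in simp_all)
    have H': "integrable M (\<lambda>w. G t t w * H w)" using H(2) by simp
    note W = weighted_integrand[OF s H(1) H' \<xi>m C]
    note N = weighted_norm_martingale[OF s H(1) H' \<xi>m C]
    let ?W = "\<lambda>w. (G t s w * H w) *\<^sub>R \<xi> i w"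
    have n: "?W w \<bullet> (m *\<^sub>R sgn (\<xi> i w)) = m * (G t s w * H w * norm (\<xi> i w))" for w
    proof -
      have "x \<bullet> sgn x = norm x" for x :: "real ^ 'd"
        by (cases "x = 0") (simp_all add: sgn_div_norm power2_norm_eq_inner[symmetric] power2_eq_square)
      thus ?thesis by (simp only: inner_scaleR_left inner_scaleR_right mult_ac)
    qed
    have L: "has_bochner_integral M (\<lambda>w. G s T w * (?W w \<bullet> (B u w - B s w)))
        ((u - s) * (m * (\<integral>w. G t s w * H w * norm (\<xi> i w) \<partial>M)))"
      using G_increment_step[OF i su(4,2,3) W] unfolding n by simp
    have eq: "?term i w = G s T w * (?W w \<bullet> (B u w - B s w)) - ((u - s) * m) * (G t T w * (H w * norm (\<xi> i w)))" for w
      using G_split[of t s T w, symmetric] s by (simp add: s_def[symmetric] u_def[symmetric] algebra_simps)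
    have "has_bochner_integral M (\<lambda>w. ((u - s) * m) * (G t T w * (H w * norm (\<xi> i w))))
        ((u - s) * (m * (\<integral>w. G t s w * H w * norm (\<xi> i w) \<partial>M)))"
      unfolding mult.assoc[symmetric, of "u - s" m "\<integral>w. _ w \<partial>M"] by (intro has_bochner_integral_mult_right N)
    from has_bochner_integral_diff[OF L this] show ?thesis unfolding eq by simp
  qed
  have eq: "G t T w * (H w * simple_driver n \<tau> \<xi> m t w) = (\<Sum>i<n. ?term i w)" for w
    unfolding simple_driver_def sum_distrib_left ..
  show ?thesis
    unfolding eq using has_bochner_integral_sum[of "{..<n}" M ?term "\<lambda>_. 0"] summand by simp
qed

text \<open>The integrand is hidden because the moment bounds used for these densities are uniform
  in it.\<close>

definition girsanov_density :: "real \<Rightarrow> real \<Rightarrow> ('a \<Rightarrow> real) \<Rightarrow> bool" where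
  "girsanov_density m t \<Gamma> \<longleftrightarrow> (\<exists>n \<tau> \<theta>. simple_exponential M T B n \<tau> \<theta> m \<and> \<Gamma> = stoch_exp n \<tau> \<theta> t T)"

lemma girsanov_density_facts:
  assumes "girsanov_density m t \<Gamma>" "t \<in> {0..T}"
  shows "0 < \<Gamma> w"
    and "integrable M (\<lambda>w. 1 / \<Gamma> w)" and "(\<integral>w. 1 / \<Gamma> w \<partial>M) \<le> exp (m\<^sup>2 * T)"
    and "H \<in> L2 M (F t) \<Longrightarrow> (\<lambda>w. \<Gamma> w * H w) \<in> L2 M M"
    and "H \<in> L2 M (F t) \<Longrightarrow> l2norm M (\<lambda>w. \<Gamma> w * H w) \<le> exp (m\<^sup>2 * T / 2) * l2norm M H"
    and "H \<in> borel_measurable (F t) \<Longrightarrow> integrable M H \<Longrightarrow> has_bochner_integral M (\<lambda>w. \<Gamma> w * H w) (\<integral>w. H w \<partial>M)"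
    and "\<Gamma> \<in> L2 M M"
proof -
  obtain n \<tau> \<theta> where "simple_exponential M T B n \<tau> \<theta> m" and \<Gamma>: "\<Gamma> = stoch_exp n \<tau> \<theta> t T"
    using assms unfolding girsanov_density_def by blast
  then interpret simple_exponential M T B n \<tau> \<theta> m by simp
  show "0 < \<Gamma> w" by (simp add: \<Gamma>)
  show "integrable M (\<lambda>w. 1 / \<Gamma> w)" "(\<integral>w. 1 / \<Gamma> w \<partial>M) \<le> exp (m\<^sup>2 * T)"
    unfolding \<Gamma> by (rule G_inverse[OF assms(2)])+
  show "(\<lambda>w. \<Gamma> w * H w) \<in> L2 M M" "l2norm M (\<lambda>w. \<Gamma> w * H w) \<le> exp (m\<^sup>2 * T / 2) * l2norm M H"
    if "H \<in> L2 M (F t)" unfolding \<Gamma> by (rule G_L2[OF assms(2) that])+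
  show "has_bochner_integral M (\<lambda>w. \<Gamma> w * H w) (\<integral>w. H w \<partial>M)"
    if "H \<in> borel_measurable (F t)" "integrable M H"
    unfolding \<Gamma> using assms(2) that by (intro G_martingale) auto
  show "\<Gamma> \<in> L2 M M" using G_L2(1)[OF assms(2) L2_const[of 1]] by (simp add: \<Gamma>)
qed

text \<open>The \<open>k\<close>-th density is the one that annihilates the \<open>k\<close>-th
  simple driver. It leaves the mean of \<open>H y t\<close> unchanged, as this variable is known at
  time \<open>t\<close>, and the defect disappears in the limit because the norm of
  \<open>\<Gamma> k w * H w\<close> is bounded uniformly in \<open>k\<close>.\<close>

lemma bsde_representation:
  assumes sol: "solves_bsde M F B T m Q y z" and Q: "Q \<in> L2 M M" and t: "t \<in> {0..T}" and m: "0 \<le> m"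
  obtains \<Gamma> where "\<And>k::nat. girsanov_density m t (\<Gamma> k)"
    and "\<And>H. H \<in> L2 M (F t) \<Longrightarrow> (\<lambda>k. \<integral>w. \<Gamma> k w * H w * Q w \<partial>M) \<longlonglongrightarrow> (\<integral>w. H w * y t w \<partial>M)"
proof -
  obtain n \<tau> \<xi> where simple: "\<And>k::nat. simple_integrand M F T (n k) (\<tau> k) (\<xi> k)"
    and R: "\<And>k. bsde_error Q y m t (n k) (\<tau> k) (\<xi> k) \<in> L2 M M"
    and lim: "(\<lambda>k. l2norm M (bsde_error Q y m t (n k) (\<tau> k) (\<xi> k))) \<longlonglongrightarrow> 0"
    by (rule bsde_approximation[OF sol Q t], rule that)
  define \<Gamma> where "\<Gamma> k = stoch_exp (n k) (\<tau> k) (\<lambda>i w. m *\<^sub>R sgn (\<xi> k i w)) t T" for k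
  have \<Gamma>: "girsanov_density m t (\<Gamma> k)" for k
    unfolding girsanov_density_def \<Gamma>_def using sgn_exponential[OF simple m] by blast
  note facts = girsanov_density_facts[OF \<Gamma> t]
  have st: "subalgebra M (F t)" using t by simp
  have y: "y t \<in> L2 M (F t)" by (rule bsde_solution_L2[OF sol Q t])
  show thesis
  proof (rule that[of \<Gamma>])
    show "girsanov_density m t (\<Gamma> k)" for k by (rule \<Gamma>)
    fix H assume H: "H \<in> L2 M (F t)"
    have iHy: "integrable M (\<lambda>w. H w * y t w)"
      by (intro L2_integrable_mult L2_D(4)[OF st] H y)
    have mHy: "(\<lambda>w. H w * y t w) \<in> borel_measurable (F t)" using L2_D(1)[OF st H] L2_D(1)[OF st y] by measurable
    have iH: "integrable M H" using L2_integrable L2_D(4)[OF st H] by blast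
    define e where "e k = (\<integral>w. \<Gamma> k w * H w * bsde_error Q y m t (n k) (\<tau> k) (\<xi> k) w \<partial>M)" for k
    have eq: "(\<integral>w. \<Gamma> k w * H w * Q w \<partial>M) = (\<integral>w. H w * y t w \<partial>M) + e k" for k
    proof -
      \<comment> \<open>\<open>Q\<close> is split into the defect, \<open>y t\<close> and the simple
        driver.\<close>
      have "has_bochner_integral M (\<lambda>w. \<Gamma> k w * H w * bsde_error Q y m t (n k) (\<tau> k) (\<xi> k) w
          + \<Gamma> k w * (H w * y t w) + \<Gamma> k w * (H w * simple_driver (n k) (\<tau> k) (\<xi> k) m t w))
          (e k + (\<integral>w. H w * y t w \<partial>M) + 0)"
        unfolding e_def \<Gamma>_def
        by (intro has_bochner_integral_add sgn_exponential_driver simple m t has_bochner_integral_integrable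
            L2_integrable_mult R facts[unfolded \<Gamma>_def] H mHy iHy iH L2_D(1)[OF st H])
      thus ?thesis by (simp add: has_bochner_integral_iff algebra_simps)
    qed
    have "(\<lambda>k. exp (m\<^sup>2 * T / 2) * l2norm M H *
        l2norm M (bsde_error Q y m t (n k) (\<tau> k) (\<xi> k))) \<longlonglongrightarrow> 0"
      using tendsto_mult_left[OF lim, of "exp (m\<^sup>2 * T / 2) * l2norm M H"] by simp
    moreover have "\<bar>e k\<bar> \<le> exp (m\<^sup>2 * T / 2) * l2norm M H *
        l2norm M (bsde_error Q y m t (n k) (\<tau> k) (\<xi> k))" for k
      unfolding e_def
      by (rule order_trans[OF L2_Cauchy_Schwarz[OF facts(4)[OF H] R]]) (intro mult_right_mono facts(5)[OF H], simp)
    ultimately have "e \<longlonglongrightarrow> 0"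
      by (intro Lim_null_comparison[of e]) (simp_all only: real_norm_def always_eventually simp_thms)
    from tendsto_add[OF tendsto_const this, of "\<integral>w. H w * y t w \<partial>M"]
    show "(\<lambda>k. \<integral>w. \<Gamma> k w * H w * Q w \<partial>M) \<longlonglongrightarrow> (\<integral>w. H w * y t w \<partial>M)" by (simp add: eq)
  qed
qed

text \<open>Under any admissible density the conditional mean of \<open>Q\<close> given
  \<open>F t\<close> is at most \<open>y t\<close>; this is tested on events. The density starts at
  \<open>0\<close> so that it can be used in estimates of the \<open>g\<close>-expectation.\<close>

lemma bsde_supersolution:
  assumes sol: "solves_bsde M F B T m Q y z" and Q: "Q \<in> L2 M M" and t: "t \<in> {0..T}"
    and \<Gamma>: "girsanov_density m 0 \<Gamma>" and A: "A \<in> sets (F t)"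
  shows "(\<integral>w. \<Gamma> w * (indicator A w * (Q w - y t w)) \<partial>M) \<le> 0"
proof -
  obtain n \<tau> \<xi> where approx: "\<And>k::nat. simple_integrand M F T (n k) (\<tau> k) (\<xi> k)"
    and R: "\<And>k. bsde_error Q y m t (n k) (\<tau> k) (\<xi> k) \<in> L2 M M"
    and lim: "(\<lambda>k. l2norm M (bsde_error Q y m t (n k) (\<tau> k) (\<xi> k))) \<longlonglongrightarrow> 0"
    by (rule bsde_approximation[OF sol Q t], rule that)
  obtain N \<sigma> \<theta> where "simple_exponential M T B N \<sigma> \<theta> m" and \<Gamma>_eq: "\<Gamma> = stoch_exp N \<sigma> \<theta> 0 T"
    using \<Gamma> unfolding girsanov_density_def by blast
  then interpret simple_exponential M T B N \<sigma> \<theta> m by simp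
  have AM: "A \<in> events" using A t sets_augmented_subset[of t] by auto
  have "0 \<in> {0..T}" using T_pos by simp
  note facts = girsanov_density_facts[OF \<Gamma> this]
  have \<Gamma>A: "(\<lambda>w. indicator A w * \<Gamma> w) \<in> L2 M M"
    by (intro L2_indicator AM facts subalgebra_refl)
  have "has_bochner_integral M (\<lambda>w. G 0 t w * 1) (\<integral>w. 1 \<partial>M)"
    using t by (intro G_martingale) auto
  hence "integrable M (\<lambda>w. G 0 t w * 1)" by (rule integrable.intros)
  from integrable_mult_indicator[OF AM this]
  have iA: "integrable M (\<lambda>w. G 0 t w * indicator A w)" by (simp add: mult.commute)
  have mA: "indicator A \<in> borel_measurable (F t)" using A by simp
  have drv: "integrable M (\<lambda>w. \<Gamma> w * (indicator A w * simple_driver (n k) (\<tau> k) (\<xi> k) m t w))"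
    "(\<integral>w. \<Gamma> w * (indicator A w * simple_driver (n k) (\<tau> k) (\<xi> k) m t w) \<partial>M) \<le> 0" for k
    using G_simple_driver_le[OF order_refl _ _ mA iA _ approx] t by (simp_all add: \<Gamma>_eq)
  let ?e = "\<lambda>k. l2norm M (\<lambda>w. indicator A w * \<Gamma> w) * l2norm M (bsde_error Q y m t (n k) (\<tau> k) (\<xi> k))"
  have "(\<integral>w. \<Gamma> w * (indicator A w * (Q w - y t w)) \<partial>M) \<le> ?e k" for k
  proof -
    have "(\<integral>w. \<Gamma> w * (indicator A w * (Q w - y t w)) \<partial>M)
      = (\<integral>w. indicator A w * \<Gamma> w * bsde_error Q y m t (n k) (\<tau> k) (\<xi> k) w
          + \<Gamma> w * (indicator A w * simple_driver (n k) (\<tau> k) (\<xi> k) m t w) \<partial>M)"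
      by (intro Bochner_Integration.integral_cong refl) (simp add: algebra_simps)
    also have "\<dots> = (\<integral>w. indicator A w * \<Gamma> w * bsde_error Q y m t (n k) (\<tau> k) (\<xi> k) w \<partial>M)
        + (\<integral>w. \<Gamma> w * (indicator A w * simple_driver (n k) (\<tau> k) (\<xi> k) m t w) \<partial>M)"
      by (intro Bochner_Integration.integral_add L2_integrable_mult \<Gamma>A R drv)
    also have "\<dots> \<le> ?e k + 0"
      by (intro add_mono drv order_trans[OF abs_ge_self L2_Cauchy_Schwarz] \<Gamma>A R)
    finally show ?thesis by simp
  qed
  moreover have "?e \<longlonglongrightarrow> 0" using tendsto_mult_left[OF lim] by simp
  ultimately show ?thesis by (intro LIMSEQ_le_const[of ?e]) auto
qed

end

section \<open>Square-integrable variables of the filtration\<close>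

context augmented_brownian
begin

lemma T_nonneg [simp]: "0 \<le> T"
  using T_pos by simp

lemma terminal: "T \<in> {0..T}" "0 \<in> {0..T}"
  by simp_all

lemma L2_filtration_mono: "X \<in> L2 M (F s) \<Longrightarrow> s \<le> t \<Longrightarrow> t \<le> T \<Longrightarrow> X \<in> L2 M (F t)"
  by (auto simp: L2_def intro: measurable_augmented_mono)

lemma L2_plus_filtration_mono: "X \<in> L2_plus M (F s) \<Longrightarrow> s \<le> t \<Longrightarrow> t \<le> T \<Longrightarrow> X \<in> L2_plus M (F t)"
  using L2_filtration_mono by (auto simp: L2_plus_def)

lemma L2_ambient: "X \<in> L2 M (F t) \<Longrightarrow> t \<le> T \<Longrightarrow> X \<in> L2 M M"
  using L2_D(4)[of M "F t"] by simp

lemma L2_plus_add: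
  assumes "t \<le> T" "X \<in> L2_plus M (F t)" "Y \<in> L2_plus M (F t)"
  shows "(\<lambda>w. X w + Y w) \<in> L2_plus M (F t)"
proof (rule L2_plusI)
  show "(\<lambda>w. X w + Y w) \<in> L2 M (F t)" using assms by (intro L2_add L2_plusD) auto
  show "AE w in M. 0 \<le> X w + Y w"
    using L2_plusD(2)[OF assms(2)] L2_plusD(2)[OF assms(3)] by eventually_elim simp
qed

lemma L2_plus_indicator:
  assumes "t \<le> T" "A \<in> sets (F t)" "X \<in> L2_plus M (F t)"
  shows "(\<lambda>w. indicator A w * X w) \<in> L2_plus M (F t)"
proof (rule L2_plusI)
  show "(\<lambda>w. indicator A w * X w) \<in> L2 M (F t)" using assms by (intro L2_indicator L2_plusD) auto
  show "AE w in M. 0 \<le> indicator A w * X w"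
    using L2_plusD(2)[OF assms(3)] by eventually_elim (simp add: indicator_def)
qed

text \<open>\<open>B 0\<close> vanishes almost surely, so whether \<open>B 0\<close> lies in
  \<open>S\<close> is decided by whether \<open>0\<close> does.\<close>

lemma natural_0_trivial:
  assumes "A \<in> sets (natural_filtration M B 0)"
  shows "(AE w in M. w \<in> A) \<or> (AE w in M. w \<notin> A)"
proof -
  have B0: "AE w in M. B 0 w = 0" using brownian by (simp add: brownian_motion_def)
  have "{B r -` S \<inter> space M | r S. r \<in> {0..0} \<and> S \<in> sets borel}
      = {B 0 -` S \<inter> space M | S. S \<in> sets borel}"
    by auto
  hence "natural_filtration M B 0 = vimage_algebra (space M) (B 0) borel"
    by (simp add: natural_filtration_def vimage_algebra_def)
  then obtain S where A: "A = B 0 -` S \<inter> space M"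
    using assms by (auto simp: sets_vimage_algebra2)
  show ?thesis
  proof (cases "0 \<in> S")
    case True
    have "AE w in M. w \<in> A" using B0 AE_space by eventually_elim (simp add: A True)
    thus ?thesis ..
  next
    case False
    have "AE w in M. w \<notin> A" using B0 AE_space by eventually_elim (simp add: A False)
    thus ?thesis ..
  qed
qed

lemma F_0_trivial:
  assumes "A \<in> sets (F 0)"
  shows "(AE w in M. w \<in> A) \<or> (AE w in M. w \<notin> A)"
proof -
  obtain A' where A': "A' \<in> sets (natural_filtration M B 0)" "AE w in M. w \<in> A \<longleftrightarrow> w \<in> A'"
    using augmented_ae_natural[OF less_imp_le[OF T_pos] assms] by blast
  from natural_0_trivial[OF A'(1)] show ?thesis
  proof
    assume "AE w in M. w \<in> A'"
    with A'(2) have "AE w in M. w \<in> A" by eventually_elim simp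
    thus ?thesis ..
  next
    assume "AE w in M. w \<notin> A'"
    with A'(2) have "AE w in M. w \<notin> A" by eventually_elim simp
    thus ?thesis ..
  qed
qed

lemma F_0_constant:
  assumes f: "f \<in> L2 M (F 0)"
  shows "AE w in M. f w = (\<integral>w. f w \<partial>M)"
proof -
  define c where "c = (\<integral>w. f w \<partial>M)"
  have sub: "subalgebra M (F 0)" using T_pos by simp
  have [measurable]: "f \<in> borel_measurable (F 0)" by (rule L2_D(1)[OF sub f])
  have i: "integrable M f" using L2_integrable L2_D(4)[OF sub f] by blast
  \<comment> \<open>The event that \<open>g\<close> is positive is almost surely sure or impossible;
    in the first case a vanishing mean forces \<open>g\<close> to vanish almost surely. This is
    applied to \<open>f - c\<close> and to \<open>c - f\<close>.\<close>
  have le: "AE w in M. g w \<le> 0" if g: "integrable M g" "(\<integral>w. g w \<partial>M) = 0" "g \<in> borel_measurable (F 0)" for g :: "'a \<Rightarrow> real"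
  proof -
    note [measurable] = g(3)
    have "{w \<in> space (F 0). 0 < g w} \<in> sets (F 0)" by measurable
    from F_0_trivial[OF this] show ?thesis
    proof
      assume "AE w in M. w \<in> {w \<in> space (F 0). 0 < g w}"
      hence pos: "AE w in M. 0 < g w" by eventually_elim simp
      hence "AE w in M. 0 \<le> g w" by eventually_elim simp
      with g have "AE w in M. g w = 0" by (simp add: integral_nonneg_eq_0_iff_AE)
      thus ?thesis by eventually_elim simp
    next
      assume "AE w in M. w \<notin> {w \<in> space (F 0). 0 < g w}"
      thus ?thesis using AE_space by eventually_elim auto
    qed
  qed
  have "AE w in M. f w - c \<le> 0" by (rule le) (use i in \<open>auto simp: c_def prob_space\<close>)
  moreover have "AE w in M. c - f w \<le> 0" by (rule le) (use i in \<open>auto simp: c_def prob_space\<close>)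
  ultimately show ?thesis unfolding c_def[symmetric] by eventually_elim simp
qed

lemma ae_const_eqI:
  assumes "AE w in M. Y w = c"
  shows "ae_const M Y = c"
  unfolding ae_const_def
proof (rule the_equality, rule assms)
  fix d assume "AE w in M. Y w = d"
  with assms have "AE w in M. c = d" by eventually_elim simp
  thus "d = c" by simp
qed

end

section \<open>Domination of the conditional operators\<close>

locale floor_operator = augmented_brownian M T B
  for M :: "'a measure" and T and B :: "real \<Rightarrow> 'a \<Rightarrow> real ^ 'd" +
  fixes \<mu> :: real and E :: "real \<Rightarrow> real \<Rightarrow> ('a \<Rightarrow> real) \<Rightarrow> 'a \<Rightarrow> real"
  assumes operator: "consistent_operator_zero_floor M F T E"
    and mu_pos: "0 < \<mu>"
    and dominated: "\<And>X Y. X \<in> L2_plus M (F T) \<Longrightarrow> Y \<in> L2_plus M (F T) \<Longrightarrow>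
      \<exists>c. has_g_expectation M F B T \<mu> Y c \<and>
        (AE w in M. E 0 T (\<lambda>w. X w + Y w) w - E 0 T X w \<le> c)"
    and translation: "\<And>t X Y. t \<in> {0..T} \<Longrightarrow> X \<in> L2_plus M (F T) \<Longrightarrow> Y \<in> L2_plus M (F t) \<Longrightarrow>
      AE w in M. E t T (\<lambda>w. X w + Y w) w = E t T X w + Y w"
begin

section \<open>The axioms of the operator and their direct consequences\<close>

lemma E_in: "0 \<le> s \<Longrightarrow> s \<le> t \<Longrightarrow> t \<le> T \<Longrightarrow> Y \<in> L2_plus M (F t) \<Longrightarrow> E s t Y \<in> L2_plus M (F s)"
  using operator[unfolded consistent_operator_zero_floor_def, THEN conjunct1] by blast

lemma E_mono:
  "0 \<le> s \<Longrightarrow> s \<le> t \<Longrightarrow> t \<le> T \<Longrightarrow> Y \<in> L2_plus M (F t) \<Longrightarrow> Y' \<in> L2_plus M (F t) \<Longrightarrow>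
    AE w in M. Y' w \<le> Y w \<Longrightarrow> AE w in M. E s t Y' w \<le> E s t Y w"
  using operator[unfolded consistent_operator_zero_floor_def, THEN conjunct2, THEN conjunct2, THEN conjunct1] by blast

lemma E_strict_mono:
  assumes "0 \<le> r" "r \<le> t" "t \<le> T" "Y \<in> L2_plus M (F t)" "Y' \<in> L2_plus M (F t)"
    "\<And>s. s \<in> {r..t} \<Longrightarrow> AE w in M. 0 < E s t Y w" "AE w in M. Y w \<le> Y' w"
    "AE w in M. E r t Y' w = E r t Y w"
  shows "AE w in M. Y' w = Y w"
  using operator[unfolded consistent_operator_zero_floor_def, THEN conjunct2, THEN conjunct2, THEN conjunct2, THEN conjunct1] assms by blast

lemma E_id: "0 \<le> s \<Longrightarrow> s \<le> t \<Longrightarrow> t \<le> T \<Longrightarrow> Y \<in> L2_plus M (F s) \<Longrightarrow> AE w in M. E s t Y w = Y w"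
  using operator[unfolded consistent_operator_zero_floor_def, THEN conjunct2, THEN conjunct2, THEN conjunct2, THEN conjunct2, THEN conjunct1] by blast

lemma E_tower:
  "0 \<le> r \<Longrightarrow> r \<le> s \<Longrightarrow> s \<le> t \<Longrightarrow> t \<le> T \<Longrightarrow> Y \<in> L2_plus M (F t) \<Longrightarrow>
    AE w in M. E r s (E s t Y) w = E r t Y w"
  using operator[unfolded consistent_operator_zero_floor_def, THEN conjunct2, THEN conjunct2, THEN conjunct2, THEN conjunct2, THEN conjunct2, THEN conjunct1] by blast

lemma E_indicator:
  "0 \<le> s \<Longrightarrow> s \<le> t \<Longrightarrow> t \<le> T \<Longrightarrow> A \<in> sets (F s) \<Longrightarrow> Y \<in> L2_plus M (F t) \<Longrightarrow>
    AE w in M. E s t (\<lambda>w. indicator A w * Y w) w = indicator A w * E s t Y w"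
  using operator[unfolded consistent_operator_zero_floor_def, THEN conjunct2, THEN conjunct2, THEN conjunct2, THEN conjunct2, THEN conjunct2, THEN conjunct2] by blast

lemma E_cong:
  assumes st: "0 \<le> s" "s \<le> t" "t \<le> T" and Y: "Y \<in> L2_plus M (F t)" "Y' \<in> L2_plus M (F t)"
    and eq: "AE w in M. Y w = Y' w"
  shows "AE w in M. E s t Y w = E s t Y' w"
proof -
  have "AE w in M. Y w \<le> Y' w" "AE w in M. Y' w \<le> Y w"
    using eq by (eventually_elim, simp)+
  from E_mono[OF st Y(2,1) this(1)] E_mono[OF st Y this(2)]
  show ?thesis by eventually_elim simp
qed

text \<open>Both (a) and (b) refer to the terminal time \<open>T\<close>; this allows an earlier
  terminal time to be exchanged for \<open>T\<close>.\<close>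

lemma E_restrict:
  assumes st: "0 \<le> s" "s \<le> t" "t \<le> T" and Y: "Y \<in> L2_plus M (F t)"
  shows "AE w in M. E s T Y w = E s t Y w"
proof -
  have YT: "Y \<in> L2_plus M (F T)" using L2_plus_filtration_mono[OF Y] st by simp
  have "AE w in M. E s t (E t T Y) w = E s T Y w" using st YT by (intro E_tower) auto
  moreover have "AE w in M. E s t (E t T Y) w = E s t Y w"
    using st Y YT by (intro E_cong E_id E_in) auto
  ultimately show ?thesis by eventually_elim simp
qed

lemma E_ge_const:
  assumes st: "0 \<le> s" "s \<le> t" "t \<le> T" and Y: "Y \<in> L2_plus M (F t)" and c: "0 \<le> c" "AE w in M. c \<le> Y w"
  shows "AE w in M. c \<le> E s t Y w"
proof -
  have "AE w in M. E s t (\<lambda>_. c) w \<le> E s t Y w" by (intro E_mono st Y c L2_plus_const)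
  moreover have "AE w in M. E s t (\<lambda>_. c) w = c" by (intro E_id[of s t "\<lambda>_. c"] st L2_plus_const c)
  ultimately show ?thesis by eventually_elim simp
qed

text \<open>Axiom (D4) determines the value on \<open>A\<close> and on its complement separately,
  and the two pieces are glued.\<close>

lemma E_local_perturbation:
  assumes t: "t \<in> {0..T}" and A: "A \<in> sets (F t)"
    and P: "P \<in> L2_plus M (F T)" and Q: "Q \<in> L2_plus M (F T)"
  shows "AE w in M. E t T (\<lambda>w. P w + indicator A w * Q w) w
    = E t T P w + indicator A w * (E t T (\<lambda>w. P w + Q w) w - E t T P w)"
proof -
  let ?A' = "space M - A"
  have A': "?A' \<in> sets (F t)" using sets.compl_sets[OF A] by simp
  have AT: "A \<in> sets (F T)" using A t sets_augmented_mono[of t T] by auto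
  have PQ: "(\<lambda>w. P w + Q w) \<in> L2_plus M (F T)" "(\<lambda>w. P w + indicator A w * Q w) \<in> L2_plus M (F T)"
    using P Q AT by (auto intro!: L2_plus_add L2_plus_indicator)
  have st: "0 \<le> t" "t \<le> T" "T \<le> T" using t by auto
  have "(\<lambda>w. indicator A w * (P w + indicator A w * Q w)) = (\<lambda>w. indicator A w * (P w + Q w))"
    by (auto split: split_indicator)
  moreover have "(\<lambda>w. indicator ?A' w * (P w + indicator A w * Q w)) = (\<lambda>w. indicator ?A' w * P w)"
    by (auto split: split_indicator)
  ultimately have "AE w in M. indicator A w * E t T (\<lambda>w. P w + indicator A w * Q w) w
      = indicator A w * E t T (\<lambda>w. P w + Q w) w"
    "AE w in M. indicator ?A' w * E t T (\<lambda>w. P w + indicator A w * Q w) w = indicator ?A' w * E t T P w"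
    using E_indicator[OF st A PQ(1)] E_indicator[OF st A PQ(2)] E_indicator[OF st A' P]
      E_indicator[OF st A' PQ(2)] by auto
  thus ?thesis using AE_space
  proof eventually_elim
    case (elim w)
    thus ?case by (cases "w \<in> A") auto
  qed
qed

text \<open>Hypothesis (a) contains existence: it is applied with both variables equal to
  \<open>Q\<close>.\<close>

lemma g_expectation_exists:
  assumes "Q \<in> L2_plus M (F T)"
  obtains c y z where "solves_bsde M F B T \<mu> Q y z" "AE w in M. y 0 w = c" "has_g_expectation M F B T \<mu> Q c"
  using dominated[OF assms assms] unfolding has_g_expectation_def by blast

text \<open>The value at time \<open>0\<close> is a limit of means under densities, hence at most
  any common upper bound of such means. The argument covers every number \<open>c'\<close> to which
  \<open>V\<close> is related.\<close>

lemma g_expectation_le_const: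
  assumes V: "V \<in> L2 M M" and g: "has_g_expectation M F B T \<mu> V c'"
    and le: "\<And>\<Gamma>. girsanov_density \<mu> 0 \<Gamma> \<Longrightarrow> (\<integral>w. \<Gamma> w * V w \<partial>M) \<le> c"
  shows "c' \<le> c"
proof -
  obtain y z where sol: "solves_bsde M F B T \<mu> V y z" and y0: "AE w in M. y 0 w = c'"
    using g by (auto simp: has_g_expectation_def)
  have 0: "0 \<in> {0..T}" using T_pos by simp
  obtain \<Gamma> where \<Gamma>: "\<And>k::nat. girsanov_density \<mu> 0 (\<Gamma> k)"
    and lim: "\<And>H. H \<in> L2 M (F 0) \<Longrightarrow> (\<lambda>k. \<integral>w. \<Gamma> k w * H w * V w \<partial>M) \<longlonglongrightarrow> (\<integral>w. H w * y 0 w \<partial>M)"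
    by (rule bsde_representation[OF sol V 0 less_imp_le[OF mu_pos]], rule that)
  have "(\<integral>w. y 0 w \<partial>M) = (\<integral>w. c' \<partial>M)"
    using L2_D(2)[OF _ bsde_solution_L2[OF sol V 0]] 0 y0 by (intro integral_cong_AE) auto
  hence "(\<lambda>k. \<integral>w. \<Gamma> k w * V w \<partial>M) \<longlonglongrightarrow> c'"
    using lim[OF L2_const[of 1]] by (simp add: prob_space)
  thus ?thesis using le[OF \<Gamma>] by (intro LIMSEQ_le_const2) auto
qed

text \<open>On a bounded part \<open>A\<close> of the event where the claim fails, the payoff \<open>c + 1\<^sub>A (Q - y t)\<close> has
  \<open>g\<close>-expectation at most \<open>c\<close>, so that adding it to \<open>P\<close> changes \<open>E 0 T\<close> by at most \<open>c\<close>;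
  strict monotonicity then forces \<open>A\<close> to be null.\<close>

lemma conditional_domination:
  assumes t: "t \<in> {0..T}" and P: "P \<in> L2_plus M (F T)" and Q: "Q \<in> L2_plus M (F T)"
    and sol: "solves_bsde M F B T \<mu> Q y z"
  shows "AE w in M. E t T (\<lambda>w. P w + Q w) w \<le> E t T P w + y t w"
proof -
  define D where "D w = E t T (\<lambda>w. P w + Q w) w - E t T P w" for w
  have st: "0 \<le> t" "t \<le> T" "T \<le> T" "0 \<le> T" using t by auto
  have QM: "Q \<in> L2 M M" using L2_plusD(1)[OF Q] by (rule L2_ambient) simp
  have yL: "y t \<in> L2 M (F t)" by (rule bsde_solution_L2[OF sol QM t])
  have sub: "subalgebra M (F t)" using st by simp
  have PQ: "(\<lambda>w. P w + Q w) \<in> L2_plus M (F T)" using P Q by (intro L2_plus_add) auto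
  have EP: "E t T P \<in> L2_plus M (F t)" and EPQ: "E t T (\<lambda>w. P w + Q w) \<in> L2_plus M (F t)"
    using st P PQ by (auto intro!: E_in)
  have [measurable]: "y t \<in> borel_measurable (F t)" "D \<in> borel_measurable (F t)"
    using L2_D(1)[OF sub yL] L2_D(1)[OF sub L2_plusD(1)[OF EP]] L2_D(1)[OF sub L2_plusD(1)[OF EPQ]]
    by (auto simp: D_def[abs_def])
  have null: "AE w in M. w \<notin> {w \<in> space M. y t w < D w \<and> \<bar>y t w\<bar> \<le> real N + 1}" for N :: nat
  proof -
    define A where "A = {w \<in> space (F t). y t w < D w \<and> \<bar>y t w\<bar> \<le> real N + 1}"
    \<comment> \<open>Two demands meet here: \<open>c\<close> bounds \<open>y t\<close> on
      \<open>A\<close>, which makes \<open>Y'\<close> nonnegative, and it is positive even for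
      \<open>N = 0\<close>, which keeps \<open>X1\<close> above the floor.\<close>
    define c where "c = real N + 1"
    have c: "0 < c" by (simp add: c_def)
    have A: "A \<in> sets (F t)" unfolding A_def by measurable
    have AT: "A \<in> sets (F T)" using A st sets_augmented_mono[of t T] by auto
    have yA: "\<bar>indicator A w * y t w\<bar> \<le> c" for w using c by (auto simp: A_def c_def indicator_def)
    have iQ: "(\<lambda>w. indicator A w * Q w) \<in> L2_plus M (F T)" using AT Q by (intro L2_plus_indicator) auto
    have iy: "(\<lambda>w. indicator A w * y t w) \<in> L2 M (F t)" by (rule L2_indicator[OF sub A yL])
    \<comment> \<open>The payoff \<open>c + 1_A (Q - y t)\<close> is arranged as a sum of two
      nonnegative terms, the second of which is known at time \<open>t\<close>, so that (b) can
      extract it.\<close>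
    define Y' where "Y' w = c - indicator A w * y t w" for w
    have Y': "Y' \<in> L2_plus M (F t)"
      unfolding Y'_def[abs_def]
      using yA by (intro L2_plusI L2_diff[OF sub L2_const iy] AE_I2) (simp add: abs_le_iff)
    define V where "V w = indicator A w * Q w + Y' w" for w
    have V: "V \<in> L2_plus M (F T)"
      unfolding V_def[abs_def] using iQ L2_plus_filtration_mono[OF Y'] st by (intro L2_plus_add) auto
    have VM: "V \<in> L2 M M" using L2_plusD(1)[OF V] by (rule L2_ambient) simp
    obtain c' where c': "has_g_expectation M F B T \<mu> V c'"
      "AE w in M. E 0 T (\<lambda>w. P w + V w) w - E 0 T P w \<le> c'"
      using dominated[OF P V] by blast
    \<comment> \<open>Under each density the constant contributes \<open>c\<close>, and the part on
      \<open>A\<close> contributes at most \<open>0\<close> by the supersolution property.\<close>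
    have "c' \<le> c"
    proof (rule g_expectation_le_const[OF VM c'(1)])
      fix \<Gamma> assume \<Gamma>: "girsanov_density \<mu> 0 \<Gamma>"
      have 0: "0 \<in> {0..T}" using T_pos by simp
      note facts = girsanov_density_facts[OF \<Gamma> 0]
      have "has_bochner_integral M (\<lambda>w. \<Gamma> w * c) (\<integral>w. c \<partial>M)" by (rule facts(6)) auto
      hence i1: "integrable M (\<lambda>w. \<Gamma> w * c)" "(\<integral>w. \<Gamma> w * c \<partial>M) = c"
        by (auto simp only: has_bochner_integral_iff) (simp add: prob_space)
      have "(\<lambda>w. indicator A w * (Q w - y t w)) \<in> L2 M M"
        using AT sets_augmented_subset[of T]
        by (intro L2_indicator L2_diff QM L2_ambient[OF yL]) (use st in auto)
      hence i2: "integrable M (\<lambda>w. \<Gamma> w * (indicator A w * (Q w - y t w)))"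
        by (intro L2_integrable_mult facts)
      have "(\<integral>w. \<Gamma> w * V w \<partial>M) = (\<integral>w. \<Gamma> w * c + \<Gamma> w * (indicator A w * (Q w - y t w)) \<partial>M)"
        by (intro Bochner_Integration.integral_cong refl) (simp add: V_def Y'_def algebra_simps)
      also have "\<dots> = c + (\<integral>w. \<Gamma> w * (indicator A w * (Q w - y t w)) \<partial>M)"
        using i1 i2 by simp
      also have "\<dots> \<le> c" using bsde_supersolution[OF sol QM t \<Gamma> A] by simp
      finally show "(\<integral>w. \<Gamma> w * V w \<partial>M) \<le> c" .
    qed
    \<comment> \<open>\<open>X1\<close> is what the bound by \<open>c\<close> at time
      \<open>0\<close> allows as value at time \<open>t\<close>, and \<open>X2\<close> is the actual
      value; they differ by \<open>D - y t\<close> on \<open>A\<close>, so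
      \<open>X1 \<le> X2\<close>.\<close>
    define X1 where "X1 w = E t T P w + c" for w
    have X1: "X1 \<in> L2_plus M (F t)"
      unfolding X1_def[abs_def] using EP st c by (intro L2_plus_add L2_plus_const) auto
    have PV: "(\<lambda>w. P w + V w) \<in> L2_plus M (F T)" using P V by (intro L2_plus_add) auto
    define X2 where "X2 = E t T (\<lambda>w. P w + V w)"
    have X2: "X2 \<in> L2_plus M (F t)" unfolding X2_def using st PV by (intro E_in) auto
    have PiQ: "(\<lambda>w. P w + indicator A w * Q w) \<in> L2_plus M (F T)" using P iQ by (intro L2_plus_add) auto
    have eqV: "(\<lambda>w. P w + V w) = (\<lambda>w. (P w + indicator A w * Q w) + Y' w)" by (auto simp: V_def)
    have X12: "AE w in M. X2 w = X1 w + indicator A w * (D w - y t w)"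
      using translation[OF t PiQ Y'] E_local_perturbation[OF t A P Q] unfolding X2_def eqV
      by eventually_elim (simp add: X1_def D_def Y'_def algebra_simps)
    have le12: "AE w in M. X1 w \<le> X2 w"
      using X12 by eventually_elim (auto simp: A_def indicator_def)
    have cT: "(\<lambda>_. c) \<in> L2_plus M (F 0)" using c by (intro L2_plus_const) simp
    \<comment> \<open>Seen from time \<open>0\<close> the order is reversed: \<open>E 0 t X2\<close>
      is \<open>E 0 T (P + V)\<close>, at most \<open>E 0 T P + c\<close>, and this is
      \<open>E 0 t X1\<close>.\<close>
    have "AE w in M. E 0 t X2 w = E 0 T (\<lambda>w. P w + V w) w"
      unfolding X2_def using st PV by (intro E_tower) auto
    moreover have "AE w in M. E 0 T X1 w = E 0 t X1 w" using st X1 by (intro E_restrict) auto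
    moreover have "AE w in M. E 0 T X1 w = E 0 T (E t T P) w + c"
      unfolding X1_def[abs_def] using st EP cT T_pos
      by (intro translation L2_plus_filtration_mono[OF EP]) auto
    moreover have "AE w in M. E 0 T (E t T P) w = E 0 t (E t T P) w" using st EP by (intro E_restrict) auto
    moreover have "AE w in M. E 0 t (E t T P) w = E 0 T P w" using st P by (intro E_tower) auto
    moreover have "AE w in M. E 0 t X1 w \<le> E 0 t X2 w" using st X1 X2 le12 by (intro E_mono) auto
    ultimately have eq12: "AE w in M. E 0 t X2 w = E 0 t X1 w"
      using c'(2) by eventually_elim (use \<open>c' \<le> c\<close> in linarith)
    \<comment> \<open>The positivity demanded by strict monotonicity is inherited from the constant
      \<open>c\<close> below \<open>X1\<close>.\<close>
    have pos: "AE w in M. 0 < E s t X1 w" if "s \<in> {0..t}" for s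
    proof -
      have "AE w in M. c \<le> X1 w" using L2_plusD(2)[OF EP] by eventually_elim (simp add: X1_def)
      hence "AE w in M. c \<le> E s t X1 w" using that st X1 c by (intro E_ge_const) auto
      thus ?thesis by eventually_elim (use c in linarith)
    qed
    from E_strict_mono[OF order_refl st(1,2) X1 X2 pos le12 eq12]
    have "AE w in M. X2 w = X1 w" .
    with X12 show ?thesis
      by eventually_elim (auto simp: A_def indicator_def)
  qed
  hence "AE w in M. \<forall>N::nat. w \<notin> {w \<in> space M. y t w < D w \<and> \<bar>y t w\<bar> \<le> real N + 1}"
    by (simp only: AE_all_countable) simp
  thus ?thesis using AE_space
  proof eventually_elim
    case (elim w)
    obtain N where "\<bar>y t w\<bar> \<le> real N" using real_arch_simple by blast
    hence "\<not> y t w < D w" using elim(1)[rule_format, of N] elim(2) by auto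
    thus ?case by (simp add: D_def)
  qed
qed

section \<open>Lipschitz continuity in mean square\<close>

abbreviation lipschitz_const :: real where
  "lipschitz_const \<equiv> exp (\<mu>\<^sup>2 * T / 2)"

text \<open>The representation is tested with \<open>H = D\<close>: the square of the norm of
  \<open>D\<close> is at most the mean of \<open>D y t\<close>, a limit of means of
  \<open>\<Gamma> k D Q\<close>, each bounded by Cauchy--Schwarz. Division by the norm of
  \<open>D\<close> concludes.\<close>

lemma l2norm_le_of_le_bsde:
  assumes t: "t \<in> {0..T}" and Q: "Q \<in> L2 M M" and sol: "solves_bsde M F B T \<mu> Q y z"
    and D: "D \<in> L2 M (F t)" "AE w in M. 0 \<le> D w" "AE w in M. D w \<le> y t w"
  shows "l2norm M D \<le> lipschitz_const * l2norm M Q"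
proof -
  obtain \<Gamma> where \<Gamma>: "\<And>k::nat. girsanov_density \<mu> t (\<Gamma> k)"
    and lim: "\<And>H. H \<in> L2 M (F t) \<Longrightarrow> (\<lambda>k. \<integral>w. \<Gamma> k w * H w * Q w \<partial>M) \<longlonglongrightarrow> (\<integral>w. H w * y t w \<partial>M)"
    by (rule bsde_representation[OF sol Q t less_imp_le[OF mu_pos]], rule that)
  note facts = girsanov_density_facts[OF \<Gamma> t]
  have yL: "y t \<in> L2 M (F t)" by (rule bsde_solution_L2[OF sol Q t])
  have M: "D \<in> L2 M M" "y t \<in> L2 M M" using L2_ambient[OF D(1)] L2_ambient[OF yL] t by auto
  have "(l2norm M D)\<^sup>2 = (\<integral>w. D w * D w \<partial>M)" by (simp only: l2norm_square) (simp add: power2_eq_square)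
  also have "\<dots> \<le> (\<integral>w. D w * y t w \<partial>M)"
  proof (intro integral_mono_AE L2_integrable_mult M)
    show "AE w in M. D w * D w \<le> D w * y t w"
      using D(2,3) by eventually_elim (rule mult_left_mono)
  qed
  also have "\<dots> \<le> lipschitz_const * l2norm M D * l2norm M Q"
  proof (rule LIMSEQ_le_const2[OF lim[OF D(1)]])
    have "(\<integral>w. \<Gamma> k w * D w * Q w \<partial>M) \<le> lipschitz_const * l2norm M D * l2norm M Q" for k
    proof -
      have "(\<integral>w. \<Gamma> k w * D w * Q w \<partial>M) \<le> l2norm M (\<lambda>w. \<Gamma> k w * D w) * l2norm M Q"
        by (rule order_trans[OF abs_ge_self L2_Cauchy_Schwarz[OF facts(4)[OF D(1)] Q]])
      also have "\<dots> \<le> lipschitz_const * l2norm M D * l2norm M Q"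
        by (intro mult_right_mono facts(5) D) simp
      finally show ?thesis .
    qed
    thus "\<exists>N. \<forall>k\<ge>N. (\<integral>w. \<Gamma> k w * D w * Q w \<partial>M) \<le> lipschitz_const * l2norm M D * l2norm M Q" by blast
  qed
  finally have *: "l2norm M D * l2norm M D \<le> (lipschitz_const * l2norm M Q) * l2norm M D"
    by (simp add: power2_eq_square mult_ac)
  show ?thesis
  proof (cases "l2norm M D = 0")
    case False
    hence "0 < l2norm M D" using l2norm_nonneg[of M D] by linarith
    thus ?thesis using * by (rule mult_right_le_imp_le[rotated])
  qed simp
qed

text \<open>Since \<open>P \<le> P' + |P - P'|\<close> and conversely, domination with
  \<open>Q = |P - P'|\<close> bounds the difference of the values by the same \<open>y t\<close> in
  both directions.\<close>

lemma E_lipschitz: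
  assumes t: "t \<in> {0..T}" and P: "P \<in> L2_plus M (F T)" and P': "P' \<in> L2_plus M (F T)"
  shows "l2dist M (E t T P) (E t T P') \<le> lipschitz_const * l2dist M P P'"
proof -
  define Q where "Q w = \<bar>P w - P' w\<bar>" for w
  have st: "0 \<le> t" "t \<le> T" "T \<le> T" using t by auto
  have Q: "Q \<in> L2_plus M (F T)"
  proof (rule L2_plusI)
    show "Q \<in> L2 M (F T)"
      unfolding Q_def[abs_def] using P P' by (intro L2_abs L2_diff L2_plusD) auto
  qed (simp add: Q_def)
  obtain c y z where sol: "solves_bsde M F B T \<mu> Q y z" "AE w in M. y 0 w = c" "has_g_expectation M F B T \<mu> Q c"
    by (rule g_expectation_exists[OF Q])
  have le: "AE w in M. E t T R w \<le> E t T S w + y t w"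
    if R: "R \<in> L2_plus M (F T)" and S: "S \<in> L2_plus M (F T)" and RS: "\<And>w. R w \<le> S w + Q w" for R S
  proof -
    have "AE w in M. E t T R w \<le> E t T (\<lambda>w. S w + Q w) w"
      using RS by (intro E_mono st R L2_plus_add S Q) auto
    thus ?thesis using conditional_domination[OF t S Q sol(1)] by eventually_elim simp
  qed
  let ?D = "\<lambda>w. \<bar>E t T P w - E t T P' w\<bar>"
  have "l2norm M ?D \<le> lipschitz_const * l2norm M Q"
  proof (rule l2norm_le_of_le_bsde[OF t _ sol(1)])
    show "Q \<in> L2 M M" using L2_plusD(1)[OF Q] by (rule L2_ambient) simp
    show "?D \<in> L2 M (F t)"
      using st P P' by (intro L2_abs L2_diff L2_plusD E_in) auto
    show "AE w in M. ?D w \<le> y t w"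
    proof -
      have "AE w in M. E t T P w \<le> E t T P' w + y t w" by (rule le[OF P P']) (simp add: Q_def)
      moreover have "AE w in M. E t T P' w \<le> E t T P w + y t w" by (rule le[OF P' P]) (simp add: Q_def)
      ultimately show ?thesis by eventually_elim (simp add: abs_le_iff)
    qed
  qed simp
  thus ?thesis by (simp add: l2norm_abs Q_def[abs_def])
qed

end

section \<open>The extension to square-integrable variables\<close>

context floor_operator
begin

text \<open>Values below \<open>- real n\<close> become \<open>0\<close> rather than
  \<open>- real n\<close>, so \<open>cut n X\<close> decreases in \<open>n\<close>.\<close>

definition cut :: "nat \<Rightarrow> ('a \<Rightarrow> real) \<Rightarrow> 'a \<Rightarrow> real" where
  "cut n X w = X w * indicator {w. X w \<ge> - real n} w"

definition approx :: "real \<Rightarrow> nat \<Rightarrow> ('a \<Rightarrow> real) \<Rightarrow> 'a \<Rightarrow> real" where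
  "approx t n X w = E t T (\<lambda>w'. cut n X w' + real n) w - real n"

abbreviation Ec :: "real \<Rightarrow> ('a \<Rightarrow> real) \<Rightarrow> 'a \<Rightarrow> real" where
  "Ec \<equiv> ext_cond M F T E"

section \<open>Existence of the limit and continuity of the extension\<close>

lemma L2_lower_bounded:
  assumes "X \<in> L2 M (F T)" "AE w in M. - m \<le> X w"
  shows "(\<lambda>w. X w + m) \<in> L2_plus M (F T)"
proof (rule L2_plusI)
  show "(\<lambda>w. X w + m) \<in> L2 M (F T)" using assms(1) by (intro L2_add) auto
  show "AE w in M. 0 \<le> X w + m" using assms(2) by eventually_elim simp
qed

lemma cut_L2: "X \<in> L2 M (F T) \<Longrightarrow> cut n X \<in> L2 M (F T)"
proof (rule L2_bound)
  assume X: "X \<in> L2 M (F T)"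
  have [measurable]: "X \<in> borel_measurable (F T)" using L2_D(1)[OF _ X] by simp
  have "(\<lambda>w. if X w \<ge> - real n then X w else 0) \<in> borel_measurable (F T)" by measurable
  thus "cut n X \<in> borel_measurable (F T)"
    by (rule measurable_cong[THEN iffD1, rotated]) (simp add: cut_def)
qed (auto simp: cut_def indicator_def)

lemma cut_lower: "- real n \<le> cut n X w"
  by (simp add: cut_def indicator_def)

lemma cut_plus: "X \<in> L2 M (F T) \<Longrightarrow> (\<lambda>w. cut n X w + real n) \<in> L2_plus M (F T)"
  by (intro L2_lower_bounded cut_L2 AE_I2 cut_lower)

lemma shifted_L2:
  assumes t: "t \<in> {0..T}" and P: "P \<in> L2_plus M (F T)"
  shows "(\<lambda>w. E t T P w - c) \<in> L2 M (F t)"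
  using t P by (intro L2_diff L2_const L2_plusD E_in) auto

lemma approx_L2: "t \<in> {0..T} \<Longrightarrow> X \<in> L2 M (F T) \<Longrightarrow> approx t n X \<in> L2 M (F t)"
  unfolding approx_def[abs_def] by (intro shifted_L2 cut_plus)

text \<open>By (b) the value does not depend on which constant lifts the variable above the
  floor.\<close>

lemma E_shift:
  assumes t: "t \<in> {0..T}" and X: "X \<in> L2 M (F T)" "AE w in M. - m \<le> X w" and m: "m \<le> m'"
  shows "AE w in M. E t T (\<lambda>w. X w + m') w - m' = E t T (\<lambda>w. X w + m) w - m"
proof -
  have "(\<lambda>_. m' - m) \<in> L2_plus M (F t)" using m by (intro L2_plus_const) simp
  from translation[OF t L2_lower_bounded[OF X] this] show ?thesis by (simp add: algebra_simps)
qed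

lemma approx_decreasing:
  assumes t: "t \<in> {0..T}" and X: "X \<in> L2 M (F T)"
  shows "AE w in M. approx t (Suc n) X w \<le> approx t n X w"
proof -
  have c: "(\<lambda>w. cut n X w + real (Suc n)) \<in> L2_plus M (F T)"
    using order_trans[OF _ cut_lower[of n X], of "- real (Suc n)"] by (intro L2_lower_bounded cut_L2 X AE_I2) simp
  have "AE w in M. E t T (\<lambda>w. cut (Suc n) X w + real (Suc n)) w \<le> E t T (\<lambda>w. cut n X w + real (Suc n)) w"
    using t by (intro E_mono c cut_plus X) (auto simp: cut_def indicator_def)
  moreover have "AE w in M. E t T (\<lambda>w. cut n X w + real (Suc n)) w - real (Suc n)
      = E t T (\<lambda>w. cut n X w + real n) w - real n"
    by (intro E_shift t cut_L2 X AE_I2 cut_lower) simp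
  ultimately show ?thesis by eventually_elim (simp add: approx_def)
qed

text \<open>A bound uniform in \<open>n\<close>: \<open>cut 0 X \<le> cut n X + |X|\<close>, and
  domination replaces the summand \<open>|X|\<close> by the solution with that terminal
  value.\<close>

lemma approx_lower_bound:
  assumes t: "t \<in> {0..T}" and X: "X \<in> L2 M (F T)"
  obtains g where "g \<in> L2 M (F t)" "\<And>n. AE w in M. approx t 0 X w - g w \<le> approx t n X w"
proof -
  have Q: "(\<lambda>w. \<bar>X w\<bar>) \<in> L2_plus M (F T)" by (rule L2_plusI) (auto intro: L2_abs X)
  obtain c y z where sol: "solves_bsde M F B T \<mu> (\<lambda>w. \<bar>X w\<bar>) y z" "AE w in M. y 0 w = c"
    "has_g_expectation M F B T \<mu> (\<lambda>w. \<bar>X w\<bar>) c"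
    by (rule g_expectation_exists[OF Q])
  show thesis
  proof (rule that)
    show "y t \<in> L2 M (F t)"
      by (rule bsde_solution_L2[OF sol(1) _ t]) (use L2_ambient[OF L2_plusD(1)[OF Q]] in simp)
    fix n
    have c0: "(\<lambda>w. cut 0 X w + real n) \<in> L2_plus M (F T)"
      using order_trans[OF _ cut_lower[of 0 X], of "- real n"] by (intro L2_lower_bounded cut_L2 X AE_I2) simp
    have "AE w in M. E t T (\<lambda>w. cut 0 X w + real n) w \<le> E t T (\<lambda>w. (cut n X w + real n) + \<bar>X w\<bar>) w"
    proof (rule E_mono)
      show "(\<lambda>w. cut n X w + real n + \<bar>X w\<bar>) \<in> L2_plus M (F T)" by (intro L2_plus_add cut_plus X Q) simp
      show "AE w in M. cut 0 X w + real n \<le> cut n X w + real n + \<bar>X w\<bar>"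
        by (auto simp: cut_def indicator_def)
    qed (use t c0 in auto)
    moreover have "AE w in M. E t T (\<lambda>w. (cut n X w + real n) + \<bar>X w\<bar>) w
        \<le> E t T (\<lambda>w. cut n X w + real n) w + y t w"
      by (rule conditional_domination[OF t cut_plus[OF X] Q sol(1)])
    moreover have "AE w in M. E t T (\<lambda>w. cut 0 X w + real n) w - real n = E t T (\<lambda>w. cut 0 X w + real 0) w - real 0"
      by (intro E_shift t cut_L2 X AE_I2 cut_lower) simp
    ultimately show "AE w in M. approx t 0 X w - y t w \<le> approx t n X w"
      by eventually_elim (simp add: approx_def)
  qed
qed

text \<open>The approximations decrease and are bounded below in \<open>L2\<close>, so they converge
  almost surely and, by domination, in mean square.\<close>

lemma ext_cond_limit_exists:
  assumes t: "t \<in> {0..T}" and X: "X \<in> L2 M (F T)"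
  shows "\<exists>\<eta>. is_L2_limit M (F t) (\<lambda>n. approx t n X) \<eta>"
proof -
  obtain g where g: "g \<in> L2 M (F t)" and lower: "\<And>n. AE w in M. approx t 0 X w - g w \<le> approx t n X w"
    by (rule approx_lower_bound[OF t X], rule that)
  have sub: "subalgebra M (F t)" using t by simp
  note UL = approx_L2[OF t X]
  note [measurable] = L2_D(1)[OF sub UL]
  \<comment> \<open>Taking \<open>lim\<close> at every point gives measurability with respect to
    \<open>F t\<close> itself, although convergence is known only almost surely.\<close>
  define \<eta> where "\<eta> w = lim (\<lambda>n. approx t n X w)" for w
  have \<eta>m: "\<eta> \<in> borel_measurable (F t)" unfolding \<eta>_def[abs_def] by measurable
  have "AE w in M. \<forall>n. approx t (Suc n) X w \<le> approx t n X w" "AE w in M. \<forall>n. approx t 0 X w - g w \<le> approx t n X w"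
    unfolding AE_all_countable using approx_decreasing[OF t X] lower by auto
  hence main: "AE w in M. (\<lambda>n. approx t n X w) \<longlonglongrightarrow> \<eta> w \<and>
      (\<forall>n. \<bar>approx t n X w - \<eta> w\<bar> \<le> \<bar>g w\<bar>)"
  proof eventually_elim
    case (elim w)
    let ?u = "\<lambda>n. approx t n X w"
    have dec: "decseq ?u" using elim(1) by (intro decseq_SucI) auto
    then obtain l where l: "?u \<longlonglongrightarrow> l" "\<And>n. l \<le> ?u n"
      using elim(2) decseq_convergent[of ?u] by metis
    have \<eta>: "l = \<eta> w" unfolding \<eta>_def using l(1) by (rule limI[symmetric])
    have "?u 0 - g w \<le> l" using l(1) elim(2) by (intro LIMSEQ_le_const) auto
    moreover have "?u n \<le> ?u 0" for n using dec by (auto simp: decseq_def)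
    \<comment> \<open>Both \<open>?u n\<close> and \<open>l\<close> lie between
      \<open>?u 0 - g w\<close> and \<open>?u 0\<close>.\<close>
    ultimately have "\<bar>?u n - l\<bar> \<le> \<bar>g w\<bar>" for n
      using l(2)[of n] by (smt (verit))
    thus ?case using l(1) unfolding \<eta> by blast
  qed
  have lim: "(\<lambda>n. l2dist M (approx t n X) \<eta>) \<longlonglongrightarrow> 0"
  proof (rule l2_limit_dominated)
    show "g \<in> L2 M M" using L2_D(4)[OF sub g] .
    show "approx t n X \<in> borel_measurable M" for n using L2_D(2)[OF sub UL] .
    show "\<eta> \<in> borel_measurable M" using measurable_augmented_imp[OF \<eta>m] t by simp
    show "AE w in M. (\<lambda>n. approx t n X w) \<longlonglongrightarrow> \<eta> w" "AE w in M. \<bar>approx t n X w - \<eta> w\<bar> \<le> \<bar>g w\<bar>" for n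
      using main by (eventually_elim, blast)+
  qed
  have "(\<lambda>w. approx t 0 X w - \<eta> w) \<in> L2 M (F t)"
  proof (rule L2_bound[OF sub _ sub g])
    show "(\<lambda>w. approx t 0 X w - \<eta> w) \<in> borel_measurable (F t)" using \<eta>m by measurable
    show "AE w in M. \<bar>approx t 0 X w - \<eta> w\<bar> \<le> \<bar>g w\<bar>" using main by eventually_elim blast
  qed
  from L2_diff[OF sub UL[of 0] this] have "\<eta> \<in> L2 M (F t)" by simp
  thus ?thesis
    using UL lim unfolding is_L2_limit_def l2norm_tendsto_iff by blast
qed

lemma ext_cond_limit:
  assumes t: "t \<in> {0..T}" and X: "X \<in> L2 M (F T)"
  shows "Ec t X \<in> L2 M (F t)" "(\<lambda>n. l2dist M (approx t n X) (Ec t X)) \<longlonglongrightarrow> 0"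
proof -
  have "Ec t X = (SOME \<eta>. is_L2_limit M (F t) (\<lambda>n. approx t n X) \<eta>)"
    by (simp add: ext_cond_def approx_def[abs_def] cut_def)
  hence "is_L2_limit M (F t) (\<lambda>n. approx t n X) (Ec t X)"
    using someI_ex[OF ext_cond_limit_exists[OF assms]] by simp
  thus "Ec t X \<in> L2 M (F t)" "(\<lambda>n. l2dist M (approx t n X) (Ec t X)) \<longlonglongrightarrow> 0"
    by (auto simp: is_L2_limit_def l2norm_tendsto_iff)
qed

lemma Ec_L2_terminal:
  assumes "t \<in> {0..T}" "X \<in> L2 M (F T)"
  shows "Ec t X \<in> L2 M (F T)" "Ec t X \<in> L2 M M"
  using L2_filtration_mono[OF ext_cond_limit(1)[OF assms], of T] L2_ambient[OF ext_cond_limit(1)[OF assms]] assms(1)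
  by auto

lemma cut_limit:
  assumes X: "X \<in> L2 M (F T)"
  shows "(\<lambda>n. l2dist M (cut n X) X) \<longlonglongrightarrow> 0"
proof (rule l2_limit_truncation)
  show "X \<in> L2 M M" "cut n X \<in> borel_measurable M" for n
    using L2_D(4)[OF _ X] L2_D(2)[OF _ cut_L2[OF X]] by auto
qed (auto simp: cut_def indicator_def)

text \<open>Once \<open>n\<close> exceeds \<open>m\<close>, cutting changes nothing almost surely
  and the shift is immaterial, so the approximations are stationary. On variables bounded below the
  extension is thus the original operator up to a shift, and its algebraic properties are checked
  there.\<close>

lemma Ec_lower_bounded:
  assumes t: "t \<in> {0..T}" and X: "X \<in> L2 M (F T)" "AE w in M. - m \<le> X w"
  shows "AE w in M. Ec t X w = E t T (\<lambda>w. X w + m) w - m"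
proof -
  obtain N where N: "m \<le> real N" using real_arch_simple by blast
  have eq: "AE w in M. approx t (n + N) X w = E t T (\<lambda>w. X w + m) w - m" for n
  proof -
    have m: "m \<le> real (n + N)" using N by simp
    have X': "AE w in M. - real (n + N) \<le> X w" using X(2) m by (auto elim!: eventually_mono)
    have "AE w in M. E t T (\<lambda>w. cut (n + N) X w + real (n + N)) w = E t T (\<lambda>w. X w + real (n + N)) w"
    proof (rule E_cong)
      show "AE w in M. cut (n + N) X w + real (n + N) = X w + real (n + N)"
        using X' by eventually_elim (simp add: cut_def indicator_def)
    qed (use t in \<open>simp_all only: cut_plus[OF X(1)] L2_lower_bounded[OF X(1) X'] atLeastAtMost_iff order_refl\<close>)
    with E_shift[OF t X m] show ?thesis by eventually_elim (simp add: approx_def)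
  qed
  have L: "(\<lambda>w. E t T (\<lambda>w. X w + m) w - m) \<in> L2 M M"
    using shifted_L2[OF t L2_lower_bounded[OF X]] t by (intro L2_ambient) auto
  show ?thesis
  proof (rule l2_limit_eq[OF _ L Ec_L2_terminal(2)[OF t X(1)] L eq])
    show "approx t (n + N) X \<in> L2 M M" for n using approx_L2[OF t X(1)] t by (intro L2_ambient) auto
    show "(\<lambda>n. l2norm M (\<lambda>w. approx t (n + N) X w - Ec t X w)) \<longlonglongrightarrow> 0"
      using ext_cond_limit(2)[OF t X(1)] by (rule LIMSEQ_ignore_initial_segment)
  qed (simp add: l2norm_def)
qed

text \<open>The Lipschitz constant of \<open>E t T\<close> does not depend on the truncation, so it
  passes to the limit. This continuity is what makes a dense class of arguments sufficient
  below.\<close>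

lemma Ec_lipschitz:
  assumes t: "t \<in> {0..T}" and X: "X \<in> L2 M (F T)" and Y: "Y \<in> L2 M (F T)"
  shows "l2dist M (Ec t X) (Ec t Y) \<le> lipschitz_const * l2dist M X Y"
proof -
  have LM: "X \<in> L2 M M" "Y \<in> L2 M M" "\<And>n. cut n X \<in> L2 M M" "\<And>n. cut n Y \<in> L2 M M"
    using X Y cut_L2[OF X] cut_L2[OF Y] by (auto intro: L2_ambient)
  have EM: "Ec t X \<in> L2 M M" "Ec t Y \<in> L2 M M" "\<And>n. approx t n X \<in> L2 M M" "\<And>n. approx t n Y \<in> L2 M M"
    using Ec_L2_terminal(2)[OF t] X Y approx_L2[OF t] t by (auto intro: L2_ambient)
  let ?e = "\<lambda>n. l2dist M (approx t n X) (Ec t X) + (lipschitz_const * (l2dist M (cut n X) X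
      + (l2dist M X Y + l2dist M (cut n Y) Y)) + l2dist M (approx t n Y) (Ec t Y))"
  have "l2dist M (Ec t X) (Ec t Y) \<le> ?e n" for n
  proof -
    have "l2dist M (approx t n X) (approx t n Y) \<le> lipschitz_const * l2dist M (cut n X) (cut n Y)"
      using E_lipschitz[OF t cut_plus[OF X] cut_plus[OF Y], of n n] by (simp add: approx_def)
    also have "\<dots> \<le> lipschitz_const * (l2dist M (cut n X) X
        + (l2dist M X Y + l2dist M Y (cut n Y)))"
    proof (rule mult_left_mono)
      have "l2dist M (cut n X) (cut n Y) \<le> l2dist M (cut n X) X + l2dist M X (cut n Y)"
        by (rule l2norm_diff_triangle[OF LM(3,1,4)])
      also have "l2dist M X (cut n Y) \<le> l2dist M X Y + l2dist M Y (cut n Y)"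
        by (rule l2norm_diff_triangle[OF LM(1,2,4)])
      finally show "l2dist M (cut n X) (cut n Y) \<le> l2dist M (cut n X) X
        + (l2dist M X Y + l2dist M Y (cut n Y))" by simp
    qed simp
    finally have "l2dist M (approx t n X) (approx t n Y) \<le> lipschitz_const * (l2dist M (cut n X) X
        + (l2dist M X Y + l2dist M (cut n Y) Y))"
      by (simp add: l2norm_diff_commute[of M Y])
    moreover have "l2dist M (Ec t X) (Ec t Y)
        \<le> l2dist M (Ec t X) (approx t n X) + l2dist M (approx t n X) (Ec t Y)"
      by (rule l2norm_diff_triangle[OF EM(1,3,2)])
    moreover have "l2dist M (approx t n X) (Ec t Y)
        \<le> l2dist M (approx t n X) (approx t n Y) + l2dist M (approx t n Y) (Ec t Y)"
      by (rule l2norm_diff_triangle[OF EM(3,4,2)])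
    ultimately show ?thesis by (simp add: l2norm_diff_commute[of M "Ec t X"])
  qed
  moreover have "?e \<longlonglongrightarrow> 0 + (lipschitz_const * (0 + (l2dist M X Y + 0)) + 0)"
    by (intro tendsto_intros ext_cond_limit(2) cut_limit t X Y)
  ultimately show ?thesis by (intro LIMSEQ_le_const[of ?e]) auto
qed

lemma Ec_continuous:
  assumes t: "t \<in> {0..T}" and X: "X \<in> L2 M (F T)" and U: "\<And>n. U n \<in> L2 M (F T)"
    and lim: "(\<lambda>n. l2dist M (U n) X) \<longlonglongrightarrow> 0"
  shows "(\<lambda>n. l2dist M (Ec t (U n)) (Ec t X)) \<longlonglongrightarrow> 0"
proof (rule Lim_null_comparison)
  show "\<forall>\<^sub>F n in sequentially. norm (l2dist M (Ec t (U n)) (Ec t X))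
      \<le> lipschitz_const * l2dist M (U n) X"
    using Ec_lipschitz[OF t U X] by (intro always_eventually) simp
  show "(\<lambda>n. lipschitz_const * l2dist M (U n) X) \<longlonglongrightarrow> 0"
    using tendsto_mult_left[OF lim] by simp
qed

end

section \<open>Properties of the extension\<close>

context floor_operator
begin

text \<open>Unlike \<open>cut\<close>, this truncation is monotone in \<open>X\<close>, which the
  comparison of values needs.\<close>

abbreviation lower :: "('a \<Rightarrow> real) \<Rightarrow> nat \<Rightarrow> 'a \<Rightarrow> real" where
  "lower X n \<equiv> \<lambda>w. max (X w) (- real n)"

lemma lower_L2:
  assumes "t \<in> {0..T}" "X \<in> L2 M (F t)"
  shows "lower X n \<in> L2 M (F t)"
proof -
  have sub: "subalgebra M (F t)" using assms by simp
  have [measurable]: "X \<in> borel_measurable (F t)" using L2_D(1)[OF sub assms(2)] .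
  have g: "(\<lambda>w. \<bar>X w\<bar> + real n) \<in> L2 M (F t)" by (intro L2_add L2_abs sub assms L2_const)
  show ?thesis
  proof (rule L2_bound[OF sub _ sub g])
    show "lower X n \<in> borel_measurable (F t)" by measurable
    show "AE w in M. \<bar>lower X n w\<bar> \<le> \<bar>\<bar>X w\<bar> + real n\<bar>" by (intro AE_I2) (simp add: max_def abs_if)
  qed
qed

lemma lower_limit:
  assumes "t \<in> {0..T}" "X \<in> L2 M (F t)"
  shows "(\<lambda>n. l2dist M (lower X n) X) \<longlonglongrightarrow> 0"
  using assms(1) L2_D(4)[OF _ assms(2)] L2_D(2)[OF _ lower_L2[OF assms]]
  by (intro l2_limit_truncation) (auto simp: max_def)

lemma Ec_lower_limit:
  assumes "t \<in> {0..T}" "X \<in> L2 M (F T)"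
  shows "(\<lambda>n. l2dist M (Ec t (lower X n)) (Ec t X)) \<longlonglongrightarrow> 0"
  using assms by (intro Ec_continuous lower_L2 lower_limit[of T]) auto

lemma Ec_lower:
  assumes t: "t \<in> {0..T}" and X: "X \<in> L2 M (F T)"
  shows "AE w in M. Ec t (lower X n) w = E t T (\<lambda>w. lower X n w + real n) w - real n"
  using X by (intro Ec_lower_bounded t lower_L2 AE_I2) auto

lemma Ec_mono:
  assumes t: "t \<in> {0..T}" and X: "X \<in> L2 M (F T)" and Y: "Y \<in> L2 M (F T)" and le: "AE w in M. X w \<le> Y w"
  shows "AE w in M. Ec t X w \<le> Ec t Y w"
proof (rule l2_limit_mono[OF _ _ _ _ _ Ec_lower_limit[OF t X] Ec_lower_limit[OF t Y]])
  fix n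
  have P: "(\<lambda>w. lower Z n w + real n) \<in> L2_plus M (F T)" if "Z \<in> L2 M (F T)" for Z
    using that by (intro L2_lower_bounded lower_L2 AE_I2) auto
  have "AE w in M. E t T (\<lambda>w. lower X n w + real n) w \<le> E t T (\<lambda>w. lower Y n w + real n) w"
  proof (rule E_mono[OF _ _ _ P[OF Y] P[OF X]])
    show "AE w in M. lower X n w + real n \<le> lower Y n w + real n" using le by eventually_elim auto
  qed (use t in auto)
  with Ec_lower[OF t X, of n] Ec_lower[OF t Y, of n] show "AE w in M. Ec t (lower X n) w \<le> Ec t (lower Y n) w"
    by eventually_elim simp
qed (intro Ec_L2_terminal t X Y lower_L2 terminal)+

lemma Ec_cong:
  assumes "t \<in> {0..T}" "X \<in> L2 M (F T)" "Y \<in> L2 M (F T)" "AE w in M. X w = Y w"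
  shows "AE w in M. Ec t X w = Ec t Y w"
proof -
  have "AE w in M. X w \<le> Y w" "AE w in M. Y w \<le> X w" using assms(4) by (eventually_elim, simp)+
  from Ec_mono[OF assms(1-3) this(1)] Ec_mono[OF assms(1,3,2) this(2)]
  show ?thesis by eventually_elim simp
qed

lemma Ec_translation:
  assumes t: "t \<in> {0..T}" and X: "X \<in> L2 M (F T)" and Y: "Y \<in> L2 M (F t)"
  shows "AE w in M. Ec t (\<lambda>w. X w + Y w) w = Ec t X w + Y w"
proof -
  have YT: "Y \<in> L2 M (F T)" using L2_filtration_mono[OF Y] t by simp
  have lY: "lower Y n \<in> L2 M (F t)" for n by (rule lower_L2[OF t Y])
  have lX: "lower X n \<in> L2 M (F T)" for n using X by (intro lower_L2) auto
  have lYT: "lower Y n \<in> L2 M (F T)" for n using YT by (intro lower_L2) auto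
  have lXY: "(\<lambda>w. lower X n w + lower Y n w) \<in> L2 M (F T)" for n using lX lYT by (intro L2_add) auto
  have XY: "(\<lambda>w. X w + Y w) \<in> L2 M (F T)" using X YT by (intro L2_add) auto
  note amb = L2_ambient[OF _ order_refl]
  have ambt: "Z \<in> L2 M (F t) \<Longrightarrow> Z \<in> L2 M M" for Z using L2_ambient t by simp
  show ?thesis
  proof (rule l2_limit_eq)
    show "(\<lambda>n. l2norm M (\<lambda>w. Ec t (\<lambda>w. lower X n w + lower Y n w) w - Ec t (\<lambda>w. X w + Y w) w)) \<longlonglongrightarrow> 0"
      by (intro Ec_continuous t XY lXY l2norm_sum_limit amb[OF lX] amb[OF lYT] amb[OF X] amb[OF YT]
          lower_limit[OF terminal(1)] X YT)
    show "(\<lambda>n. l2norm M (\<lambda>w. (Ec t (lower X n) w + lower Y n w) - (Ec t X w + Y w))) \<longlonglongrightarrow> 0"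
      by (intro l2norm_sum_limit Ec_lower_limit t X lower_limit[OF t Y] Ec_L2_terminal(2) lX ambt[OF lY] ambt[OF Y])
    fix n
    have P: "(\<lambda>w. lower X n w + real n) \<in> L2_plus M (F T)" using lX by (intro L2_lower_bounded AE_I2) auto
    have Q: "(\<lambda>w. lower Y n w + real n) \<in> L2_plus M (F t)"
      using lY t by (intro L2_plusI L2_add AE_I2) auto
    \<comment> \<open>The sum of the truncations is at least \<open>- 2 n\<close>; the shift
      \<open>2 n\<close> is shared equally, which makes both summands nonnegative and the second
      known at time \<open>t\<close>.\<close>
    have "AE w in M. Ec t (\<lambda>w. lower X n w + lower Y n w) w
        = E t T (\<lambda>w. lower X n w + lower Y n w + 2 * real n) w - 2 * real n"
      by (intro Ec_lower_bounded t lXY AE_I2) (simp add: max_def)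
    moreover have "(\<lambda>w. lower X n w + lower Y n w + 2 * real n) = (\<lambda>w. (lower X n w + real n) + (lower Y n w + real n))"
      by auto
    ultimately show "AE w in M. Ec t (\<lambda>w. lower X n w + lower Y n w) w = Ec t (lower X n) w + lower Y n w"
      using translation[OF t P Q] Ec_lower[OF t X, of n] by (auto elim!: eventually_elim2 AE_mp)
  qed (intro Ec_L2_terminal(2) t X XY lXY lX ambt[OF Y] ambt[OF lY] L2_add subalgebra_refl)+
qed

lemma Ec_zero: "t \<in> {0..T} \<Longrightarrow> AE w in M. Ec t (\<lambda>_. 0) w = 0"
proof -
  assume t: "t \<in> {0..T}"
  have "AE w in M. Ec t (\<lambda>_. 0) w = E t T (\<lambda>w. 0 + 0) w - 0"
    using Ec_lower_bounded[OF t L2_const, of 0 0] by simp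
  moreover have "AE w in M. E t T (\<lambda>w. 0 + 0) w = 0 + 0"
    using E_id[of t T "\<lambda>_. 0"] L2_plus_const[OF order_refl, of "F t"] t by simp
  ultimately show ?thesis by eventually_elim simp
qed

lemma Ec_id:
  assumes "t \<in> {0..T}" "Y \<in> L2 M (F t)"
  shows "AE w in M. Ec t Y w = Y w"
proof -
  have "AE w in M. Ec t Y w = Ec t (\<lambda>_. 0) w + Y w"
    using Ec_translation[OF assms(1) L2_const[of 0] assms(2)] by simp
  with Ec_zero[OF assms(1)] show ?thesis by eventually_elim simp
qed

lemma Ec_tower:
  assumes st: "0 \<le> s" "s \<le> t" "t \<le> T" and X: "X \<in> L2 M (F T)"
  shows "AE w in M. Ec s (Ec t X) w = Ec s X w"
proof -
  have s: "s \<in> {0..T}" and t: "t \<in> {0..T}" using st by auto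
  have lX: "lower X n \<in> L2 M (F T)" for n using X by (intro lower_L2) auto
  show ?thesis
  proof (rule l2_limit_eq)
    show "(\<lambda>n. l2dist M (Ec s (Ec t (lower X n))) (Ec s (Ec t X))) \<longlonglongrightarrow> 0"
      by (intro Ec_continuous[OF s] Ec_L2_terminal(1) Ec_lower_limit s t X lX)
    show "(\<lambda>n. l2dist M (Ec s (lower X n)) (Ec s X)) \<longlonglongrightarrow> 0" by (rule Ec_lower_limit[OF s X])
    fix n
    let ?P = "\<lambda>w. lower X n w + real n"
    have P: "?P \<in> L2_plus M (F T)" using lX by (intro L2_lower_bounded AE_I2) auto
    have EP: "E t T ?P \<in> L2_plus M (F t)" using st P by (intro E_in) auto
    \<comment> \<open>\<open>W\<close> is bounded below by \<open>- real n\<close> because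
      \<open>E t T ?P\<close> is nonnegative, so the same shift \<open>n\<close> serves for the
      outer operator.\<close>
    define W where "W w = E t T ?P w - real n" for w
    have W: "W \<in> L2 M (F T)"
      unfolding W_def[abs_def] using L2_filtration_mono[OF shifted_L2[OF t P]] st by auto
    have "AE w in M. Ec s (Ec t (lower X n)) w = Ec s W w"
      by (rule Ec_cong[OF s Ec_L2_terminal(1)[OF t lX] W Ec_lower[OF t X, of n, folded W_def]])
    moreover have "AE w in M. Ec s W w = E s T (E t T ?P) w - real n"
    proof -
      have "AE w in M. - real n \<le> W w" using L2_plusD(2)[OF EP] by eventually_elim (simp add: W_def)
      moreover have "(\<lambda>w. W w + real n) = E t T ?P" by (simp add: W_def)
      ultimately show ?thesis using Ec_lower_bounded[OF s W, of "real n"] by simp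
    qed
    moreover have "AE w in M. E s T (E t T ?P) w = E s t (E t T ?P) w"
      by (intro E_restrict st EP)
    moreover have "AE w in M. E s t (E t T ?P) w = E s T ?P w"
      by (intro E_tower st P order_refl)
    moreover note Ec_lower[OF s X, of n]
    ultimately show "AE w in M. Ec s (Ec t (lower X n)) w = Ec s (lower X n) w"
      by eventually_elim simp
  qed (intro Ec_L2_terminal s t X lX)+
qed

lemma Ec_indicator:
  assumes t: "t \<in> {0..T}" and A: "A \<in> sets (F t)" and X: "X \<in> L2 M (F T)"
  shows "AE w in M. Ec t (\<lambda>w. indicator A w * X w) w = indicator A w * Ec t X w"
proof -
  have st: "0 \<le> t" "t \<le> T" "T \<le> T" using t by auto
  have AT: "A \<in> sets (F T)" "A \<in> events" using A st sets_augmented_mono[of t T] sets_augmented_subset[of t] by auto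
  have A': "space M - A \<in> sets (F t)" using sets.compl_sets[OF A] by simp
  have lX: "lower X n \<in> L2 M (F T)" for n using X by (intro lower_L2) auto
  have ind: "(\<lambda>w. indicator A w * Z w) \<in> L2 M (F T)" if "Z \<in> L2 M (F T)" for Z
    using that AT by (intro L2_indicator) auto
  have indM: "(\<lambda>w. indicator A w * Z w) \<in> L2 M M" if "Z \<in> L2 M M" for Z
    using that AT by (intro L2_indicator) auto
  have contr: "l2norm M (\<lambda>w. indicator A w * f w - indicator A w * g w) \<le> l2dist M f g"
    if "f \<in> L2 M M" "g \<in> L2 M M" for f g
    using that by (intro l2norm_mono_AE L2_diff indM subalgebra_refl AE_I2) (auto simp: indicator_def)
  have lim: "(\<lambda>n. l2norm M (\<lambda>w. indicator A w * U n w - indicator A w * f w)) \<longlonglongrightarrow> 0"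
    if "(\<lambda>n. l2dist M (U n) f) \<longlonglongrightarrow> 0" "\<And>n. U n \<in> L2 M M" "f \<in> L2 M M" for U f
    using contr[OF that(2,3)] by (intro Lim_null_comparison[OF _ that(1)] always_eventually) simp
  show ?thesis
  proof (rule l2_limit_eq)
    show "(\<lambda>n. l2norm M (\<lambda>w. Ec t (\<lambda>w. indicator A w * lower X n w) w - Ec t (\<lambda>w. indicator A w * X w) w)) \<longlonglongrightarrow> 0"
      by (intro Ec_continuous t ind lX X lim lower_limit[OF terminal(1)] L2_ambient[OF lX] L2_ambient[OF X] order_refl)
    show "(\<lambda>n. l2norm M (\<lambda>w. indicator A w * Ec t (lower X n) w - indicator A w * Ec t X w)) \<longlonglongrightarrow> 0"
      by (intro lim Ec_lower_limit t X Ec_L2_terminal(2) lX)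
    fix n
    let ?P = "\<lambda>w. lower X n w + real n"
    have P: "?P \<in> L2_plus M (F T)" using lX by (intro L2_lower_bounded AE_I2) auto
    \<comment> \<open>The shift \<open>n\<close> is needed on the whole space but (D4) localises to
      \<open>A\<close>; the part of the shift outside \<open>A\<close> is known at time
      \<open>t\<close> and is extracted by (b).\<close>
    have Q: "(\<lambda>w. indicator (space M - A) w * real n) \<in> L2_plus M (F t)"
      using st A' by (intro L2_plus_indicator L2_plus_const) auto
    have iP: "(\<lambda>w. indicator A w * ?P w) \<in> L2_plus M (F T)" using AT P by (intro L2_plus_indicator) auto
    have Q': "(\<lambda>w. indicator (space M - A) w * real n) \<in> L2_plus M (F T)"
      using L2_plus_filtration_mono[OF Q] st by simp
    have lb: "AE w in M. - real n \<le> indicator A w * lower X n w" by (intro AE_I2) (simp add: indicator_def)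
    have "AE w in M. Ec t (\<lambda>w. indicator A w * lower X n w) w
        = E t T (\<lambda>w. indicator A w * lower X n w + real n) w - real n"
      by (intro Ec_lower_bounded t ind lX lb)
    moreover have "AE w in M. E t T (\<lambda>w. indicator A w * lower X n w + real n) w
        = E t T (\<lambda>w. indicator A w * ?P w + indicator (space M - A) w * real n) w"
    proof (rule E_cong[OF st])
      show "AE w in M. indicator A w * lower X n w + real n
          = indicator A w * ?P w + indicator (space M - A) w * real n"
        by (intro AE_I2) (auto simp: indicator_def)
    qed (intro L2_lower_bounded ind lX lb L2_plus_add order_refl iP Q')+
    moreover note translation[OF t iP Q] E_indicator[OF st A P] Ec_lower[OF t X, of n] AE_space
    ultimately show "AE w in M. Ec t (\<lambda>w. indicator A w * lower X n w) w = indicator A w * Ec t (lower X n) w"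
      by eventually_elim (auto simp: indicator_def)
  qed (intro Ec_L2_terminal(2) t X ind lX indM)+
qed

section \<open>The extended expectation: domination and strict monotonicity\<close>

abbreviation Eh :: "('a \<Rightarrow> real) \<Rightarrow> real" where
  "Eh \<equiv> ext M F T E"

lemma Ec_0_eq:
  assumes "X \<in> L2 M (F T)"
  shows "AE w in M. Ec 0 X w = Eh X"
proof -
  have "AE w in M. Ec 0 X w = (\<integral>w. Ec 0 X w \<partial>M)"
    by (rule F_0_constant[OF ext_cond_limit(1)[OF terminal(2) assms]])
  moreover have "Eh X = (\<integral>w. Ec 0 X w \<partial>M)" unfolding ext_def by (rule ae_const_eqI) fact
  ultimately show ?thesis by simp
qed

lemma Eh_eqI:
  assumes "X \<in> L2 M (F T)" "AE w in M. Ec 0 X w = c"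
  shows "Eh X = c"
  using ae_const_eqI[OF assms(2)] by (simp add: ext_def)

lemma Eh_leI:
  assumes X: "X \<in> L2 M (F T)" and Y: "Y \<in> L2 M (F T)" and le: "AE w in M. Ec 0 X w \<le> Ec 0 Y w + c"
  shows "Eh X \<le> Eh Y + c"
proof -
  have "AE w in M. Eh X \<le> Eh Y + c" using Ec_0_eq[OF X] Ec_0_eq[OF Y] le by eventually_elim simp
  thus ?thesis by simp
qed

lemma Eh_mono:
  assumes "X \<in> L2 M (F T)" "Y \<in> L2 M (F T)" "AE w in M. X w \<le> Y w"
  shows "Eh X \<le> Eh Y"
  using Eh_leI[of X Y 0] Ec_mono[of 0 X Y] assms by simp

text \<open>The solution is fixed first and \<open>conditional_domination\<close> is used at time
  \<open>0\<close>, so that one and the same \<open>c\<close> serves all truncations; applying (a)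
  to each of them could yield a different number each time.\<close>

lemma Eh_dominated:
  assumes X: "X \<in> L2 M (F T)" and Y: "Y \<in> L2_plus M (F T)"
  shows "\<exists>c. has_g_expectation M F B T \<mu> Y c \<and> Eh (\<lambda>w. X w + Y w) - Eh X \<le> c"
proof -
  obtain c y z where sol: "solves_bsde M F B T \<mu> Y y z" "AE w in M. y 0 w = c" "has_g_expectation M F B T \<mu> Y c"
    by (rule g_expectation_exists[OF Y])
  note YL = L2_plusD(1)[OF Y]
  have XY: "(\<lambda>w. X w + Y w) \<in> L2 M (F T)" using X YL by (intro L2_add) auto
  have lX: "lower X n \<in> L2 M (F T)" for n using X by (intro lower_L2) auto
  have lXY: "(\<lambda>w. lower X n w + Y w) \<in> L2 M (F T)" for n using lX YL by (intro L2_add) auto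
  note amb = L2_ambient[OF _ order_refl]
  have "AE w in M. Ec 0 (\<lambda>w. X w + Y w) w \<le> Ec 0 X w + c"
  proof (rule l2_limit_mono)
    show "(\<lambda>n. l2norm M (\<lambda>w. Ec 0 (\<lambda>w. lower X n w + Y w) w - Ec 0 (\<lambda>w. X w + Y w) w)) \<longlonglongrightarrow> 0"
      using lower_limit[OF terminal(1) X] by (intro Ec_continuous XY lXY terminal) simp
    show "(\<lambda>n. l2norm M (\<lambda>w. (Ec 0 (lower X n) w + c) - (Ec 0 X w + c))) \<longlonglongrightarrow> 0"
      using Ec_lower_limit[OF terminal(2) X] by simp
    fix n
    have P: "(\<lambda>w. lower X n w + real n) \<in> L2_plus M (F T)" using lX by (intro L2_lower_bounded AE_I2) auto
    have lb: "AE w in M. - real n \<le> lower X n w + Y w" using L2_plusD(2)[OF Y] by eventually_elim auto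
    have "(\<lambda>w. lower X n w + Y w + real n) = (\<lambda>w. (lower X n w + real n) + Y w)" by auto
    with Ec_lower_bounded[OF terminal(2) lXY lb]
    have "AE w in M. Ec 0 (\<lambda>w. lower X n w + Y w) w = E 0 T (\<lambda>w. (lower X n w + real n) + Y w) w - real n" by simp
    with conditional_domination[OF terminal(2) P Y sol(1)] sol(2) Ec_lower[OF terminal(2) X, of n]
    show "AE w in M. Ec 0 (\<lambda>w. lower X n w + Y w) w \<le> Ec 0 (lower X n) w + c"
      by eventually_elim simp
  qed (intro Ec_L2_terminal(2) terminal XY lXY lX X L2_add subalgebra_refl L2_const)+
  from Eh_leI[OF XY X this] sol(3) show ?thesis by auto
qed

lemma Eh_translation_const:
  assumes "X \<in> L2 M (F T)"
  shows "Eh (\<lambda>w. X w + c) = Eh X + c"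
proof (rule Eh_eqI)
  show "(\<lambda>w. X w + c) \<in> L2 M (F T)" using assms by (intro L2_add) auto
  show "AE w in M. Ec 0 (\<lambda>w. X w + c) w = Eh X + c"
    using Ec_translation[OF terminal(2) assms L2_const[of c]] Ec_0_eq[OF assms] by eventually_elim simp
qed

text \<open>Under each Girsanov density \<open>\<Gamma>\<close>, \<open>2 Z \<le> l \<Gamma> Z + 1 / (l \<Gamma>)\<close> by AM-GM, and the reciprocals
  \<open>1 / \<Gamma>\<close> are bounded in mean.\<close>

lemma g_expectation_strict:
  assumes Z: "Z \<in> L2 M M" "AE w in M. 0 \<le> Z w \<and> Z w \<le> 1"
    and g: "has_g_expectation M F B T \<mu> (\<lambda>w. 1 - Z w) c" and c: "1 \<le> c"
  shows "AE w in M. Z w = 0"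
proof -
  have V: "(\<lambda>w. 1 - Z w) \<in> L2 M M" by (intro L2_diff Z) auto
  have iZ: "integrable M Z" by (rule L2_integrable[OF Z(1)])
  have bound: "2 * (\<integral>w. Z w \<partial>M) \<le> exp (\<mu>\<^sup>2 * T) / l" if l: "0 < l" for l
  proof -
    \<comment> \<open>The mean of \<open>\<Gamma> (1 - Z)\<close> is \<open>1\<close> minus that of
      \<open>\<Gamma> Z\<close>, and the latter is bounded below by taking means in the AM-GM
      inequality. The bound depends on no particular \<open>\<Gamma>\<close>.\<close>
    have "c \<le> 1 - (2 * (\<integral>w. Z w \<partial>M) - exp (\<mu>\<^sup>2 * T) / l) / l"
    proof (rule g_expectation_le_const[OF V g])
      fix \<Gamma> assume \<Gamma>: "girsanov_density \<mu> 0 \<Gamma>"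
      note facts = girsanov_density_facts[OF \<Gamma> terminal(2)]
      have i1: "integrable M \<Gamma>" "(\<integral>w. \<Gamma> w \<partial>M) = 1"
      proof -
        have "has_bochner_integral M (\<lambda>w. \<Gamma> w * 1) (\<integral>w. 1 \<partial>M)" by (rule facts(6)) auto
        thus "integrable M \<Gamma>" "(\<integral>w. \<Gamma> w \<partial>M) = 1" by (auto simp: has_bochner_integral_iff prob_space)
      qed
      have i2: "integrable M (\<lambda>w. \<Gamma> w * Z w)" by (intro L2_integrable_mult facts Z)
      have "2 * (\<integral>w. Z w \<partial>M) = (\<integral>w. 2 * Z w \<partial>M)" by simp
      also have "\<dots> \<le> (\<integral>w. l * (\<Gamma> w * Z w) + (1 / l) * (1 / \<Gamma> w) \<partial>M)"
      proof (rule integral_mono_AE)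
        show "AE w in M. 2 * Z w \<le> l * (\<Gamma> w * Z w) + (1 / l) * (1 / \<Gamma> w)"
          using Z(2)
        proof eventually_elim
          case (elim w)
          define x where "x = l * \<Gamma> w"
          have x: "0 < x" using l facts(1)[of w] by (simp add: x_def)
          have "2 \<le> x + 1 / x"
            using x zero_le_power2[of "x - 1"] by (simp add: field_simps power2_eq_square)
          hence "2 * Z w \<le> (x + 1 / x) * Z w" using elim by (intro mult_right_mono) auto
          also have "\<dots> = x * Z w + 1 / x * Z w" by (rule distrib_right)
          also have "\<dots> \<le> x * Z w + 1 / x * 1" using elim x by (intro add_left_mono mult_left_mono) auto
          finally show ?case by (simp add: x_def mult.assoc)
        qed
      qed (intro Bochner_Integration.integrable_add integrable_mult_right iZ i2 facts(2))+
      also have "\<dots> = l * (\<integral>w. \<Gamma> w * Z w \<partial>M) + (1 / l) * (\<integral>w. 1 / \<Gamma> w \<partial>M)"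
        using i2 facts(2) by (subst Bochner_Integration.integral_add) (auto simp only: integrable_mult_right integral_mult_right_zero)
      also have "\<dots> \<le> l * (\<integral>w. \<Gamma> w * Z w \<partial>M) + (1 / l) * exp (\<mu>\<^sup>2 * T)"
        using facts(3) l by (intro add_left_mono mult_left_mono) auto
      finally have "(2 * (\<integral>w. Z w \<partial>M) - exp (\<mu>\<^sup>2 * T) / l) / l \<le> (\<integral>w. \<Gamma> w * Z w \<partial>M)"
        using l by (simp add: pos_divide_le_eq mult.commute)
      moreover have "(\<integral>w. \<Gamma> w * (1 - Z w) \<partial>M) = 1 - (\<integral>w. \<Gamma> w * Z w \<partial>M)"
        using i1 i2 by (simp add: right_diff_distrib)
      ultimately show "(\<integral>w. \<Gamma> w * (1 - Z w) \<partial>M) \<le> 1 - (2 * (\<integral>w. Z w \<partial>M) - exp (\<mu>\<^sup>2 * T) / l) / l"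
        by linarith
    qed
    \<comment> \<open>Since \<open>1 \<le> c\<close>, the numerator cannot be positive; sending
      \<open>l\<close> to infinity then leaves no room for a positive mean of
      \<open>Z\<close>.\<close>
    hence "(2 * (\<integral>w. Z w \<partial>M) - exp (\<mu>\<^sup>2 * T) / l) / l \<le> 0" using c by linarith
    thus ?thesis using l by (simp add: divide_le_0_iff)
  qed
  have lim: "((\<lambda>l. exp (\<mu>\<^sup>2 * T) / l) \<longlongrightarrow> 0) at_top"
    by (rule tendsto_divide_0[OF tendsto_const filterlim_at_top_imp_at_infinity[OF filterlim_ident]])
  have "2 * (\<integral>w. Z w \<partial>M) \<le> 0"
    by (rule tendsto_lowerbound[OF lim]) (use bound in \<open>auto intro!: eventually_mono[OF eventually_gt_at_top[of 0]]\<close>)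
  moreover have nn: "AE w in M. 0 \<le> Z w" using Z(2) by eventually_elim simp
  moreover have "0 \<le> (\<integral>w. Z w \<partial>M)" by (rule integral_nonneg_AE[OF nn])
  ultimately have "(\<integral>w. Z w \<partial>M) = 0" by linarith
  thus ?thesis using integral_nonneg_eq_0_iff_AE[OF iZ nn] by simp
qed

text \<open>The truncated gap \<open>Z\<close> is completed to \<open>1\<close>: \<open>Eh X + 1 =
  Eh (X + Z + (1 - Z)) \<le> Eh (X + Z) + c \<le> Eh Y + c\<close>, where \<open>c\<close> is a
  \<open>g\<close>-expectation of \<open>1 - Z\<close>. Equality of \<open>Eh X\<close> and
  \<open>Eh Y\<close> gives \<open>1 \<le> c\<close>, which strict comparison permits only for
  \<open>Z = 0\<close>.\<close>

lemma Eh_strict_mono: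
  assumes X: "X \<in> L2 M (F T)" and Y: "Y \<in> L2 M (F T)" and le: "AE w in M. X w \<le> Y w" and eq: "Eh X = Eh Y"
  shows "AE w in M. Y w = X w"
proof -
  \<comment> \<open>Truncation at \<open>1\<close> keeps \<open>1 - Z\<close> nonnegative, as
    domination requires, and \<open>Z\<close> still vanishes only where the gap does.\<close>
  define Z where "Z w = min 1 (max 0 (Y w - X w))" for w
  have sub: "subalgebra M (F T)" by simp
  have [measurable]: "X \<in> borel_measurable (F T)" "Y \<in> borel_measurable (F T)"
    using L2_D(1)[OF sub] X Y by auto
  have Z: "Z \<in> L2 M (F T)"
    by (rule L2_bound[OF sub _ sub L2_const[of 1]]) (auto simp: Z_def[abs_def])
  have V: "(\<lambda>w. 1 - Z w) \<in> L2_plus M (F T)"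
    by (intro L2_plusI L2_diff[OF sub L2_const Z] AE_I2) (simp add: Z_def)
  have XZ: "(\<lambda>w. X w + Z w) \<in> L2 M (F T)" by (rule L2_add[OF sub X Z])
  obtain c where c: "has_g_expectation M F B T \<mu> (\<lambda>w. 1 - Z w) c"
    "Eh (\<lambda>w. (X w + Z w) + (1 - Z w)) - Eh (\<lambda>w. X w + Z w) \<le> c"
    using Eh_dominated[OF XZ V] by blast
  have "Eh (\<lambda>w. (X w + Z w) + (1 - Z w)) = Eh X + 1" using Eh_translation_const[OF X, of 1] by simp
  moreover have "Eh (\<lambda>w. X w + Z w) \<le> Eh Y"
    using le by (intro Eh_mono XZ Y) (auto elim!: eventually_mono simp: Z_def)
  ultimately have "1 \<le> c" using c(2) eq by simp
  have "AE w in M. Z w = 0"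
    by (rule g_expectation_strict[OF L2_ambient[OF Z order_refl] _ c(1) \<open>1 \<le> c\<close>]) (auto simp: Z_def)
  with le show ?thesis by eventually_elim (auto simp: Z_def min_def max_def split: if_splits)
qed

text \<open>Applying the operator at time \<open>0\<close> to both conditional values reduces the
  claim to the unconditional one.\<close>

lemma Ec_strict_mono:
  assumes X: "X \<in> L2 M (F T)" and Y: "Y \<in> L2 M (F T)" and le: "AE w in M. X w \<le> Y w"
    and t: "t \<in> {0..T}" and eq: "AE w in M. Ec t Y w = Ec t X w"
  shows "AE w in M. Y w = X w"
proof (rule Eh_strict_mono[OF X Y le], rule Eh_eqI[OF X])
  have t0: "0 \<le> (0::real)" "0 \<le> t" "t \<le> T" using t by auto
  have "AE w in M. Ec 0 (Ec t Y) w = Ec 0 (Ec t X) w" by (intro Ec_cong terminal Ec_L2_terminal t X Y eq)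
  with Ec_tower[OF t0 X] Ec_tower[OF t0 Y] Ec_0_eq[OF Y]
  show "AE w in M. Ec 0 X w = Eh Y" by eventually_elim simp
qed

section \<open>Consistency of the extended expectation\<close>

lemma Eh_const: "Eh (\<lambda>w. c) = c"
  by (intro Eh_eqI Ec_id terminal L2_const)

text \<open>The indicator enters the conditional value because \<open>A\<close> is known at time
  \<open>t\<close>; the tower property then removes the conditioning.\<close>

lemma Eh_conditional:
  assumes t: "t \<in> {0..T}" and Y: "Y \<in> L2 M (F T)" and A: "A \<in> sets (F t)"
  shows "Eh (\<lambda>w. Ec t Y w * indicator A w) = Eh (\<lambda>w. Y w * indicator A w)"
proof (rule Eh_eqI)
  have AT: "A \<in> sets (F T)" using A t sets_augmented_mono[of t T] by auto
  have L: "(\<lambda>w. Z w * indicator A w) \<in> L2 M (F T)" if "Z \<in> L2 M (F T)" for Z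
    using L2_indicator[OF _ AT that] by (simp add: mult.commute)
  show EY: "(\<lambda>w. Ec t Y w * indicator A w) \<in> L2 M (F T)" by (intro L Ec_L2_terminal t Y)
  have t0: "0 \<le> (0::real)" "0 \<le> t" "t \<le> T" using t by auto
  have "AE w in M. Ec t (\<lambda>w. Y w * indicator A w) w = Ec t Y w * indicator A w"
    using Ec_indicator[OF t A Y] by (simp add: mult.commute)
  hence "AE w in M. Ec 0 (Ec t (\<lambda>w. Y w * indicator A w)) w = Ec 0 (\<lambda>w. Ec t Y w * indicator A w) w"
    by (intro Ec_cong terminal Ec_L2_terminal t L[OF Y] EY)
  with Ec_tower[OF t0 L[OF Y]] Ec_0_eq[OF L[OF Y]]
  show "AE w in M. Ec 0 (\<lambda>w. Ec t Y w * indicator A w) w = Eh (\<lambda>w. Y w * indicator A w)"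
    by eventually_elim simp
qed

text \<open>On the event where the inequality fails the two variables are ordered the other way, so
  equality of the expectations there and strict monotonicity make them equal on it.\<close>

lemma Eh_determines_le:
  assumes t: "t \<in> {0..T}" and \<eta>: "\<eta> \<in> L2 M (F t)" and \<zeta>: "\<zeta> \<in> L2 M (F t)"
    and eq: "\<And>A. A \<in> sets (F t) \<Longrightarrow> Eh (\<lambda>w. \<eta> w * indicator A w) = Eh (\<lambda>w. \<zeta> w * indicator A w)"
  shows "AE w in M. \<eta> w \<le> \<zeta> w"
proof -
  define A where "A = {w \<in> space (F t). \<zeta> w < \<eta> w}"
  have sub: "subalgebra M (F t)" using t by simp
  have [measurable]: "\<eta> \<in> borel_measurable (F t)" "\<zeta> \<in> borel_measurable (F t)"
    using L2_D(1)[OF sub] \<eta> \<zeta> by auto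
  have A: "A \<in> sets (F t)" unfolding A_def by measurable
  have L: "(\<lambda>w. Z w * indicator A w) \<in> L2 M (F T)" if "Z \<in> L2 M (F t)" for Z
    using L2_filtration_mono[OF L2_indicator[OF sub A that], of T] t by (simp add: mult.commute)
  have "AE w in M. \<eta> w * indicator A w = \<zeta> w * indicator A w"
    by (rule Eh_strict_mono[OF L[OF \<zeta>] L[OF \<eta>] _ eq[OF A, symmetric]]) (auto simp: A_def indicator_def)
  thus ?thesis using AE_space by eventually_elim (auto simp: A_def indicator_def split: if_splits)
qed

lemma Eh_consistent: "consistent_expectation M F T Eh"
  unfolding consistent_expectation_def
proof (intro conjI ballI allI impI)
  fix Y1 Y2 assume Y: "Y1 \<in> L2 M (F T)" "Y2 \<in> L2 M (F T)" and le: "AE w in M. Y1 w \<le> Y2 w"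
  show "Eh Y1 \<le> Eh Y2" by (rule Eh_mono[OF Y le])
  assume "Eh Y1 = Eh Y2"
  from Eh_strict_mono[OF Y le this] show "AE w in M. Y1 w = Y2 w" by eventually_elim simp
next
  show "Eh (\<lambda>w. c) = c" for c by (rule Eh_const)
next
  fix t Y assume t: "t \<in> {0..T}" and Y: "Y \<in> L2 M (F T)"
  show "\<exists>\<eta>\<in>L2 M (F t).
          (\<forall>A\<in>sets (F t). Eh (\<lambda>w. \<eta> w * indicator A w) = Eh (\<lambda>w. Y w * indicator A w)) \<and>
          (\<forall>\<eta>'\<in>L2 M (F t).
             (\<forall>A\<in>sets (F t). Eh (\<lambda>w. \<eta>' w * indicator A w) = Eh (\<lambda>w. Y w * indicator A w))
             \<longrightarrow> (AE w in M. \<eta>' w = \<eta> w))"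
  proof (intro bexI[of _ "Ec t Y"] conjI ballI impI)
    show EY: "Ec t Y \<in> L2 M (F t)" by (rule ext_cond_limit(1)[OF t Y])
    show EA: "Eh (\<lambda>w. Ec t Y w * indicator A w) = Eh (\<lambda>w. Y w * indicator A w)" if "A \<in> sets (F t)" for A
      by (rule Eh_conditional[OF t Y that])
    fix \<eta> assume \<eta>: "\<eta> \<in> L2 M (F t)"
      and eq: "\<forall>A\<in>sets (F t). Eh (\<lambda>w. \<eta> w * indicator A w) = Eh (\<lambda>w. Y w * indicator A w)"
    have "AE w in M. \<eta> w \<le> Ec t Y w" "AE w in M. Ec t Y w \<le> \<eta> w"
      by (rule Eh_determines_le[OF t]; use \<eta> EY EA eq in simp)+
    thus "AE w in M. \<eta> w = Ec t Y w" by eventually_elim simp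
  qed
qed

end

theorem theorem2p4:
  fixes M :: "'a measure"
    and B :: "real \<Rightarrow> 'a \<Rightarrow> real ^ 'd"
    and F :: "real \<Rightarrow> 'a measure"
    and T \<mu> :: real
    and E :: "real \<Rightarrow> real \<Rightarrow> ('a \<Rightarrow> real) \<Rightarrow> 'a \<Rightarrow> real"
    and Ec :: "real \<Rightarrow> ('a \<Rightarrow> real) \<Rightarrow> 'a \<Rightarrow> real"
    and Eh :: "('a \<Rightarrow> real) \<Rightarrow> real"
  assumes "0 < T"
    and "brownian_motion M T B"
    and "F = augmented_filtration M B"
    and "consistent_operator_zero_floor M F T E"
    and "0 < \<mu>"
    and a: "\<forall>X\<in>L2_plus M (F T). \<forall>Y\<in>L2_plus M (F T).
      \<exists>c. has_g_expectation M F B T \<mu> Y c \<and>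
        (AE \<omega> in M. E 0 T (\<lambda>\<omega>. X \<omega> + Y \<omega>) \<omega> - E 0 T X \<omega> \<le> c)"
    and b: "\<forall>t\<in>{0..T}. \<forall>X\<in>L2_plus M (F T). \<forall>Y\<in>L2_plus M (F t).
      AE \<omega> in M. E t T (\<lambda>\<omega>. X \<omega> + Y \<omega>) \<omega> = E t T X \<omega> + Y \<omega>"
    and "Ec = ext_cond M F T E"
    and "Eh = ext M F T E"
  shows
    "(\<forall>X\<in>L2 M (F T). \<forall>Y\<in>L2_plus M (F T).
       \<exists>c. has_g_expectation M F B T \<mu> Y c \<and> Eh (\<lambda>\<omega>. X \<omega> + Y \<omega>) - Eh X \<le> c) \<and>
     (\<forall>t\<in>{0..T}. \<forall>X\<in>L2 M (F T). \<forall>Y\<in>L2 M (F t).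
       AE \<omega> in M. Ec t (\<lambda>\<omega>. X \<omega> + Y \<omega>) \<omega> = Ec t X \<omega> + Y \<omega>) \<and>
     (\<forall>X\<in>L2 M (F T). \<forall>Y\<in>L2 M (F T). (AE \<omega> in M. X \<omega> \<le> Y \<omega>) \<longrightarrow>
       (\<forall>t\<in>{0..T}. AE \<omega> in M. Ec t X \<omega> \<le> Ec t Y \<omega>) \<and>
       ((\<exists>t\<in>{0..T}. AE \<omega> in M. Ec t Y \<omega> = Ec t X \<omega>) \<longrightarrow> (AE \<omega> in M. Y \<omega> = X \<omega>))) \<and>
     (\<forall>t\<in>{0..T}. \<forall>Y\<in>L2 M (F t). AE \<omega> in M. Ec t Y \<omega> = Y \<omega>) \<and>
     (\<forall>s t. 0 \<le> s \<and> s \<le> t \<and> t \<le> T \<longrightarrow>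
       (\<forall>X\<in>L2 M (F T). AE \<omega> in M. Ec s (Ec t X) \<omega> = Ec s X \<omega>)) \<and>
     (\<forall>t\<in>{0..T}. \<forall>A\<in>sets (F t). \<forall>X\<in>L2 M (F T).
       AE \<omega> in M. Ec t (\<lambda>\<omega>. indicator A \<omega> * X \<omega>) \<omega> = indicator A \<omega> * Ec t X \<omega>) \<and>
     consistent_expectation M F T Eh"
proof -
  let ?F = "augmented_filtration M B"
  have "prob_space M" using assms(2) by (simp add: brownian_motion_def)
  then interpret prob_space M .
  interpret floor_operator M T B \<mu> E
  proof unfold_locales
    show "0 < T" "brownian_motion M T B" "0 < \<mu>" by fact+
    show "consistent_operator_zero_floor M ?F T E"
      using assms(3,4) by simp
    show "\<exists>c. has_g_expectation M ?F B T \<mu> Y c \<and>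
        (AE \<omega> in M. E 0 T (\<lambda>\<omega>. X \<omega> + Y \<omega>) \<omega> - E 0 T X \<omega> \<le> c)"
      if "X \<in> L2_plus M (?F T)" "Y \<in> L2_plus M (?F T)" for X Y
      using a that unfolding assms(3) by blast
    show "AE \<omega> in M. E t T (\<lambda>\<omega>. X \<omega> + Y \<omega>) \<omega> = E t T X \<omega> + Y \<omega>"
      if "t \<in> {0..T}" "X \<in> L2_plus M (?F T)" "Y \<in> L2_plus M (?F t)"
      for t X Y
      using b that unfolding assms(3) by blast
  qed
  show ?thesis
    unfolding assms(3) \<open>Ec = ext_cond M F T E\<close> \<open>Eh = ext M F T E\<close>
  proof (intro conjI ballI impI allI; (elim conjE bexE)?)
    show "\<exists>c. has_g_expectation M ?F B T \<mu> Y c \<and>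
        ext M ?F T E (\<lambda>\<omega>. X \<omega> + Y \<omega>) - ext M ?F T E X \<le> c"
      if "X \<in> L2 M (?F T)" "Y \<in> L2_plus M (?F T)" for X Y
      by (rule Eh_dominated[OF that])
  qed (rule Ec_translation Ec_mono Ec_id Ec_tower Ec_indicator Eh_consistent Ec_strict_mono; assumption)+
qed

end
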